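(* Consider solutions $(R,W,q,a)$, $t\ge0$, of the system $$R_{xx}-R_{tt}=0,$$ $$W_{tt}-W_{xx}+\frac{R_t}{R}W_t-\frac{R_x}{R}W_x+\frac{q_t^2-q_x^2}{2}e^{-4W}=0,$$ $$q_{tt}-q_{xx}+\frac{R_t}{R}q_t-\frac{R_x}{R}q_x-4q_tW_t+4q_xW_x=0,$$ $$a_{tt}-a_{xx}+\frac{R_x^2-R_t^2}{4R^2}+W_t^2-W_x^2+\tfrac14(q_t^2-q_x^2)e^{-4W}=0,$$ whose initial data satisfy $m_0(0)<2R_0/3$, $(R-R_b)(0,\cdot)\in C_0^3$, $\partial_t(R-R_b)(0,\cdot)\in C_0^2$, $(W-W_b)(0,\cdot)\in\widetilde H^3$, $\partial_t(W-W_b)(0,\cdot)\in\widetilde H^2$, $q(0,\cdot)\in\widetilde H^3$, $q_t(0,\cdot)\in\widetilde H^2$, $a(0,\cdot)\in C^2$, $a_t(0,\cdot)\in C^1$. Then for each $\epsilon>0$ there is $\delta>0$ such that: 1. If the initial data satisfy $\widetilde{\mathcal M}_3(0)+m_3(0)\le\delta$ and $\|a(0,\cdot)-a_b(0,\cdot)\|_{C^0}+\|a_t(0,\cdot)-\partial_ta_b(0,\cdot)\|_{L^1}\le\delta$, then $\|a(t,\cdot)-a_b(t,\cdot)\|_{C^0}\le\epsilon$ for all $t\ge0$. 2. If the initial data satisfy $\widetilde{\mathcal M}_3(0)+m_3(0)\le\delta$ and $\|a_x(0,\cdot)-\partial_xa_b(0,\cdot)\|_{C^0}+\|a_t(0,\cdot)-\partial_ta_b(0,\cdot)\|_{C^0}\le\delta$,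 then $\|a_x(t,\cdot)-\partial_xa_b(t,\cdot)\|_{C^0}+\|a_t(t,\cdot)-\partial_ta_b(t,\cdot)\|_{C^0}\le\epsilon$ for all $t\ge0$.
   Context: All unknowns are real functions of $(t,x)$, $x\in\mathbb{R}$. The background (polarized double cusp) is fixed: with constants $R_0>0$, $W_0\neq0$, $W_1,a_0\in\mathbb{R}$, $$R_b=R_0e^{2t}\cosh(2x),\quad W_b=W_1+W_0\arctan(e^{2x}),\quad q_b=0,$$ $$a_b=a_0-\left(\tfrac12+\tfrac{W_0^2}{2}\right)\tfrac12\ln(\cosh(2x))+\left(\tfrac32+\tfrac{W_0^2}{2}\right)t.$$ Norms are taken in $x\in\mathbb{R}$ at fixed $t$ ($\|\cdot\|_{C^0}$ is the sup norm): $$m_0(t)=\|R-R_b\|_{C^0}+\|R_t-\partial_tR_b\|_{C^0},\qquad m_k(t)=\|R-R_b\|_{C^k}+\|R_t-\partial_tR_b\|_{C^{k-1}}\ (k\ge1),$$ $$\widetilde{\mathcal M}_k(t)=\|W-W_b\|_{\widetilde H^k}+\|\partial_t(W-W_b)\|_{\widetilde H^{k-1}}+\|q\|_{\widetilde H^k}+\|\partial_tq\|_{\widetilde H^{k-1}}.$$ $\widetilde H^k$ is the completion of $C_c^\infty(\mathbb{R})$ in the norm $\|f\|_{\widetilde H^k}^2=\sum_{i=0}^k\int_{\mathbb{R}}(f^{(i)}(x))^2\cosh(2x)\,dx$. $C_0^k$ is the space of $C^k$ functions $f$ on $\mathbb{R}$ with $f^{(i)}(x)\to0$ as $|x|\to\infty$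 for every $i\le k$. Under the stated assumptions on $(R,W,q)$, the $C^2$ solution is unique and defined for all $t\ge0$. *)

theory Defs
  imports "HOL-Analysis.Analysis"
begin

section \<open>Function spaces and norms on the real line\<close>

definition Ck :: "nat \<Rightarrow> (real \<Rightarrow> real) \<Rightarrow> bool" where
  "Ck k f \<longleftrightarrow> (\<forall>i<k. \<forall>x. (deriv ^^ i) f differentiable (at x)) \<and>
     continuous_on UNIV ((deriv ^^ k) f)"

definition C0k :: "nat \<Rightarrow> (real \<Rightarrow> real) \<Rightarrow> bool" where
  "C0k k f \<longleftrightarrow> Ck k f \<and> (\<forall>i\<le>k. ((deriv ^^ i) f \<longlongrightarrow> 0) at_infinity)"

definition test_fun :: "(real \<Rightarrow> real) \<Rightarrow> bool" where
  "test_fun \<phi> \<longleftrightarrow> (\<forall>k. Ck k \<phi>) \<and> compact (closure {x. \<phi> x \<noteq> 0})"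

text \<open>All norms take values in the extended nonnegative reals, so that an unbounded function
  has norm \<open>\<infinity>\<close> and no finiteness has to be assumed separately.\<close>

definition C0_norm :: "(real \<Rightarrow> real) \<Rightarrow> ennreal" where
  "C0_norm f = (SUP x. ennreal \<bar>f x\<bar>)"

definition Ck_norm :: "nat \<Rightarrow> (real \<Rightarrow> real) \<Rightarrow> ennreal" where
  "Ck_norm k f = (\<Sum>i\<le>k. C0_norm ((deriv ^^ i) f))"

definition L1_norm :: "(real \<Rightarrow> real) \<Rightarrow> ennreal" where
  "L1_norm f = (\<integral>\<^sup>+x. ennreal \<bar>f x\<bar> \<partial>lborel)"

text \<open>The completion of the test functions in the \<open>k\<close>-th order Sobolev norm with weight \<open>cosh (2x)\<close> is
  realised inside the weighted \<open>L\<^sup>2\<close> space: \<open>f\<close> belongs to it iff some sequence of test functions,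
  Cauchy in that norm, converges to \<open>f\<close> in weighted \<open>L\<^sup>2\<close>. By completeness of \<open>L\<^sup>2\<close> the \<open>i\<close>-th
  derivatives of the sequence then converge to functions \<open>g i\<close>, with \<open>g 0 = f\<close> almost everywhere;
  these are the weak derivatives \<open>f\<^sup>(\<^sup>i\<^sup>)\<close>, which need not be classical derivatives.\<close>

definition Ht_derivs :: "nat \<Rightarrow> (real \<Rightarrow> real) \<Rightarrow> (nat \<Rightarrow> real \<Rightarrow> real) \<Rightarrow> bool" where
  "Ht_derivs k f g \<longleftrightarrow>
     (AE x in lborel. g 0 x = f x) \<and> (\<forall>i\<le>k. g i \<in> borel_measurable borel) \<and>
     (\<exists>\<phi>. (\<forall>n. test_fun (\<phi> n)) \<and>
       (\<forall>i\<le>k. (\<lambda>n. \<integral>\<^sup>+x. ennreal (((deriv ^^ i) (\<phi> n) x - g i x)\<^sup>2 * cosh (2 * x)) \<partial>lborel)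
                  \<longlonglongrightarrow> 0))"

definition Ht :: "nat \<Rightarrow> (real \<Rightarrow> real) set" where
  "Ht k = {f. \<exists>g. Ht_derivs k f g}"

text \<open>The weak derivatives are unique up to null sets, so for \<open>f \<in> Ht k\<close> the infimum ranges over
  a single value; for \<open>f \<notin> Ht k\<close> it is the infimum of the empty set, that is \<open>\<infinity>\<close>. The
  integrals are finite because \<open>g i\<close> is a weighted \<open>L\<^sup>2\<close> limit of test functions.\<close>

definition Ht_norm :: "nat \<Rightarrow> (real \<Rightarrow> real) \<Rightarrow> ennreal" where
  "Ht_norm k f = (INF g \<in> {g. Ht_derivs k f g}.
     ennreal (sqrt (\<Sum>i\<le>k. \<integral>x. (g i x)\<^sup>2 * cosh (2 * x) \<partial>lborel)))"

section \<open>Functions of time and space on \<open>t \<ge> 0\<close>\<close>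

text \<open>Time derivatives are taken within \<open>{0..}\<close>: one-sided at \<open>t = 0\<close>, ordinary for \<open>t > 0\<close>.\<close>

definition pd_t :: "(real \<Rightarrow> real \<Rightarrow> real) \<Rightarrow> real \<Rightarrow> real \<Rightarrow> real" where
  "pd_t u t x = vector_derivative (\<lambda>s. u s x) (at t within {0..})"

definition pd_x :: "(real \<Rightarrow> real \<Rightarrow> real) \<Rightarrow> real \<Rightarrow> real \<Rightarrow> real" where
  "pd_x u t x = deriv (u t) x"

definition C1_tx :: "(real \<Rightarrow> real \<Rightarrow> real) \<Rightarrow> bool" where
  "C1_tx u \<longleftrightarrow>
     (\<forall>t\<ge>0. \<forall>x. (\<lambda>s. u s x) differentiable (at t within {0..}) \<and> u t differentiable (at x)) \<and>
     continuous_on ({0..} \<times> UNIV) (\<lambda>(t, x). pd_t u t x) \<and>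
     continuous_on ({0..} \<times> UNIV) (\<lambda>(t, x). pd_x u t x)"

definition C2_tx :: "(real \<Rightarrow> real \<Rightarrow> real) \<Rightarrow> bool" where
  "C2_tx u \<longleftrightarrow> C1_tx u \<and> C1_tx (pd_t u) \<and> C1_tx (pd_x u)"

section \<open>The system, its solutions, and the polarized double-cusp background\<close>

definition is_solution ::
  "(real \<Rightarrow> real \<Rightarrow> real) \<Rightarrow> (real \<Rightarrow> real \<Rightarrow> real) \<Rightarrow> (real \<Rightarrow> real \<Rightarrow> real) \<Rightarrow>
   (real \<Rightarrow> real \<Rightarrow> real) \<Rightarrow> bool" where
  "is_solution R W q a \<longleftrightarrow>
     C2_tx R \<and> C2_tx W \<and> C2_tx q \<and> C2_tx a \<and>
     (\<forall>t\<ge>0. \<forall>x.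
        pd_x (pd_x R) t x - pd_t (pd_t R) t x = 0 \<and>
        pd_t (pd_t W) t x - pd_x (pd_x W) t x
          + pd_t R t x / R t x * pd_t W t x - pd_x R t x / R t x * pd_x W t x
          + ((pd_t q t x)\<^sup>2 - (pd_x q t x)\<^sup>2) / 2 * exp (- 4 * W t x) = 0 \<and>
        pd_t (pd_t q) t x - pd_x (pd_x q) t x
          + pd_t R t x / R t x * pd_t q t x - pd_x R t x / R t x * pd_x q t x
          - 4 * pd_t q t x * pd_t W t x + 4 * pd_x q t x * pd_x W t x = 0 \<and>
        pd_t (pd_t a) t x - pd_x (pd_x a) t x
          + ((pd_x R t x)\<^sup>2 - (pd_t R t x)\<^sup>2) / (4 * (R t x)\<^sup>2)
          + (pd_t W t x)\<^sup>2 - (pd_x W t x)\<^sup>2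
          + 1 / 4 * ((pd_t q t x)\<^sup>2 - (pd_x q t x)\<^sup>2) * exp (- 4 * W t x) = 0)"

definition Rb :: "real \<Rightarrow> real \<Rightarrow> real \<Rightarrow> real" where
  "Rb R0 t x = R0 * exp (2 * t) * cosh (2 * x)"

definition Wb :: "real \<Rightarrow> real \<Rightarrow> real \<Rightarrow> real \<Rightarrow> real" where
  "Wb W0 W1 t x = W1 + W0 * arctan (exp (2 * x))"

definition ab :: "real \<Rightarrow> real \<Rightarrow> real \<Rightarrow> real \<Rightarrow> real" where
  "ab a0 W0 t x = a0 - (1/2 + W0\<^sup>2 / 2) * (1/2) * ln (cosh (2 * x)) + (3/2 + W0\<^sup>2 / 2) * t"

text \<open>With truncated subtraction \<open>0 - 1 = 0\<close>, the case \<open>k = 0\<close> is the separately defined \<open>m\<^sub>0\<close>,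
  where the \<open>C\<^sup>0\<close> norm is used for both terms.\<close>

definition m_norm :: "nat \<Rightarrow> real \<Rightarrow> (real \<Rightarrow> real \<Rightarrow> real) \<Rightarrow> real \<Rightarrow> ennreal" where
  "m_norm k R0 R t =
     Ck_norm k (\<lambda>x. R t x - Rb R0 t x) + Ck_norm (k - 1) (\<lambda>x. pd_t R t x - pd_t (Rb R0) t x)"

text \<open>Used for \<open>k \<ge> 1\<close> only.\<close>

definition M_norm :: "nat \<Rightarrow> real \<Rightarrow> real \<Rightarrow> (real \<Rightarrow> real \<Rightarrow> real) \<Rightarrow> (real \<Rightarrow> real \<Rightarrow> real) \<Rightarrow>
    real \<Rightarrow> ennreal" where
  "M_norm k W0 W1 W q t =
     Ht_norm k (\<lambda>x. W t x - Wb W0 W1 t x)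
     + Ht_norm (k - 1) (pd_t (\<lambda>t x. W t x - Wb W0 W1 t x) t)
     + Ht_norm k (q t) + Ht_norm (k - 1) (pd_t q t)"

definition admissible_data ::
  "real \<Rightarrow> real \<Rightarrow> real \<Rightarrow> (real \<Rightarrow> real \<Rightarrow> real) \<Rightarrow> (real \<Rightarrow> real \<Rightarrow> real) \<Rightarrow>
   (real \<Rightarrow> real \<Rightarrow> real) \<Rightarrow> (real \<Rightarrow> real \<Rightarrow> real) \<Rightarrow> bool" where
  "admissible_data R0 W0 W1 R W q a \<longleftrightarrow>
     m_norm 0 R0 R 0 < ennreal (2 * R0 / 3) \<and>
     C0k 3 (\<lambda>x. R 0 x - Rb R0 0 x) \<and>
     C0k 2 (pd_t (\<lambda>t x. R t x - Rb R0 t x) 0) \<and>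
     (\<lambda>x. W 0 x - Wb W0 W1 0 x) \<in> Ht 3 \<and>
     pd_t (\<lambda>t x. W t x - Wb W0 W1 t x) 0 \<in> Ht 2 \<and>
     q 0 \<in> Ht 3 \<and> pd_t q 0 \<in> Ht 2 \<and>
     Ck 2 (a 0) \<and> Ck 1 (pd_t a 0)"

end

theory Submission
  imports Defs
begin

text \<open>The solution is given for all \<open>t \<ge> 0\<close>, so only a priori bounds are at stake. They are obtained
pointwise, by looking backwards from one point \<open>(T, X)\<close> along the triangle on which the solution
there depends.

\<^emph>\<open>The area function.\<close> The difference \<open>r = R - R\<^sub>b\<close> solves the flat wave equation and grows at
most linearly in time, while \<open>R\<^sub>b\<close> grows like \<open>e\<^bsup>2t\<^esup> cosh (2x)\<close>. Hence the coefficients \<open>R\<^sub>t/R\<close> and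
\<open>R\<^sub>x/R\<close> approach their background values \<open>2\<close> and \<open>2 tanh (2x)\<close> at the rate \<open>e\<^bsup>-t\<^esup> / cosh (2x)\<close>
(\<open>areal_perturbation\<close>).

\<^emph>\<open>The linearised equations.\<close> Around the background, \<open>u = W - W\<^sub>b\<close> and \<open>q\<close> both solve
\<open>u\<^sub>t\<^sub>t - u\<^sub>x\<^sub>x + 2u\<^sub>t - 2(tanh (2x) - k / cosh (2x)) u\<^sub>x = \<dots>\<close>, with \<open>k = 0\<close> for \<open>u\<close> and \<open>k = 2W\<^sub>0\<close> for \<open>q\<close>.
The decisive fact is an identity: after multiplication by
\<open>e\<^sup>t cosh(2x)\<^bsup>1/2\<^esup> exp (-k arctan (e\<^bsup>2x\<^esup>))\<close> this becomes
\<open>v\<^sub>t\<^sub>t - v\<^sub>x\<^sub>x + (1 + k\<^sup>2) cosh(2x)\<^bsup>-2\<^esup> v = \<dots>\<close> (\<open>slope_identity\<close>). The potential is nonnegative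
however large \<open>W\<^sub>0\<close> is, so the energy of \<open>v\<close> is nonnegative and its flux through the sides of the
triangle controls \<open>v\<close> at the apex. Therefore \<open>v\<close> grows at most polynomially (\<open>wave_bound\<close>), and \<open>u\<close>,
\<open>q\<close> and their first derivatives decay like \<open>e\<^bsup>-3t/4\<^esup> cosh(2x)\<^bsup>-1/2\<^esup>\<close> (\<open>weighted_wave_bound\<close>).

\<^emph>\<open>The nonlinear equations.\<close> The remaining terms are quadratic, or carry the small factors
\<open>R\<^sub>t/R - 2\<close> and \<open>R\<^sub>x/R - 2 tanh (2x)\<close>. Measured with the weight \<open>e\<^sup>t cosh(2x)\<^bsup>1/2\<^esup>\<close>, they are bounded by a
small constant as long as the solution has the asserted decay (\<open>nonlinear_source_bounds\<close>). A first
time at which the decay fails exists on a compact triangle, and the linear estimate excludes it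
(\<open>perturbation_decay\<close>). The initial smallness that this needs, weighted sup bounds for \<open>u\<close>, \<open>q\<close> and
their first derivatives, follows from the weighted Sobolev norms (\<open>Ht_pointwise_bound\<close>,
\<open>Ht_pointwise_deriv_bound\<close>).

\<^emph>\<open>The metric function.\<close> For \<open>b = a - a\<^sub>b\<close> this gives
\<open>\<bar>b\<^sub>t\<^sub>t - b\<^sub>x\<^sub>x\<bar> \<le> \<kappa> e\<^bsup>-t/2\<^esup> / cosh (2x)\<close> with a small \<open>\<kappa>\<close> (\<open>metric_perturbation_source\<close>). This bound
is integrable over space-time, so d'Alembert's formula controls \<open>b\<close> (\<open>wave_duhamel_bound\<close>), and it is
integrable along null lines, which controls \<open>b\<^sub>t \<plusminus> b\<^sub>x\<close> (\<open>transport_bound\<close>).\<close>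

section \<open>Functions on the closed half-plane\<close>

text \<open>The suffix \<open>hp\<close> stands for the closed half-plane \<open>t \<ge> 0\<close>.\<close>

definition cont_hp :: "(real \<Rightarrow> real \<Rightarrow> real) \<Rightarrow> bool" where
  "cont_hp f \<longleftrightarrow> continuous_on ({0..} \<times> UNIV) (\<lambda>(t, x). f t x)"

text \<open>Naming the partial derivatives explicitly, rather than through the operators \<open>pd_t\<close> and
\<open>pd_x\<close>, lets transformed unknowns be introduced with formulas for their derivatives, without
first proving them differentiable.\<close>

definition has_partials ::
  "(real \<Rightarrow> real \<Rightarrow> real) \<Rightarrow> (real \<Rightarrow> real \<Rightarrow> real) \<Rightarrow> (real \<Rightarrow> real \<Rightarrow> real) \<Rightarrow> bool" where
  "has_partials u ut ux \<longleftrightarrow>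
     (\<forall>t\<ge>0. \<forall>x. ((\<lambda>s. u s x) has_real_derivative ut t x) (at t within {0..}) \<and>
                (u t has_real_derivative ux t x) (at x)) \<and>
     cont_hp ut \<and> cont_hp ux"

lemma cont_hp_compose:
  assumes "cont_hp f" "continuous_on S g" "continuous_on S h" "\<And>z. z \<in> S \<Longrightarrow> 0 \<le> g z"
  shows "continuous_on S (\<lambda>z. f (g z) (h z))"
proof -
  have "continuous_on S (\<lambda>z. (\<lambda>(t, x). f t x) (g z, h z))"
    by (rule continuous_on_compose2[OF assms(1)[unfolded cont_hp_def]])
      (use assms in \<open>auto intro!: continuous_intros\<close>)
  then show ?thesis by simp
qed

text \<open>Continuity of the space derivative alone upgrades the two partial derivatives to a Frechet
derivative, one-sided at \<open>t = 0\<close>; the chain rule along curves rests on this.\<close>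

lemma has_partials_frechet:
  assumes "has_partials u ut ux" "t \<ge> 0"
  shows "((\<lambda>(s, y). u s y) has_derivative (\<lambda>(ds, dy). ds * ut t x + dy * ux t x))
           (at (t, x) within {0..} \<times> UNIV)"
proof -
  have "((\<lambda>(s, y). u s y) has_derivative
      (\<lambda>(ds, dy). (\<lambda>h. h * ut t x) ds + blinfun_apply (blinfun_scaleR_left (ux t x)) dy))
      (at (t, x) within {0..} \<times> UNIV)"
  proof (rule has_derivative_partialsI)
    show "((\<lambda>s. u s x) has_derivative (\<lambda>h. h * ut t x)) (at t within {0..})"
      using assms by (simp add: has_partials_def has_field_derivative_def mult.commute[of _ "ut t x"])
    show "(u s has_derivative blinfun_apply (blinfun_scaleR_left (ux s y))) (at y within UNIV)"
      if "s \<in> {0..}" for s y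
      using assms that by (simp add: has_partials_def has_field_derivative_def mult.commute[of _ "ux s y"])
    have "continuous_on ({0..} \<times> UNIV) (\<lambda>(s, y). ux s y)"
      using assms by (simp add: has_partials_def cont_hp_def)
    then have "continuous_on ({0..} \<times> UNIV) (\<lambda>(s, y). blinfun_scaleR_left (ux s y) :: real \<Rightarrow>\<^sub>L real)"
      by (auto simp: case_prod_unfold intro!: continuous_intros bounded_linear.continuous_on[OF bounded_linear_blinfun_scaleR_left])
    then show "continuous (at (t, x) within {0..} \<times> UNIV) (\<lambda>(s, y). blinfun_scaleR_left (ux s y) :: real \<Rightarrow>\<^sub>L real)"
      using assms(2) by (auto simp: continuous_on_eq_continuous_within)
  qed auto
  then show ?thesis by (simp add: case_prod_unfold)
qed

lemma has_partials_cont: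
  assumes "has_partials u ut ux" shows "cont_hp u"
  unfolding cont_hp_def continuous_on_eq_continuous_within
proof
  fix p :: "real \<times> real" assume "p \<in> {0..} \<times> UNIV"
  then obtain t x where "p = (t, x)" "t \<ge> 0" by auto
  then show "continuous (at p within {0..} \<times> UNIV) (\<lambda>(t, x). u t x)"
    using has_derivative_continuous[OF has_partials_frechet[OF assms, of t x]] by auto
qed

lemma has_partials_along:
  assumes u: "has_partials u ut ux" and "s \<ge> 0"
    and b: "(b has_real_derivative b') (at s within {0..})"
  shows "((\<lambda>s. u s (b s)) has_real_derivative ut s (b s) + b' * ux s (b s)) (at s within {0..})"
proof -
  have g: "((\<lambda>s. (s, b s)) has_derivative (\<lambda>h. (h, h * b'))) (at s within {0..})"
    using b by (auto intro!: derivative_eq_intros simp: has_field_derivative_def mult.commute[of _ b'])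
  have f: "((\<lambda>(s, y). u s y) has_derivative (\<lambda>(ds, dy). ds * ut s (b s) + dy * ux s (b s)))
      (at (s, b s) within (\<lambda>s. (s, b s)) ` {0..})"
    by (rule has_derivative_subset[OF has_partials_frechet[OF u \<open>s \<ge> 0\<close>]]) auto
  have "((\<lambda>(s, y). u s y) \<circ> (\<lambda>s. (s, b s)) has_derivative
     (\<lambda>(ds, dy). ds * ut s (b s) + dy * ux s (b s)) \<circ> (\<lambda>h. (h, h * b'))) (at s within {0..})"
    by (rule diff_chain_within[OF g f])
  moreover have "(\<lambda>(ds, dy). ds * ut s (b s) + dy * ux s (b s)) \<circ> (\<lambda>h. (h, h * b')) =
      (*) (ut s (b s) + b' * ux s (b s))"
    by (auto simp: fun_eq_iff algebra_simps)
  ultimately show ?thesis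
    by (simp add: has_field_derivative_def o_def)
qed

lemma has_partials_pd:
  assumes "has_partials u ut ux" "t \<ge> 0"
  shows "pd_t u t x = ut t x" "pd_x u t x = ux t x"
proof -
  have "((\<lambda>s. u s x) has_vector_derivative ut t x) (at t within {0..})"
    using assms by (simp add: has_partials_def has_real_derivative_iff_has_vector_derivative)
  moreover have "at t within {0..} \<noteq> bot"
  proof -
    have "at_right t \<le> at t within {0..}"
      using assms(2) by (intro at_le) auto
    then show ?thesis
      using trivial_limit_at_right_real[of t] by (auto simp: bot_unique)
  qed
  ultimately show "pd_t u t x = ut t x"
    unfolding pd_t_def by (simp add: vector_derivative_within)
  show "pd_x u t x = ux t x"
    unfolding pd_x_def using assms by (auto simp: has_partials_def intro: DERIV_imp_deriv)
qed

lemma C1_tx_has_partials: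
  assumes "C1_tx u" shows "has_partials u (pd_t u) (pd_x u)"
proof -
  have "((\<lambda>s. u s x) has_real_derivative pd_t u t x) (at t within {0..})"
    "(u t has_real_derivative pd_x u t x) (at x)" if "t \<ge> 0" for t x
    using assms that
    by (auto simp: C1_tx_def pd_t_def pd_x_def has_real_derivative_iff_has_vector_derivative
        simp flip: vector_derivative_works)
       (auto simp: DERIV_deriv_iff_real_differentiable
        simp flip: has_real_derivative_iff_has_vector_derivative)
  then show ?thesis
    using assms by (simp add: has_partials_def C1_tx_def cont_hp_def)
qed

lemma has_partials_cong:
  assumes "has_partials u ut ux"
    and "\<And>t x. t \<ge> 0 \<Longrightarrow> u' t x = u t x" "\<And>t x. t \<ge> 0 \<Longrightarrow> ut' t x = ut t x"
        "\<And>t x. t \<ge> 0 \<Longrightarrow> ux' t x = ux t x"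
  shows "has_partials u' ut' ux'"
proof -
  have "((\<lambda>s. u' s x) has_real_derivative ut' t x) (at t within {0..})"
    "(u' t has_real_derivative ux' t x) (at x)" if "t \<ge> 0" for t x
  proof -
    show "((\<lambda>s. u' s x) has_real_derivative ut' t x) (at t within {0..})"
      by (rule has_field_derivative_transform_within[where f = "\<lambda>s. u s x" and d = 1])
        (use assms that in \<open>auto simp: has_partials_def\<close>)
    have "u' t = u t" using assms that by auto
    then show "(u' t has_real_derivative ux' t x) (at x)"
      using assms that by (simp add: has_partials_def)
  qed
  moreover have "cont_hp g" if "cont_hp f" "\<And>t x. t \<ge> 0 \<Longrightarrow> g t x = f t x" for f g
    using that(1) unfolding cont_hp_def
    by (rule continuous_on_eq) (use that(2) in auto)
  ultimately show ?thesis using assms unfolding has_partials_def by metis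
qed

lemma cont_hp_intros:
  "cont_hp (\<lambda>t x. c)"
  "cont_hp f \<Longrightarrow> cont_hp g \<Longrightarrow> cont_hp (\<lambda>t x. f t x + g t x)"
  "cont_hp f \<Longrightarrow> cont_hp g \<Longrightarrow> cont_hp (\<lambda>t x. f t x - g t x)"
  "cont_hp f \<Longrightarrow> cont_hp g \<Longrightarrow> cont_hp (\<lambda>t x. f t x * g t x)"
  "cont_hp f \<Longrightarrow> cont_hp (\<lambda>t x. \<bar>f t x\<bar>)"
  "continuous_on UNIV h \<Longrightarrow> cont_hp (\<lambda>t x. h x)"
  "continuous_on UNIV h \<Longrightarrow> cont_hp (\<lambda>t x. h t)"
  unfolding cont_hp_def case_prod_unfold
  by (auto intro!: continuous_intros intro: continuous_on_compose2)

lemma has_partials_add: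
  assumes "has_partials u ut ux" "has_partials v vt vx"
  shows "has_partials (\<lambda>t x. u t x + v t x) (\<lambda>t x. ut t x + vt t x) (\<lambda>t x. ux t x + vx t x)"
  using assms by (auto simp: has_partials_def intro!: derivative_intros cont_hp_intros)

lemma has_partials_diff:
  assumes "has_partials u ut ux" "has_partials v vt vx"
  shows "has_partials (\<lambda>t x. u t x - v t x) (\<lambda>t x. ut t x - vt t x) (\<lambda>t x. ux t x - vx t x)"
  using assms by (auto simp: has_partials_def intro!: derivative_intros cont_hp_intros)

lemma has_partials_mult:
  assumes "has_partials u ut ux" "has_partials v vt vx"
  shows "has_partials (\<lambda>t x. u t x * v t x) (\<lambda>t x. ut t x * v t x + u t x * vt t x)
    (\<lambda>t x. ux t x * v t x + u t x * vx t x)"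
  using assms has_partials_cont[OF assms(1)] has_partials_cont[OF assms(2)]
  by (auto simp: has_partials_def intro!: derivative_eq_intros cont_hp_intros)

lemma has_partials_time:
  assumes "\<And>t. (h has_real_derivative h' t) (at t)" "continuous_on UNIV h'"
  shows "has_partials (\<lambda>t x. h t) (\<lambda>t x. h' t) (\<lambda>t x. 0)"
  using assms
  by (auto simp: has_partials_def intro!: derivative_intros cont_hp_intros
      intro: has_field_derivative_at_within)

lemma has_partials_space:
  assumes "\<And>x. (h has_real_derivative h' x) (at x)" "continuous_on UNIV h'"
  shows "has_partials (\<lambda>t x. h x) (\<lambda>t x. 0) (\<lambda>t x. h' x)"
  using assms by (auto simp: has_partials_def intro!: derivative_intros cont_hp_intros)

text \<open>The two-sided symmetry theorem does not apply on the boundary \<open>t = 0\<close>. Instead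
\<open>u(t, x) = u(0, x) + \<integral> u\<^sub>t\<close> is differentiated in \<open>x\<close> under the integral and then in \<open>t\<close>.\<close>

lemma mixed_partials_symmetric:
  assumes u: "has_partials u ut ux" and ut: "has_partials ut utt utx" and ux: "has_partials ux uxt uxx"
    and "t \<ge> 0"
  shows "uxt t x = utx t x"
proof -
  have c: "cont_hp ut" "cont_hp utx" "cont_hp ux"
    using u ut by (auto simp: has_partials_def)
  have FTC: "u s y = u 0 y + integral {0..s} (\<lambda>\<sigma>. ut \<sigma> y)" if "s \<ge> 0" for s y
  proof -
    have "((\<lambda>a. u a y) has_real_derivative ut \<sigma> y) (at \<sigma> within {0..s})" if "\<sigma> \<in> {0..s}" for \<sigma>
      by (rule DERIV_subset[of _ _ _ "{0..}"]) (use u that in \<open>auto simp: has_partials_def\<close>)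
    then have "((\<lambda>\<sigma>. ut \<sigma> y) has_integral u s y - u 0 y) {0..s}"
      using \<open>s \<ge> 0\<close> fundamental_theorem_of_calculus[of 0 s "\<lambda>a. u a y" "\<lambda>a. ut a y"]
      by (simp add: has_real_derivative_iff_has_vector_derivative)
    then show ?thesis by (simp add: integral_unique)
  qed
  have X: "ux s x = ux 0 x + integral {0..s} (\<lambda>\<sigma>. utx \<sigma> x)" if s: "s \<ge> 0" for s
  proof -
    have "((\<lambda>y. integral (cbox 0 s) (\<lambda>\<sigma>. ut \<sigma> y)) has_field_derivative
        integral (cbox 0 s) (\<lambda>\<sigma>. utx \<sigma> x)) (at x within UNIV)"
    proof (rule leibniz_rule_field_derivative)
      show "((\<lambda>x. ut t x) has_real_derivative utx t x) (at x within UNIV)"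
        if "t \<in> cbox 0 s" for x t
        using ut that by (simp add: has_partials_def)
      show "(\<lambda>\<sigma>. ut \<sigma> y) integrable_on cbox 0 s" for y
        by (intro integrable_continuous cont_hp_compose[OF c(1)]) (auto intro!: continuous_intros)
      have "continuous_on (UNIV \<times> cbox 0 s) (\<lambda>p. utx (snd p) (fst p))"
        by (intro cont_hp_compose[OF c(2)]) (auto intro!: continuous_intros)
      then show "continuous_on (UNIV \<times> cbox 0 s) (\<lambda>(x, t). utx t x)"
        by (simp add: case_prod_unfold)
    qed auto
    moreover have "(u 0 has_real_derivative ux 0 x) (at x)"
      using u by (simp add: has_partials_def)
    ultimately have "((\<lambda>y. u 0 y + integral {0..s} (\<lambda>\<sigma>. ut \<sigma> y)) has_field_derivative
        ux 0 x + integral {0..s} (\<lambda>\<sigma>. utx \<sigma> x)) (at x)"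
      by (auto intro!: derivative_intros)
    moreover have "u s = (\<lambda>y. u 0 y + integral {0..s} (\<lambda>\<sigma>. ut \<sigma> y))"
      using FTC[OF s] by auto
    moreover have "(u s has_real_derivative ux s x) (at x)"
      using u s by (simp add: has_partials_def)
    ultimately show ?thesis using DERIV_unique by metis
  qed
  have "((\<lambda>s. integral {0..s} (\<lambda>\<sigma>. utx \<sigma> x)) has_real_derivative utx t x) (at t within {0..t + 1})"
    by (rule integral_has_real_derivative)
      (use assms(4) in \<open>auto intro!: cont_hp_compose[OF c(2)] continuous_intros\<close>)
  then have "((\<lambda>s. ux 0 x + integral {0..s} (\<lambda>\<sigma>. utx \<sigma> x)) has_real_derivative utx t x)
      (at t within {0..t + 1})"
    by (auto intro!: derivative_eq_intros)
  then have "((\<lambda>s. ux s x) has_real_derivative utx t x) (at t within {0..t + 1})"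
    by (rule has_field_derivative_transform_within[OF _ zero_less_one])
      (use X[symmetric] assms(4) in \<open>auto\<close>)
  moreover have "((\<lambda>s. ux s x) has_real_derivative uxt t x) (at t within {0..t + 1})"
    by (rule DERIV_subset[of _ _ _ "{0..}"]) (use ux assms(4) in \<open>auto simp: has_partials_def\<close>)
  moreover have "at t within {0..t + 1} \<noteq> bot"
    using assms(4) by (simp add: at_within_Icc_at_right trivial_limit_within)
  ultimately show ?thesis
    using has_field_derivative_unique by blast
qed

definition has_partials2 where
  "has_partials2 u ut ux utt utx uxx \<longleftrightarrow>
     has_partials u ut ux \<and> has_partials ut utt utx \<and> has_partials ux utx uxx"

lemma C2_tx_has_partials2:
  assumes "C2_tx u"
  shows "has_partials2 u (pd_t u) (pd_x u) (pd_t (pd_t u)) (pd_x (pd_t u)) (pd_x (pd_x u))"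
proof -
  have *: "has_partials u (pd_t u) (pd_x u)"
    "has_partials (pd_t u) (pd_t (pd_t u)) (pd_x (pd_t u))"
    "has_partials (pd_x u) (pd_t (pd_x u)) (pd_x (pd_x u))"
    using assms by (auto simp: C2_tx_def intro: C1_tx_has_partials)
  then have "has_partials (pd_x u) (pd_x (pd_t u)) (pd_x (pd_x u))"
    by (rule_tac has_partials_cong[OF *(3)]) (auto intro: mixed_partials_symmetric[OF *, symmetric])
  with * show ?thesis by (simp add: has_partials2_def)
qed

lemma has_partials2_diff:
  assumes "has_partials2 u ut ux utt utx uxx" "has_partials2 v vt vx vtt vtx vxx"
  shows "has_partials2 (\<lambda>t x. u t x - v t x) (\<lambda>t x. ut t x - vt t x) (\<lambda>t x. ux t x - vx t x)
    (\<lambda>t x. utt t x - vtt t x) (\<lambda>t x. utx t x - vtx t x) (\<lambda>t x. uxx t x - vxx t x)"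
  using assms by (auto simp: has_partials2_def intro: has_partials_diff)

text \<open>Integration in time is expressed through this comparison: \<open>g\<close> plays the role of an antiderivative of
the bound.\<close>

lemma increment_le_of_derivative_le:
  fixes f g :: "real \<Rightarrow> real"
  assumes "a \<le> b"
    and f: "\<And>s. s \<in> {a..b} \<Longrightarrow> (f has_real_derivative f' s) (at s within {a..b})"
    and g: "\<And>s. s \<in> {a..b} \<Longrightarrow> (g has_real_derivative g' s) (at s within {a..b})"
    and le: "\<And>s. a < s \<Longrightarrow> s < b \<Longrightarrow> f' s \<le> g' s"
  shows "f b - f a \<le> g b - g a"
proof (cases "a = b")
  case False
  then have "a < b" using assms(1) by simp
  define h where "h s = g s - f s" for s
  have h: "(h has_real_derivative g' s - f' s) (at s within {a..b})" if "s \<in> {a..b}" for s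
    unfolding h_def using f[OF that] g[OF that] by (auto intro!: derivative_intros)
  then have cont: "continuous_on {a..b} h"
    by (rule DERIV_continuous_on)
  have "\<exists>y. (h has_real_derivative y) (at s) \<and> 0 \<le> y" if "a < s" "s < b" for s
  proof -
    have "(h has_real_derivative g' s - f' s) (at s within {a..b})"
      using h[of s] that by simp
    then have "(h has_real_derivative g' s - f' s) (at s)"
      by (simp only: at_within_Icc_at[OF that])
    then show ?thesis using le[OF that] by (intro exI[of _ "g' s - f' s"]) simp
  qed
  then have "h a \<le> h b"
    using DERIV_nonneg_imp_increasing_open[of a b h] cont \<open>a \<le> b\<close> by blast
  then show ?thesis by (simp add: h_def)
qed simp

section \<open>Null lines and backward triangles\<close>

text \<open>Since \<open>c\<^sup>2 = 1\<close>, the derivative of \<open>u\<^sub>t + c u\<^sub>x\<close> along the null line \<open>x = X + c (T - s)\<close> is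
\<open>u\<^sub>t\<^sub>t - u\<^sub>x\<^sub>x\<close>. The function \<open>G\<close> is an antiderivative of a bound for this source.\<close>

lemma transport_bound:
  assumes u: "has_partials2 u ut ux utt utx uxx"
    and "T \<ge> 0" and c: "c = 1 \<or> c = -1"
    and G: "\<And>s. s \<in> {0..T} \<Longrightarrow> (G has_real_derivative G' s) (at s within {0..T})"
    and le: "\<And>s. 0 < s \<Longrightarrow> s < T \<Longrightarrow>
       \<bar>utt s (X + c * (T - s)) - uxx s (X + c * (T - s))\<bar> \<le> G' s"
  shows "\<bar>ut T X + c * ux T X\<bar> \<le> \<bar>ut 0 (X + c * T)\<bar> + \<bar>ux 0 (X + c * T)\<bar> + (G T - G 0)"
proof -
  define P where "P s = ut s (X + c * (T - s)) + c * ux s (X + c * (T - s))" for s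
  define F where "F s = utt s (X + c * (T - s)) - uxx s (X + c * (T - s))" for s
  have P: "(P has_real_derivative F s) (at s within {0..T})" if "s \<in> {0..T}" for s
  proof -
    have b: "((\<lambda>s. X + c * (T - s)) has_real_derivative - c) (at s within {0..})"
      by (auto intro!: derivative_eq_intros)
    have 1: "((\<lambda>s. ut s (X + c * (T - s))) has_real_derivative
        utt s (X + c * (T - s)) + - c * utx s (X + c * (T - s))) (at s within {0..})"
      by (rule has_partials_along[OF _ _ b]) (use u that in \<open>auto simp: has_partials2_def\<close>)
    have 2: "((\<lambda>s. ux s (X + c * (T - s))) has_real_derivative
        utx s (X + c * (T - s)) + - c * uxx s (X + c * (T - s))) (at s within {0..})"
      by (rule has_partials_along[OF _ _ b]) (use u that in \<open>auto simp: has_partials2_def\<close>)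
    have cc: "c * c = 1" using c by auto
    have "(P has_real_derivative (utt s (X + c * (T - s)) + - c * utx s (X + c * (T - s))) +
        c * (utx s (X + c * (T - s)) + - c * uxx s (X + c * (T - s)))) (at s within {0..})"
      unfolding P_def by (intro DERIV_add DERIV_cmult 1 2)
    moreover have "(utt s (X + c * (T - s)) + - c * utx s (X + c * (T - s))) +
        c * (utx s (X + c * (T - s)) + - c * uxx s (X + c * (T - s))) = F s"
      using cc by (auto simp: F_def algebra_simps mult.assoc[symmetric])
    ultimately show ?thesis by (auto intro: DERIV_subset)
  qed
  have "P T - P 0 \<le> G T - G 0"
    by (rule increment_le_of_derivative_le[OF \<open>T \<ge> 0\<close> P G]) (use le in \<open>auto simp: F_def abs_le_iff\<close>)
  moreover have "- P T - - P 0 \<le> G T - G 0"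
    by (rule increment_le_of_derivative_le[OF \<open>T \<ge> 0\<close> DERIV_minus[OF P] G])
      (use le in \<open>auto simp: F_def abs_le_iff\<close>)
  moreover have "\<bar>P 0\<bar> \<le> \<bar>ut 0 (X + c * T)\<bar> + \<bar>ux 0 (X + c * T)\<bar>"
    using c by (auto simp: P_def)
  moreover have "P T = ut T X + c * ux T X" by (simp add: P_def)
  ultimately show ?thesis by linarith
qed

text \<open>The integral of \<open>e(s, \<cdot>)\<close> over \<open>[X - (T - s), X + (T - s)]\<close>, the section at time \<open>s\<close> of the backward
triangle with apex \<open>(T, X)\<close>, after rescaling to \<open>[-1, 1]\<close>. On the fixed interval it can be differentiated in
\<open>s\<close> under the integral.\<close>

definition slice :: "(real \<Rightarrow> real \<Rightarrow> real) \<Rightarrow> real \<Rightarrow> real \<Rightarrow> real \<Rightarrow> real" where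
  "slice e T X s = (T - s) * integral {-1..1} (\<lambda>z. e s (X + (T - s) * z))"

lemma cont_hp_slice_integrable:
  assumes "cont_hp e" "s \<ge> 0"
  shows "(\<lambda>z. e s (X + (T - s) * z)) integrable_on {-1..1}"
  by (intro integrable_continuous_real cont_hp_compose[OF assms(1)])
    (use assms in \<open>auto intro!: continuous_intros\<close>)

text \<open>The divergence theorem on the backward triangle: besides the divergence \<open>e\<^sub>t - j\<^sub>x\<close> inside, the
current \<open>(e, j)\<close> loses the fluxes \<open>e - j\<close> and \<open>e + j\<close> through the right and the left side. It serves twice:
for the wave energy, and with \<open>(e, j) = (b\<^sub>t, b\<^sub>x)\<close> for d'Alembert's formula.\<close>

lemma slice_has_derivative:
  assumes e: "has_partials e et ex" and j: "has_partials j jt jx" and "s \<ge> 0"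
  shows "(slice e T X has_real_derivative
      slice (\<lambda>s y. et s y - jx s y) T X s
      - (e s (X + (T - s)) - j s (X + (T - s))) - (e s (X - (T - s)) + j s (X - (T - s))))
    (at s within {0..})"
proof -
  have c: "cont_hp e" "cont_hp et" "cont_hp ex" "cont_hp jx" "cont_hp j"
    using e j has_partials_cont[OF e] has_partials_cont[OF j] by (auto simp: has_partials_def)
  define D where "D s z = - e s (X + (T - s) * z) +
      (T - s) * (et s (X + (T - s) * z) - z * ex s (X + (T - s) * z))" for s z
  have E: "((\<lambda>s. (T - s) * e s (X + (T - s) * z)) has_real_derivative D s z) (at s within {0..})"
    if "s \<ge> 0" for s z
  proof -
    have b: "((\<lambda>s. X + (T - s) * z) has_real_derivative - z) (at s within {0..})"
      by (auto intro!: derivative_eq_intros)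
    show ?thesis
      using has_partials_along[OF e that b]
      by (auto intro!: derivative_eq_intros simp: D_def algebra_simps)
  qed
  have comp: "continuous_on S (\<lambda>p. f (fst p) (X + (T - fst p) * snd p))"
    if "cont_hp f" "S \<subseteq> {0..} \<times> UNIV" for f S
    by (rule cont_hp_compose[OF that(1)]) (use that(2) in \<open>auto intro!: continuous_intros\<close>)
  have "((\<lambda>s. integral (cbox (-1) 1) (\<lambda>z. (T - s) * e s (X + (T - s) * z))) has_real_derivative
      integral (cbox (-1) 1) (D s)) (at s within {0..})"
  proof (rule leibniz_rule_field_derivative)
    show "((\<lambda>s. (T - s) * e s (X + (T - s) * z)) has_real_derivative D s z) (at s within {0..})"
      if "s \<in> {0..}" for s z using E that by auto
    show "(\<lambda>z. (T - s) * e s (X + (T - s) * z)) integrable_on cbox (- 1) 1" if "s \<in> {0..}" for s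
      using cont_hp_slice_integrable[OF c(1)] that by (auto intro!: integrable_on_mult_right)
    show "continuous_on ({0..} \<times> cbox (- 1) 1) (\<lambda>(s, z). D s z)"
      unfolding D_def case_prod_unfold
      by (intro continuous_intros comp c) auto
  qed (use \<open>s \<ge> 0\<close> in auto)
  then have I: "(slice e T X has_real_derivative integral {-1..1} (D s)) (at s within {0..})"
    by (simp add: slice_def[abs_def])
  \<comment> \<open>Up to a total derivative in the rescaled variable, \<open>D\<close> is the divergence.\<close>
  define B where "B z = - z * e s (X + (T - s) * z) + j s (X + (T - s) * z)" for z
  have "((\<lambda>z. D s z - (T - s) * (et s (X + (T - s) * z) - jx s (X + (T - s) * z)))
      has_integral B 1 - B (-1)) {-1..1}"
  proof (rule fundamental_theorem_of_calculus)
    fix z :: real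
    have f: "(f s has_real_derivative fx s y) (at y)" if "has_partials f ft fx" for f ft fx y
      using that \<open>s \<ge> 0\<close> by (simp add: has_partials_def)
    have g: "((\<lambda>z. X + (T - s) * z) has_real_derivative T - s) (at z)"
      by (auto intro!: derivative_eq_intros)
    have "(B has_real_derivative - z * (ex s (X + (T - s) * z) * (T - s)) + -1 * e s (X + (T - s) * z)
        + jx s (X + (T - s) * z) * (T - s)) (at z)"
      unfolding B_def
      by (intro DERIV_add DERIV_mult' DERIV_minus DERIV_ident DERIV_chain2[OF f[OF e] g]
          DERIV_chain2[OF f[OF j] g])
    then have "(B has_real_derivative D s z - (T - s) * (et s (X + (T - s) * z) - jx s (X + (T - s) * z))) (at z)"
      by (simp add: D_def algebra_simps)
    then show "(B has_vector_derivative
        D s z - (T - s) * (et s (X + (T - s) * z) - jx s (X + (T - s) * z))) (at z within {-1..1})"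
      by (simp add: has_field_derivative_at_within flip: has_real_derivative_iff_has_vector_derivative)
  qed simp
  moreover have "((\<lambda>z. (T - s) * (et s (X + (T - s) * z) - jx s (X + (T - s) * z)))
     has_integral slice (\<lambda>s y. et s y - jx s y) T X s) {-1..1}"
    unfolding slice_def
    by (intro has_integral_mult_right integrable_integral cont_hp_slice_integrable
         cont_hp_intros c \<open>s \<ge> 0\<close>)
  ultimately have "(D s has_integral B 1 - B (-1) + slice (\<lambda>s y. et s y - jx s y) T X s) {-1..1}"
    by (drule_tac has_integral_add) auto
  then have "integral {-1..1} (D s) = B 1 - B (-1) + slice (\<lambda>s y. et s y - jx s y) T X s"
    by (rule integral_unique)
  with I show ?thesis by (simp add: B_def algebra_simps)
qed

lemma slice_mono:
  assumes "cont_hp e" "cont_hp f" "0 \<le> s" "s \<le> T"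
    and "\<And>y. \<bar>y - X\<bar> \<le> T - s \<Longrightarrow> e s y \<le> f s y"
  shows "slice e T X s \<le> slice f T X s"
  unfolding slice_def
proof (rule mult_left_mono[OF integral_le])
  fix z :: real assume "z \<in> {-1..1}"
  then have "\<bar>(T - s) * z\<bar> \<le> T - s"
    using assms(4) mult_left_mono[of "\<bar>z\<bar>" 1 "T - s"] by (auto simp: abs_mult)
  then show "e s (X + (T - s) * z) \<le> f s (X + (T - s) * z)"
    by (intro assms(5)) simp
qed (use assms in \<open>auto intro: cont_hp_slice_integrable\<close>)

lemma slice_const [simp]: "slice (\<lambda>s y. c) T X s = 2 * (T - s) * c"
  by (simp add: slice_def)

lemma slice_cmult: "slice (\<lambda>s y. c * e s y) T X s = c * slice e T X s"
  by (simp add: slice_def)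

lemma slice_add:
  assumes "cont_hp e" "cont_hp f" "s \<ge> 0"
  shows "slice (\<lambda>s y. e s y + f s y) T X s = slice e T X s + slice f T X s"
  by (simp add: slice_def integral_add cont_hp_slice_integrable[OF assms(1,3)]
     cont_hp_slice_integrable[OF assms(2,3)] distrib_left)

section \<open>Waves with a nonnegative potential\<close>

text \<open>The energy density is \<open>e = (v\<^sub>t\<^sup>2 + v\<^sub>x\<^sup>2 + V v\<^sup>2)/2\<close> with flux density \<open>j = v\<^sub>t v\<^sub>x\<close>. Because \<open>V \<ge> 0\<close>, the
loss through the right side of the triangle is at least \<open>(v\<^sub>t - v\<^sub>x)\<^sup>2/2\<close>, the square of the derivative of \<open>v\<close>
along that side. So the initial energy bounds the change of \<open>v\<close> from the base to the apex, with a
power of \<open>T\<close> lost to the length of the base and of the side. The quadratic bounds are turned into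
linear ones by the inequality \<open>2 p \<theta> \<le> p\<^sup>2 + \<theta>\<^sup>2\<close> with \<open>\<theta> = A + \<eta>\<close>, in place of Cauchy-Schwarz for
integrals.\<close>

lemma wave_value_bound:
  fixes V V' :: "real \<Rightarrow> real"
  assumes v: "has_partials2 v vt vx vtt vtx vxx"
    and V: "\<And>x. (V has_real_derivative V' x) (at x)" "continuous_on UNIV V'"
      "\<And>x. 0 \<le> V x" "\<And>x. V x \<le> m"
    and "T \<ge> 0" "A > 0" "\<eta> \<ge> 0"
    and data: "\<And>y. \<bar>y - X\<bar> \<le> T \<Longrightarrow> \<bar>v 0 y\<bar> \<le> A \<and> \<bar>vt 0 y\<bar> \<le> A \<and> \<bar>vx 0 y\<bar> \<le> A"
    and h: "\<And>s y. 0 \<le> s \<Longrightarrow> s < T \<Longrightarrow> \<bar>y - X\<bar> \<le> T - s \<Longrightarrow>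
       \<bar>vtt s y - vxx s y + V y * v s y\<bar> \<le> \<eta>"
  shows "\<bar>v T X\<bar> \<le> (11 + 3 * m) * (1 + T) ^ 3 * (A + \<eta>)"
proof -
  define \<theta> where "\<theta> = A + \<eta>"
  have \<theta>: "\<theta> > 0" "A \<le> \<theta>" "\<eta> \<le> \<theta>" using assms by (auto simp: \<theta>_def)
  have "m \<ge> 0" using V(3,4)[of 0] by linarith
  \<comment> \<open>The rate at which the source may feed the energy: over the time \<open>T\<close> it costs only a factor \<open>e\<close>.\<close>
  define l where "l = 1 / (1 + T)"
  have l: "l > 0" "l * T \<le> 1" "1 / l = 1 + T"
    using \<open>T \<ge> 0\<close> by (auto simp: l_def field_simps)
  define e where "e = (\<lambda>s y. (vt s y * vt s y + vx s y * vx s y + V y * (v s y * v s y)) * (1/2))"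
  define et where "et = (\<lambda>s y. vt s y * vtt s y + vx s y * vtx s y + V y * (v s y * vt s y))"
  define ex where "ex = (\<lambda>s y. vt s y * vtx s y + vx s y * vxx s y + V y * (v s y * vx s y)
      + V' y * (v s y * v s y) / 2)"
  define j where "j = (\<lambda>s y. vt s y * vx s y)"
  define jt where "jt = (\<lambda>s y. vtt s y * vx s y + vt s y * vtx s y)"
  define jx where "jx = (\<lambda>s y. vtx s y * vx s y + vt s y * vxx s y)"
  have p: "has_partials v vt vx" "has_partials vt vtt vtx" "has_partials vx vtx vxx"
    using v by (auto simp: has_partials2_def)
  have e: "has_partials e et ex"
    unfolding e_def
    by (rule has_partials_cong[OF has_partials_mult[OF has_partials_add[OF has_partials_add[OF
          has_partials_mult[OF p(2) p(2)] has_partials_mult[OF p(3) p(3)]]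
          has_partials_mult[OF has_partials_space[OF V(1,2)] has_partials_mult[OF p(1) p(1)]]]
          has_partials_space[of "\<lambda>_. 1/2" "\<lambda>_. 0"]]])
       (auto simp: et_def ex_def algebra_simps)
  have j: "has_partials j jt jx"
    unfolding j_def jt_def jx_def by (rule has_partials_mult[OF p(2,3)])
  have ce: "cont_hp e" "cont_hp (\<lambda>s y. et s y - jx s y)"
    using has_partials_cont[OF e] e j by (auto simp: has_partials_def intro!: cont_hp_intros)
  have flux: "e s y + j s y \<ge> 0" "e s y - j s y \<ge> (vt s y - vx s y)\<^sup>2 / 2" for s y
  proof -
    have "e s y + j s y = (vt s y + vx s y)\<^sup>2 / 2 + V y * (v s y)\<^sup>2 / 2"
      "e s y - j s y = (vt s y - vx s y)\<^sup>2 / 2 + V y * (v s y)\<^sup>2 / 2"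
      by (auto simp: e_def j_def power2_eq_square field_simps)
    then show "e s y + j s y \<ge> 0" "e s y - j s y \<ge> (vt s y - vx s y)\<^sup>2 / 2"
      using V(3)[of y] by auto
  qed
  define I where "I = slice e T X"
  define B where "B = T * (1 + T) * \<eta>\<^sup>2"
  have src: "slice (\<lambda>s y. et s y - jx s y) T X s \<le> l * I s + B" if s: "0 \<le> s" "s < T" for s
  proof -
    have "slice (\<lambda>s y. et s y - jx s y) T X s \<le> slice (\<lambda>s y. l * e s y + (1 + T) * \<eta>\<^sup>2 / 2) T X s"
    proof (rule slice_mono[OF ce(2)])
      show "cont_hp (\<lambda>s y. l * e s y + (1 + T) * \<eta>\<^sup>2 / 2)" by (intro cont_hp_intros ce)
      fix y assume y: "\<bar>y - X\<bar> \<le> T - s"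
      define H where "H = vtt s y - vxx s y + V y * v s y"
      have "et s y - jx s y = vt s y * H" by (simp add: et_def jx_def H_def algebra_simps)
      also have "\<dots> \<le> l * (vt s y)\<^sup>2 / 2 + H\<^sup>2 / (2 * l)"
      proof -
        have "0 \<le> (l * vt s y - H)\<^sup>2 / (2 * l)" using l(1) by simp
        also have "\<dots> = l * (vt s y)\<^sup>2 / 2 + H\<^sup>2 / (2 * l) - vt s y * H"
          using l(1) by (simp add: power2_eq_square field_simps)
        finally show ?thesis by simp
      qed
      also have "H\<^sup>2 / (2 * l) = (1 + T) * H\<^sup>2 / 2" by (simp add: l(3)[symmetric])
      also have "H\<^sup>2 \<le> \<eta>\<^sup>2"
        using h[OF s y] by (simp add: H_def abs_le_square_iff[symmetric])
      also have "l * (vt s y)\<^sup>2 / 2 \<le> l * e s y"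
        using l(1) V(3)[of y] by (simp add: e_def power2_eq_square[symmetric])
      finally show "et s y - jx s y \<le> l * e s y + (1 + T) * \<eta>\<^sup>2 / 2"
        using \<open>T \<ge> 0\<close> by (simp add: mult_left_mono)
    qed (use s in auto)
    also have "\<dots> = l * I s + (T - s) * ((1 + T) * \<eta>\<^sup>2)"
      by (subst slice_add) (use ce s in \<open>auto intro!: cont_hp_intros simp: slice_cmult I_def\<close>)
    also have "(T - s) * ((1 + T) * \<eta>\<^sup>2) \<le> B"
      unfolding B_def mult.assoc using s \<open>T \<ge> 0\<close> by (intro mult_right_mono) auto
    finally show ?thesis by simp
  qed
  define Q where "Q s = vt s (X + (T - s)) - vx s (X + (T - s))" for s
  define I' where "I' s = slice (\<lambda>s y. et s y - jx s y) T X s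
      - (e s (X + (T - s)) - j s (X + (T - s))) - (e s (X - (T - s)) + j s (X - (T - s)))" for s
  have I: "(I has_real_derivative I' s) (at s within {0..T})" if "s \<in> {0..T}" for s
    unfolding I_def I'_def
    by (rule DERIV_subset[OF slice_has_derivative[OF e j]]) (use that in auto)
  have I'_le: "I' s \<le> l * I s + B - (Q s)\<^sup>2 / 2" if "0 < s" "s < T" for s
    using src[of s] that flux(1)[of s "X - (T - s)"] flux(2)[of s "X + (T - s)"]
    unfolding I'_def Q_def by linarith
  have I0: "I 0 \<le> T * (2 + m) * A\<^sup>2"
  proof -
    have "I 0 \<le> slice (\<lambda>s y. (2 + m) * A\<^sup>2 / 2) T X 0"
      unfolding I_def
    proof (rule slice_mono[OF ce(1)])
      fix y assume "\<bar>y - X\<bar> \<le> T - 0"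
      then have "\<bar>v 0 y\<bar> \<le> \<bar>A\<bar>" "\<bar>vt 0 y\<bar> \<le> \<bar>A\<bar>" "\<bar>vx 0 y\<bar> \<le> \<bar>A\<bar>" using data[of y] by auto
      then have *: "(v 0 y)\<^sup>2 \<le> A\<^sup>2" "(vt 0 y)\<^sup>2 \<le> A\<^sup>2" "(vx 0 y)\<^sup>2 \<le> A\<^sup>2"
        by (auto simp: abs_le_square_iff)
      have "V y * (v 0 y)\<^sup>2 \<le> m * A\<^sup>2"
        using * V(3,4)[of y] \<open>m \<ge> 0\<close> by (intro mult_mono) auto
      with * show "e 0 y \<le> (2 + m) * A\<^sup>2 / 2"
        by (simp add: e_def power2_eq_square[symmetric] algebra_simps)
    qed (use \<open>T \<ge> 0\<close> in \<open>auto intro!: cont_hp_intros\<close>)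
    then show ?thesis by simp
  qed
  have main: "\<sigma> * v T X \<le> (11 + 3 * m) * (1 + T) ^ 3 * \<theta>" if \<sigma>: "\<sigma> = 1 \<or> \<sigma> = -1" for \<sigma>
  proof -
    \<comment> \<open>By Gronwall's device \<open>F\<close> decreases up to the source; \<open>G\<close> collects the source and a multiple of \<open>v\<close> along
the right side, whose derivative is \<open>Q\<close>. The factor \<open>1/3\<close> is a lower bound for \<open>exp (- l * s)\<close>.\<close>
    define F where "F s = exp (- l * s) * I s" for s
    define F' where "F' s = exp (- l * s) * (I' s - l * I s)" for s
    define G where "G s = B * s - \<theta> / 3 * (\<sigma> * v s (X + (T - s)) - \<theta> * s / 2)" for s
    define G' where "G' s = B - \<theta> / 3 * (\<sigma> * Q s - \<theta> / 2)" for s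
    have F: "(F has_real_derivative F' s) (at s within {0..T})" if "s \<in> {0..T}" for s
      unfolding F_def F'_def
      by (rule derivative_eq_intros I[OF that] refl)+ (simp add: algebra_simps)
    have G: "(G has_real_derivative G' s) (at s within {0..T})" if "s \<in> {0..T}" for s
    proof -
      have b: "((\<lambda>s. X + (T - s)) has_real_derivative - 1) (at s within {0..})"
        by (auto intro!: derivative_eq_intros)
      have "((\<lambda>s. v s (X + (T - s))) has_real_derivative Q s) (at s within {0..T})"
        using has_partials_along[OF p(1) _ b] that
        by (auto simp: Q_def intro: DERIV_subset)
      then show ?thesis
        unfolding G_def G'_def by (auto intro!: derivative_eq_intros)
    qed
    have "F T - F 0 \<le> G T - G 0"
    proof (rule increment_le_of_derivative_le[OF \<open>T \<ge> 0\<close> F G])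
      fix s assume s: "0 < s" "s < T"
      define E where "E = exp (- l * s)"
      have "l * s \<le> 1" using s l by (smt (verit) mult_left_mono)
      then have "exp (l * s) \<le> exp 1" by simp
      also have "exp 1 \<le> (3::real)" by (rule exp_le)
      finally have E: "E \<le> 1" "1 / 3 \<le> E" "E > 0"
        using l(1) s by (auto simp: E_def exp_minus field_simps)
      have "F' s \<le> E * (B - (Q s)\<^sup>2 / 2)"
        unfolding F'_def E_def[symmetric] using I'_le[OF s] E by (intro mult_left_mono) auto
      also have "\<dots> = E * B - E * ((Q s)\<^sup>2 / 2)" by (simp add: algebra_simps)
      also have "\<dots> \<le> B - (1/3) * ((Q s)\<^sup>2 / 2)"
        using E mult_right_mono[of E 1 B] mult_right_mono[of "1/3" E "(Q s)\<^sup>2 / 2"] \<open>T \<ge> 0\<close>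
        by (auto simp: B_def)
      also have "\<dots> \<le> G' s"
      proof -
        have "0 \<le> (\<sigma> * Q s - \<theta>)\<^sup>2" by simp
        also have "\<dots> = (Q s)\<^sup>2 - 2 * \<theta> * (\<sigma> * Q s - \<theta> / 2)"
          using \<sigma> by (auto simp: power2_eq_square algebra_simps)
        finally show ?thesis by (simp add: G'_def)
      qed
      finally show "F' s \<le> G' s" .
    qed
    moreover have "F T = 0" by (simp add: F_def I_def slice_def)
    moreover have "F 0 = I 0" by (simp add: F_def)
    moreover have "G T - G 0 = B * T - \<theta> / 3 * (\<sigma> * v T X - \<sigma> * v 0 (X + T) - \<theta> * T / 2)"
      by (simp add: G_def algebra_simps)
    ultimately have "\<theta> * (\<sigma> * v T X) \<le> \<theta> * (\<sigma> * v 0 (X + T)) + \<theta> * (\<theta> * T / 2) + 3 * (I 0 + B * T)"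
      by (simp add: algebra_simps)
    also have "\<sigma> * v 0 (X + T) \<le> \<theta>"
      using data[of "X + T"] \<sigma> \<open>T \<ge> 0\<close> \<theta> by auto
    also have "I 0 \<le> T * (2 + m) * \<theta>\<^sup>2"
      using I0 \<theta> \<open>A > 0\<close> \<open>T \<ge> 0\<close> \<open>m \<ge> 0\<close>
      by (meson add_nonneg_nonneg mult_left_mono mult_nonneg_nonneg order_trans power_mono less_imp_le zero_le_numeral)
    also have "B \<le> T * (1 + T) * \<theta>\<^sup>2"
      unfolding B_def using \<theta> assms by (intro mult_left_mono power_mono) auto
    finally have "\<theta> * (\<sigma> * v T X) \<le> \<theta> * \<theta> + \<theta> * (\<theta> * T / 2) + 3 * (T * (2 + m) * \<theta>\<^sup>2 + T * (1 + T) * \<theta>\<^sup>2 * T)"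
      using \<theta> \<open>T \<ge> 0\<close> by (simp add: mult_left_mono mult_right_mono)
    also have "\<dots> = \<theta> * (\<theta> * (1 + T / 2 + 3 * (T * (2 + m)) + 3 * (T * (1 + T) * T)))"
      by (simp add: power2_eq_square algebra_simps)
    finally have "\<sigma> * v T X \<le> \<theta> * (1 + T / 2 + 3 * (T * (2 + m)) + 3 * (T * (1 + T) * T))"
      using \<theta>(1) by simp
    also have "\<dots> \<le> \<theta> * ((11 + 3 * m) * (1 + T) ^ 3)"
    proof (rule mult_left_mono)
      have "(11 + 3 * m) * (1 + T) ^ 3 - (1 + T / 2 + 3 * (T * (2 + m)) + 3 * (T * (1 + T) * T))
        = 10 + 26.5 * T + 30 * T\<^sup>2 + 8 * T ^ 3 + m * (3 + 6 * T + 9 * T\<^sup>2 + 3 * T ^ 3)"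
        by (simp add: power2_eq_square power3_eq_cube algebra_simps)
      also have "\<dots> \<ge> 0" using \<open>T \<ge> 0\<close> \<open>m \<ge> 0\<close> by simp
      finally show "1 + T / 2 + 3 * (T * (2 + m)) + 3 * (T * (1 + T) * T) \<le> (11 + 3 * m) * (1 + T) ^ 3"
        by simp
    qed (use \<theta> in simp)
    finally show ?thesis by (simp add: mult_ac)
  qed
  show ?thesis
    using main[of 1] main[of "-1"] by (auto simp: \<theta>_def abs_le_iff)
qed

text \<open>The factor is \<open>16\<^sup>4\<close>, from \<open>(1 + T)\<^sup>4 \<le> 16\<^sup>4 e\<^bsup>T/4\<^esup>\<close>.\<close>

definition wave_const :: "real \<Rightarrow> real" where
  "wave_const m = 65536 * (14 + 3 * m + m * (11 + 3 * m))"

text \<open>Once \<open>v\<close> itself is bounded polynomially at all points of the triangle, the term \<open>V v\<close> can be treated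
as a source and \<open>v\<^sub>t \<plusminus> v\<^sub>x\<close> is transported along null lines. The polynomial is then absorbed into
\<open>e\<^bsup>T/4\<^esup>\<close>; any rate below \<open>e\<^sup>T\<close>, the growth of the weight, is good enough later on.\<close>

lemma wave_bound:
  fixes V V' :: "real \<Rightarrow> real"
  assumes v: "has_partials2 v vt vx vtt vtx vxx"
    and V: "\<And>x. (V has_real_derivative V' x) (at x)" "continuous_on UNIV V'"
      "\<And>x. 0 \<le> V x" "\<And>x. V x \<le> m"
    and "T \<ge> 0" "A > 0" "\<eta> \<ge> 0"
    and data: "\<And>y. \<bar>y - X\<bar> \<le> T \<Longrightarrow> \<bar>v 0 y\<bar> \<le> A \<and> \<bar>vt 0 y\<bar> \<le> A \<and> \<bar>vx 0 y\<bar> \<le> A"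
    and h: "\<And>s y. 0 \<le> s \<Longrightarrow> s < T \<Longrightarrow> \<bar>y - X\<bar> \<le> T - s \<Longrightarrow>
       \<bar>vtt s y - vxx s y + V y * v s y\<bar> \<le> \<eta>"
  shows "\<bar>v T X\<bar> \<le> wave_const m * (A + \<eta>) * exp (T / 4)"
    "\<bar>vt T X\<bar> \<le> wave_const m * (A + \<eta>) * exp (T / 4)"
    "\<bar>vx T X\<bar> \<le> wave_const m * (A + \<eta>) * exp (T / 4)"
proof -
  define \<theta> where "\<theta> = A + \<eta>"
  define C where "C = 11 + 3 * m"
  have \<theta>: "\<theta> > 0" "A \<le> \<theta>" "\<eta> \<le> \<theta>" using assms by (auto simp: \<theta>_def)
  have m: "m \<ge> 0" using V(3,4)[of 0] by linarith
  then have C: "C > 0" by (simp add: C_def)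
  have val: "\<bar>v s y\<bar> \<le> C * (1 + T) ^ 3 * \<theta>" if "0 \<le> s" "s \<le> T" "\<bar>y - X\<bar> \<le> T - s" for s y
  proof -
    have "\<bar>v s y\<bar> \<le> (11 + 3 * m) * (1 + s) ^ 3 * (A + \<eta>)"
      by (rule wave_value_bound[OF v V]) (use that assms in \<open>auto intro!: data h\<close>)
    also have "\<dots> = C * (1 + s) ^ 3 * \<theta>" by (simp add: C_def \<theta>_def)
    also have "\<dots> \<le> C * (1 + T) ^ 3 * \<theta>"
      using that C \<theta> by (intro mult_right_mono mult_left_mono power_mono) auto
    finally show ?thesis .
  qed
  define K where "K = \<theta> + m * (C * (1 + T) ^ 3 * \<theta>)"
  have tr: "\<bar>vt T X + c * vx T X\<bar> \<le> 2 * A + K * T" if c: "c = 1 \<or> c = -1" for c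
  proof -
    have "\<bar>vt T X + c * vx T X\<bar> \<le> \<bar>vt 0 (X + c * T)\<bar> + \<bar>vx 0 (X + c * T)\<bar> + (K * T - K * 0)"
    proof (rule transport_bound[OF v \<open>T \<ge> 0\<close> c])
      show "((*) K has_real_derivative K) (at s within {0..T})" for s
        by (auto intro!: derivative_eq_intros)
      fix s assume s: "0 < s" "s < T"
      let ?y = "X + c * (T - s)"
      have y: "\<bar>?y - X\<bar> \<le> T - s" using c s by auto
      have "\<bar>V ?y * v s ?y\<bar> \<le> m * (C * (1 + T) ^ 3 * \<theta>)"
        unfolding abs_mult using val[OF _ _ y] s V(3,4)[of ?y] by (intro mult_mono) auto
      with h[OF _ _ y] s \<theta> show "\<bar>vtt s ?y - vxx s ?y\<bar> \<le> K"
        unfolding K_def by linarith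
    qed
    with data[of "X + c * T"] c \<open>T \<ge> 0\<close> show ?thesis by auto
  qed
  define P where "P = (1 + T) ^ 4"
  have P: "1 \<le> P" "T \<le> P" "(1 + T) ^ 3 \<le> P" "(1 + T) ^ 3 * T \<le> P"
  proof -
    show 1: "1 \<le> P" "(1 + T) ^ 3 \<le> P" using \<open>T \<ge> 0\<close> by (auto simp: P_def intro!: power_increasing one_le_power)
    show "T \<le> P" using \<open>T \<ge> 0\<close> power_increasing[of 1 4 "1 + T"] by (simp add: P_def)
    have "(1 + T) ^ 3 * T \<le> (1 + T) ^ 3 * (1 + T)" using \<open>T \<ge> 0\<close> by (intro mult_left_mono) auto
    then show "(1 + T) ^ 3 * T \<le> P" by (simp add: P_def power4_eq_xxxx power3_eq_cube)
  qed
  have "K * T = \<theta> * T + m * C * ((1 + T) ^ 3 * T) * \<theta>" by (simp add: K_def algebra_simps)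
  also have "\<dots> \<le> \<theta> * P + m * C * P * \<theta>"
    using P m C \<theta> by (intro add_mono mult_left_mono mult_right_mono) auto
  finally have KT: "K * T \<le> \<theta> * P + m * C * P * \<theta>" .
  have "\<theta> * 1 \<le> \<theta> * P" using \<theta> P(1) by (intro mult_left_mono) auto
  then have "2 * A \<le> 2 * (\<theta> * P)" using \<theta> by linarith
  with KT have t2: "2 * A + K * T \<le> (3 + m * C) * P * \<theta>" by (simp add: algebra_simps)
  have e: "P \<le> 65536 * exp (T / 4)"
  proof -
    have "1 + T \<le> 16 * exp (T / 16)" using exp_ge_add_one_self[of "T / 16"] \<open>T \<ge> 0\<close> by linarith
    then have "P \<le> (16 * exp (T / 16)) ^ 4" unfolding P_def using \<open>T \<ge> 0\<close> by (intro power_mono) auto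
    then show ?thesis by (simp add: power_mult_distrib exp_of_nat_mult[symmetric])
  qed
  have "(14 + 3 * m + m * C) * P * \<theta> \<le> (14 + 3 * m + m * C) * (65536 * exp (T / 4)) * \<theta>"
    using e m C \<theta> by (intro mult_right_mono mult_left_mono) auto
  also have "\<dots> = wave_const m * (A + \<eta>) * exp (T / 4)"
    by (simp add: wave_const_def C_def \<theta>_def algebra_simps)
  finally have fin: "(14 + 3 * m + m * C) * P * \<theta> \<le> wave_const m * (A + \<eta>) * exp (T / 4)" .
  have "\<bar>v T X\<bar> \<le> C * P * \<theta>"
    using val[of T X] \<open>T \<ge> 0\<close> P(3) C \<theta>
    by (smt (verit) mult_left_mono mult_right_mono)
  moreover have "0 \<le> (3 + m * C) * P * \<theta>" "0 \<le> C * P * \<theta>" using C m P \<theta> by auto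
  moreover have "(14 + 3 * m + m * C) * P * \<theta> = C * P * \<theta> + (3 + m * C) * P * \<theta>"
    by (simp add: C_def algebra_simps)
  ultimately show "\<bar>v T X\<bar> \<le> wave_const m * (A + \<eta>) * exp (T / 4)"
    "\<bar>vt T X\<bar> \<le> wave_const m * (A + \<eta>) * exp (T / 4)"
    "\<bar>vx T X\<bar> \<le> wave_const m * (A + \<eta>) * exp (T / 4)"
    using fin t2 tr[of 1] tr[of "-1"] by auto
qed

section \<open>Conjugation of the linearised equations\<close>

abbreviation sech2 :: "real \<Rightarrow> real" where "sech2 x \<equiv> 1 / cosh (2 * x)"

text \<open>The square root of \<open>R\<^sub>b\<close>, up to a constant factor. Multiplication by the root of the area function
removes the first-order terms of the background wave operator.\<close>

definition weight :: "real \<Rightarrow> real \<Rightarrow> real" where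
  "weight t x = exp t * sqrt (cosh (2 * x))"

text \<open>The background \<open>W\<^sub>b\<close> enters the equation of \<open>q\<close> through the factor \<open>e\<^bsup>-4W\<^esup>\<close> in front of the area
function; \<open>tilt (2W\<^sub>0)\<close> is the square root of that factor, up to a constant.\<close>

definition tilt :: "real \<Rightarrow> real \<Rightarrow> real" where
  "tilt k x = exp (- k * arctan (exp (2 * x)))"

text \<open>The logarithmic \<open>x\<close>-derivative of \<open>weight t x * tilt k x\<close>.\<close>

definition slope :: "real \<Rightarrow> real \<Rightarrow> real" where
  "slope k x = tanh (2 * x) - k * sech2 x"

definition slope' :: "real \<Rightarrow> real \<Rightarrow> real" where
  "slope' k x = 2 * (sech2 x)\<^sup>2 + 2 * k * sech2 x * tanh (2 * x)"

lemma cosh_2x_ge_1: "1 \<le> cosh (2 * x :: real)"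
  by (rule cosh_real_ge_1)

lemma cosh_2x_pos [simp]: "0 < cosh (2 * x :: real)"
  by (rule cosh_real_pos)

lemma cosh_2x_nonzero [simp]: "cosh (2 * x :: real) \<noteq> 0"
  using cosh_2x_pos[of x] by linarith

lemma sech2_bounds: "0 < sech2 x" "sech2 x \<le> 1"
  using cosh_2x_ge_1[of x] by auto

lemma abs_tanh_le_1: "\<bar>tanh (2 * x :: real)\<bar> \<le> 1"
  using tanh_real_bounds[of "2 * x"] by auto

lemma tanh_sech: "(tanh (2 * x :: real))\<^sup>2 = 1 - (sech2 x)\<^sup>2"
  by (simp add: tanh_def power_divide sinh_square_eq diff_divide_distrib)

lemma weight_pos [simp]: "0 < weight t x"
  by (simp add: weight_def)

lemma weight_ge: "exp t \<le> weight t x"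
  using mult_left_mono[of 1 "sqrt (cosh (2 * x))" "exp t"] cosh_2x_ge_1[of x] by (simp add: weight_def)

lemma weight_square: "weight t x * weight t x = exp (2 * t) * cosh (2 * x)"
  by (simp add: weight_def power2_eq_square[symmetric] power_mult_distrib exp_double)

lemma tilt_pos [simp]: "0 < tilt k x"
  by (simp add: tilt_def)

lemma tilt_bounds: "tilt k x \<le> exp (2 * \<bar>k\<bar>)" "exp (- 2 * \<bar>k\<bar>) \<le> tilt k x"
proof -
  have "0 < arctan (exp (2 * x))" "arctan (exp (2 * x)) < 2"
    using arctan_ubound[of "exp (2 * x)"] pi_half_less_two by auto
  then have "\<bar>k * arctan (exp (2 * x))\<bar> \<le> \<bar>k\<bar> * 2"
    unfolding abs_mult by (intro mult_left_mono) auto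
  then show "tilt k x \<le> exp (2 * \<bar>k\<bar>)" "exp (- 2 * \<bar>k\<bar>) \<le> tilt k x"
    by (auto simp: tilt_def)
qed

lemma sech2_has_derivative: "(sech2 has_real_derivative - 2 * sech2 x * tanh (2 * x)) (at x)"
  by (auto intro!: derivative_eq_intros simp: tanh_def field_simps power2_eq_square)

lemma tanh_2x_has_derivative:
  "((\<lambda>x. tanh (2 * x :: real)) has_real_derivative 2 * (sech2 x)\<^sup>2) (at x)"
  by (auto intro!: derivative_eq_intros simp: tanh_sech)

lemma arctan_exp_has_derivative:
  "((\<lambda>x. arctan (exp (2 * x))) has_real_derivative sech2 x) (at x)"
proof -
  have "(exp (2 * x))\<^sup>2 = exp (2 * x) * exp (2 * x)" by (simp add: power2_eq_square)
  moreover have "exp (2 * x) * exp (- (2 * x)) = 1" by (simp add: exp_minus)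
  ultimately have "1 + (exp (2 * x))\<^sup>2 = 2 * exp (2 * x) * cosh (2 * x)"
    by (simp add: cosh_def algebra_simps)
  then have "2 * exp (2 * x) / (1 + (exp (2 * x))\<^sup>2) = sech2 x" by simp
  then show ?thesis
    by (auto intro!: derivative_eq_intros simp: field_simps)
qed

lemma slope_has_derivative: "(slope k has_real_derivative slope' k x) (at x)"
  unfolding slope_def[abs_def]
  by (rule derivative_eq_intros tanh_2x_has_derivative sech2_has_derivative refl)+
    (simp add: slope'_def)

lemma abs_slope_le: "\<bar>slope k x\<bar> \<le> 1 + \<bar>k\<bar>"
proof -
  have "\<bar>k * sech2 x\<bar> \<le> \<bar>k\<bar> * 1"
    unfolding abs_mult using sech2_bounds[of x] by (intro mult_left_mono) auto
  then show ?thesis using abs_tanh_le_1[of x] unfolding slope_def by linarith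
qed

text \<open>The terms in \<open>tanh (2x) / cosh (2x)\<close>, which have no sign, cancel between the square and the
derivative of the slope. What is left beyond the constant \<open>1\<close> is nonnegative, whatever \<open>k\<close> is; this
is where linear stability comes from.\<close>

lemma slope_identity: "(slope k x)\<^sup>2 + slope' k x = 1 + (1 + k\<^sup>2) * (sech2 x)\<^sup>2"
proof -
  have "(slope k x)\<^sup>2 + slope' k x = (tanh (2 * x))\<^sup>2 + (2 + k\<^sup>2) * (sech2 x)\<^sup>2"
    unfolding slope_def slope'_def by (simp add: power2_eq_square algebra_simps del: times_divide_eq_left times_divide_eq_right)
  then show ?thesis unfolding tanh_sech by (simp add: algebra_simps)
qed

lemma continuous_on_tanh_2x: "continuous_on UNIV (\<lambda>x. tanh (2 * x :: real))"
  by (intro continuous_intros) auto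

lemma tilted_weight_partials:
  "has_partials (\<lambda>t x. weight t x * tilt k x) (\<lambda>t x. weight t x * tilt k x) (\<lambda>t x. slope k x * (weight t x * tilt k x))"
proof -
  have 1: "((\<lambda>x. sqrt (cosh (2 * x))) has_real_derivative tanh (2 * x) * sqrt (cosh (2 * x))) (at x)" for x :: real
  proof -
    have "((\<lambda>x. sqrt (cosh (2 * x))) has_real_derivative (sinh (2 * x) * 2) * (inverse (sqrt (cosh (2 * x))) / 2)) (at x)"
    proof -
      have "((\<lambda>x. cosh (2 * x :: real)) has_real_derivative sinh (2 * x) * 2) (at x)"
        by (auto intro!: derivative_eq_intros)
      from DERIV_chain2[where g = "\<lambda>x. cosh (2 * x)", OF DERIV_real_sqrt[OF cosh_2x_pos[of x]] this]
      show ?thesis by (simp add: mult_ac)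
    qed
    moreover have "(sinh (2 * x) * 2) * (inverse (sqrt (cosh (2 * x))) / 2) = tanh (2 * x) * sqrt (cosh (2 * x))"
    proof -
      define r where "r = sqrt (cosh (2 * x))"
      have "r > 0" "cosh (2 * x) = r * r" by (auto simp: r_def)
      then show ?thesis unfolding r_def[symmetric] by (simp add: tanh_def field_simps)
    qed
    ultimately show ?thesis by (simp only:)
  qed
  have 2: "(tilt k has_real_derivative - k * sech2 x * tilt k x) (at x)" for x
    using DERIV_chain2[where g = "\<lambda>x. - k * arctan (exp (2 * x))", OF DERIV_exp
        DERIV_cmult[OF arctan_exp_has_derivative[of x], of "- k"]]
    by (simp add: tilt_def[abs_def] mult_ac)
  have g: "((\<lambda>x. sqrt (cosh (2 * x)) * tilt k x) has_real_derivative
      slope k x * (sqrt (cosh (2 * x)) * tilt k x)) (at x)" for x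
    using DERIV_mult[OF 1[of x] 2[of x]] by (simp add: slope_def algebra_simps)
  have "continuous_on UNIV (\<lambda>x. slope k x * (sqrt (cosh (2 * x)) * tilt k x))"
    unfolding slope_def tilt_def by (intro continuous_intros continuous_on_tanh_2x) auto
  from has_partials_mult[OF has_partials_time[of exp exp] has_partials_space[OF g this]]
  have *: "has_partials (\<lambda>t x. exp t * (sqrt (cosh (2 * x)) * tilt k x))
     (\<lambda>t x. exp t * (sqrt (cosh (2 * x)) * tilt k x) + exp t * 0)
     (\<lambda>t x. 0 * (sqrt (cosh (2 * x)) * tilt k x) + exp t * (slope k x * (sqrt (cosh (2 * x)) * tilt k x)))"
    by (simp add: continuous_on_exp continuous_on_id)
  show ?thesis
    by (rule has_partials_cong[OF *]) (auto simp: weight_def)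
qed

text \<open>Two factors each of \<open>2 + \<bar>k\<bar>\<close> and of \<open>e\<^bsup>2\<bar>k\<bar>\<^esup>\<close> arise from the passage between \<open>u\<close> and \<open>v\<close>, once for the
data and once for the conclusion.\<close>

definition weighted_const :: "real \<Rightarrow> real" where
  "weighted_const k = wave_const (1 + k\<^sup>2) * (2 + \<bar>k\<bar>)\<^sup>2 * (exp (2 * \<bar>k\<bar>))\<^sup>2"

lemma wave_const_pos: "m \<ge> 0 \<Longrightarrow> wave_const m > 0"
  by (auto simp: wave_const_def intro!: add_pos_nonneg mult_nonneg_nonneg)

lemma weighted_const_pos: "weighted_const k > 0"
  unfolding weighted_const_def by (intro mult_pos_pos wave_const_pos) auto

text \<open>With \<open>v = weight * tilt k * u\<close> the left-hand side of the equation becomes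
\<open>(v\<^sub>t\<^sub>t - v\<^sub>x\<^sub>x + (1 + k\<^sup>2) cosh(2x)\<^bsup>-2\<^esup> v) / (weight * tilt k)\<close>: the damping term \<open>2u\<^sub>t\<close> cancels against the
derivatives of \<open>e\<^sup>t\<close>, and \<open>slope_identity\<close> gives the potential. Since \<open>tilt k\<close> is bounded above and
below, the estimate can be stated with the untilted weight.\<close>

lemma weighted_wave_bound:
  assumes u: "has_partials2 u ut ux utt utx uxx"
    and T: "T \<ge> 0" and A: "A > 0" and \<eta>: "\<eta> \<ge> 0"
    and data: "\<And>y. \<bar>y - X\<bar> \<le> T \<Longrightarrow>
      weight 0 y * \<bar>u 0 y\<bar> \<le> A \<and> weight 0 y * \<bar>ut 0 y\<bar> \<le> A \<and> weight 0 y * \<bar>ux 0 y\<bar> \<le> A"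
    and f: "\<And>s y. 0 \<le> s \<Longrightarrow> s < T \<Longrightarrow> \<bar>y - X\<bar> \<le> T - s \<Longrightarrow>
       weight s y * \<bar>utt s y - uxx s y + 2 * ut s y - 2 * slope k y * ux s y\<bar> \<le> \<eta>"
  shows "weight T X * \<bar>u T X\<bar> \<le> weighted_const k * (A + \<eta>) * exp (T / 4)"
    "weight T X * \<bar>ut T X\<bar> \<le> weighted_const k * (A + \<eta>) * exp (T / 4)"
    "weight T X * \<bar>ux T X\<bar> \<le> weighted_const k * (A + \<eta>) * exp (T / 4)"
proof -
  define w where "w = (\<lambda>t x. weight t x * tilt k x)"
  define E where "E = exp (2 * \<bar>k\<bar>)"
  have E: "E \<ge> 1" by (simp add: E_def)
  have w_pos: "0 < w t x" for t x by (simp add: w_def)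
  have w_le: "w t x \<le> E * weight t x" for t x
    using tilt_bounds(1)[of k x] mult_right_mono[of "tilt k x" E "weight t x"] weight_pos[of t x]
    by (simp add: w_def E_def mult.commute)
  have weight_le: "weight t x \<le> E * w t x" for t x
  proof -
    have "1 \<le> E * tilt k x"
      using tilt_bounds(2)[of k x] by (simp add: E_def exp_minus field_simps)
    then show ?thesis
      using mult_right_mono[of 1 "E * tilt k x" "weight t x"] weight_pos[of t x] by (simp add: w_def mult_ac)
  qed
  have p: "has_partials u ut ux" "has_partials ut utt utx" "has_partials ux utx uxx"
    using u by (auto simp: has_partials2_def)
  have wp: "has_partials w w (\<lambda>t x. slope k x * w t x)"
    unfolding w_def by (rule tilted_weight_partials)
  have cs: "continuous_on UNIV (slope' k)"
    unfolding slope'_def[abs_def] by (intro continuous_intros continuous_on_tanh_2x) auto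
  have sp: "has_partials (\<lambda>t x. slope k x) (\<lambda>t x. 0) (\<lambda>t x. slope' k x)"
    by (rule has_partials_space[OF slope_has_derivative cs])
  define v where "v = (\<lambda>t x. w t x * u t x)"
  define vt where "vt = (\<lambda>t x. w t x * (u t x + ut t x))"
  define vx where "vx = (\<lambda>t x. w t x * (slope k x * u t x + ux t x))"
  define vtt where "vtt = (\<lambda>t x. w t x * (u t x + 2 * ut t x + utt t x))"
  define vtx where "vtx = (\<lambda>t x. w t x * (slope k x * (u t x + ut t x) + ux t x + utx t x))"
  define vxx where "vxx = (\<lambda>t x. w t x * (((slope k x)\<^sup>2 + slope' k x) * u t x + 2 * slope k x * ux t x + uxx t x))"
  have v1: "has_partials v vt vx"
    unfolding v_def
    by (rule has_partials_cong[OF has_partials_mult[OF wp p(1)]])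
      (auto simp: vt_def vx_def algebra_simps)
  have v2: "has_partials vt vtt vtx"
    unfolding vt_def
    by (rule has_partials_cong[OF has_partials_mult[OF wp has_partials_add[OF p(1,2)]]])
      (auto simp: vtt_def vtx_def algebra_simps)
  have v3: "has_partials vx vtx vxx"
    unfolding vx_def
    by (rule has_partials_cong[OF has_partials_mult[OF wp has_partials_add[OF has_partials_mult[OF sp p(1)] p(3)]]])
      (auto simp: vtx_def vxx_def algebra_simps power2_eq_square)
  have v: "has_partials2 v vt vx vtt vtx vxx"
    using v1 v2 v3 by (simp add: has_partials2_def)
  define V where "V x = (1 + k\<^sup>2) * (sech2 x)\<^sup>2" for x
  define V' where "V' x = (1 + k\<^sup>2) * (2 * sech2 x * (- 2 * sech2 x * tanh (2 * x)))" for x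
  have V1: "(V has_real_derivative V' x) (at x)" for x
    unfolding V_def[abs_def]
    by (rule derivative_eq_intros sech2_has_derivative refl)+ (simp add: V'_def)
  have V2: "continuous_on UNIV V'"
    unfolding V'_def[abs_def] by (intro continuous_intros continuous_on_tanh_2x) auto
  have V3: "0 \<le> V x" for x by (simp add: V_def)
  have V4: "V x \<le> 1 + k\<^sup>2" for x
  proof -
    have "(sech2 x)\<^sup>2 \<le> 1" using sech2_bounds[of x] by (intro power_le_one) auto
    then show ?thesis
      unfolding V_def using mult_left_mono[of "(sech2 x)\<^sup>2" 1 "1 + k\<^sup>2"] by simp
  qed
  define A' where "A' = (2 + \<bar>k\<bar>) * E * A"
  have "A' > 0" using A E by (simp add: A'_def mult_pos_pos)
  have data': "\<bar>v 0 y\<bar> \<le> A' \<and> \<bar>vt 0 y\<bar> \<le> A' \<and> \<bar>vx 0 y\<bar> \<le> A'" if "\<bar>y - X\<bar> \<le> T" for y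
  proof -
    have z: "w 0 y * \<bar>z\<bar> \<le> E * A" if "weight 0 y * \<bar>z\<bar> \<le> A" for z
    proof -
      have "w 0 y * \<bar>z\<bar> \<le> (E * weight 0 y) * \<bar>z\<bar>" by (intro mult_right_mono w_le) auto
      also have "\<dots> \<le> E * A" using that E by (simp add: mult.assoc)
      finally show ?thesis .
    qed
    have z1: "w 0 y * \<bar>u 0 y\<bar> \<le> E * A" "w 0 y * \<bar>ut 0 y\<bar> \<le> E * A" "w 0 y * \<bar>ux 0 y\<bar> \<le> E * A"
      using data[OF that] z by auto
    have EA: "E * A \<ge> 0" using E A by simp
    have "\<bar>v 0 y\<bar> = w 0 y * \<bar>u 0 y\<bar>" using w_pos[of 0 y] by (simp add: v_def abs_mult)
    moreover have "\<bar>vt 0 y\<bar> \<le> w 0 y * \<bar>u 0 y\<bar> + w 0 y * \<bar>ut 0 y\<bar>"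
      using w_pos[of 0 y] by (simp add: vt_def abs_mult distrib_left[symmetric])
    moreover have "\<bar>vx 0 y\<bar> \<le> (1 + \<bar>k\<bar>) * (w 0 y * \<bar>u 0 y\<bar>) + w 0 y * \<bar>ux 0 y\<bar>"
    proof -
      have "\<bar>vx 0 y\<bar> \<le> \<bar>slope k y\<bar> * (w 0 y * \<bar>u 0 y\<bar>) + w 0 y * \<bar>ux 0 y\<bar>"
        using w_pos[of 0 y] abs_triangle_ineq[of "w 0 y * (slope k y * u 0 y)" "w 0 y * ux 0 y"]
        by (simp add: vx_def abs_mult distrib_left mult_ac)
      also have "\<bar>slope k y\<bar> * (w 0 y * \<bar>u 0 y\<bar>) \<le> (1 + \<bar>k\<bar>) * (w 0 y * \<bar>u 0 y\<bar>)"
        using w_pos[of 0 y] by (intro mult_right_mono abs_slope_le) auto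
      finally show ?thesis by simp
    qed
    moreover have "(1 + \<bar>k\<bar>) * (w 0 y * \<bar>u 0 y\<bar>) \<le> (1 + \<bar>k\<bar>) * (E * A)"
      by (intro mult_left_mono z1) auto
    moreover have "A' = (1 + \<bar>k\<bar>) * (E * A) + E * A" "A' = 2 * (E * A) + \<bar>k\<bar> * (E * A)"
      by (auto simp: A'_def algebra_simps)
    moreover have "\<bar>k\<bar> * (E * A) \<ge> 0" using EA by (rule mult_nonneg_nonneg[OF abs_ge_zero])
    ultimately show ?thesis using z1 EA by (intro conjI; linarith)
  qed
  have h': "\<bar>vtt s y - vxx s y + V y * v s y\<bar> \<le> E * \<eta>"
    if "0 \<le> s" "s < T" "\<bar>y - X\<bar> \<le> T - s" for s y
  proof -
    define F where "F = utt s y - uxx s y + 2 * ut s y - 2 * slope k y * ux s y"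
    have "vtt s y - vxx s y + V y * v s y = w s y * F"
      unfolding vxx_def slope_identity by (simp add: vtt_def v_def V_def F_def algebra_simps)
    then have "\<bar>vtt s y - vxx s y + V y * v s y\<bar> = w s y * \<bar>F\<bar>"
      using w_pos[of s y] by (simp add: abs_mult)
    also have "\<dots> \<le> (E * weight s y) * \<bar>F\<bar>" by (intro mult_right_mono w_le) auto
    also have "\<dots> \<le> E * \<eta>"
      using f[OF that] E by (simp add: F_def mult.assoc)
    finally show ?thesis .
  qed
  define M where "M = wave_const (1 + k\<^sup>2) * ((2 + \<bar>k\<bar>) * E * (A + \<eta>)) * exp (T / 4)"
  have C: "wave_const (1 + k\<^sup>2) > 0" by (intro wave_const_pos) auto
  have E\<eta>: "E * \<eta> \<ge> 0" using E \<eta> by simp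
  have leM: "wave_const (1 + k\<^sup>2) * (A' + E * \<eta>) * exp (T / 4) \<le> M"
  proof -
    have "\<bar>k\<bar> * (E * \<eta>) \<ge> 0" using E\<eta> by simp
    then have "A' + E * \<eta> \<le> (2 + \<bar>k\<bar>) * E * (A + \<eta>)"
      unfolding A'_def using E\<eta> by (simp add: algebra_simps)
    then show ?thesis unfolding M_def using C by (intro mult_right_mono mult_left_mono) auto
  qed
  have bd: "\<bar>v T X\<bar> \<le> M" "\<bar>vt T X\<bar> \<le> M" "\<bar>vx T X\<bar> \<le> M"
    using wave_bound[OF v V1 V2 V3 V4 T \<open>A' > 0\<close> E\<eta> data' h'] leM by force+
  then have M: "M \<ge> 0" by linarith
  have fin: "weight T X * \<bar>z\<bar> \<le> weighted_const k * (A + \<eta>) * exp (T / 4)"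
    if "w T X * \<bar>z\<bar> \<le> (2 + \<bar>k\<bar>) * M" for z
  proof -
    have "weight T X * \<bar>z\<bar> \<le> (E * w T X) * \<bar>z\<bar>" by (intro mult_right_mono weight_le) auto
    also have "\<dots> \<le> E * ((2 + \<bar>k\<bar>) * M)" using that E by (simp add: mult.assoc)
    also have "\<dots> = weighted_const k * (A + \<eta>) * exp (T / 4)"
      by (simp add: weighted_const_def M_def E_def power2_eq_square mult_ac)
    finally show ?thesis .
  qed
  have kM: "(2 + \<bar>k\<bar>) * M = M + (1 + \<bar>k\<bar>) * M" "M \<le> (1 + \<bar>k\<bar>) * M"
    using M mult_nonneg_nonneg[OF abs_ge_zero[of k] M] by (simp_all add: algebra_simps)
  have w1: "w T X * \<bar>u T X\<bar> \<le> M" using bd(1) w_pos[of T X] by (simp add: v_def abs_mult)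
  show "weight T X * \<bar>u T X\<bar> \<le> weighted_const k * (A + \<eta>) * exp (T / 4)"
    by (rule fin) (use w1 kM M in linarith)
  have "w T X * \<bar>ut T X\<bar> = \<bar>vt T X - v T X\<bar>"
  proof -
    have "vt T X - v T X = w T X * ut T X" by (simp add: vt_def v_def algebra_simps)
    then show ?thesis using w_pos[of T X] by (simp add: abs_mult)
  qed
  then show "weight T X * \<bar>ut T X\<bar> \<le> weighted_const k * (A + \<eta>) * exp (T / 4)"
    by (intro fin) (use bd kM M in linarith)
  have "w T X * \<bar>ux T X\<bar> = \<bar>vx T X - slope k X * v T X\<bar>"
  proof -
    have "vx T X - slope k X * v T X = w T X * ux T X" by (simp add: vx_def v_def algebra_simps)
    then show ?thesis using w_pos[of T X] by (simp add: abs_mult)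
  qed
  moreover have "\<bar>slope k X * v T X\<bar> \<le> (1 + \<bar>k\<bar>) * M"
    unfolding abs_mult by (intro mult_mono abs_slope_le bd) auto
  ultimately show "weight T X * \<bar>ux T X\<bar> \<le> weighted_const k * (A + \<eta>) * exp (T / 4)"
    by (intro fin) (use bd kM M in linarith)
qed

section \<open>Weighted Sobolev bounds control the data pointwise\<close>

lemma test_fun_derivative:
  assumes "test_fun \<phi>" shows "(\<phi> has_real_derivative deriv \<phi> x) (at x)"
proof -
  have "Ck 1 \<phi>" using assms by (simp add: test_fun_def)
  then show ?thesis
    by (auto simp: Ck_def DERIV_deriv_iff_real_differentiable)
qed

lemma test_fun_continuous:
  assumes "test_fun \<phi>" shows "continuous_on UNIV \<phi>"
  using test_fun_derivative[OF assms] by (meson DERIV_isCont continuous_at_imp_continuous_on)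

lemma test_fun_deriv:
  assumes "test_fun \<phi>" shows "test_fun (deriv \<phi>)"
proof -
  have "Ck k (deriv \<phi>)" for k
  proof -
    have "Ck (Suc k) \<phi>" using assms by (simp add: test_fun_def)
    moreover have "(deriv ^^ i) (deriv \<phi>) = (deriv ^^ Suc i) \<phi>" for i
      by (simp only: funpow_Suc_right o_def)
    ultimately show ?thesis unfolding Ck_def by auto
  qed
  moreover have "compact (closure {x. deriv \<phi> x \<noteq> 0})"
  proof -
    have "{x. deriv \<phi> x \<noteq> 0} \<subseteq> closure {x. \<phi> x \<noteq> 0}"
    proof
      fix x assume x: "x \<in> {x. deriv \<phi> x \<noteq> 0}"
      show "x \<in> closure {x. \<phi> x \<noteq> 0}"
      proof (rule ccontr)
        assume nx: "x \<notin> closure {x. \<phi> x \<noteq> 0}"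
        have "((\<lambda>x. 0) has_real_derivative deriv \<phi> x) (at x)"
        proof (rule has_field_derivative_transform_within_open[OF test_fun_derivative[OF assms]])
          show "open (- closure {x. \<phi> x \<noteq> 0})" by auto
          show "x \<in> - closure {x. \<phi> x \<noteq> 0}" using nx by auto
          show "\<phi> y = 0" if "y \<in> - closure {x. \<phi> x \<noteq> 0}" for y
            using that closure_subset[of "{x. \<phi> x \<noteq> 0}"] by auto
        qed
        then have "deriv \<phi> x = 0" using DERIV_unique[OF _ DERIV_const] by blast
        with x show False by simp
      qed
    qed
    then have "closure {x. deriv \<phi> x \<noteq> 0} \<subseteq> closure {x. \<phi> x \<noteq> 0}"
      by (metis closed_closure closure_minimal)
    then show ?thesis
      using assms compact_Int_closed[of "closure {x. \<phi> x \<noteq> 0}" "closure {x. deriv \<phi> x \<noteq> 0}"]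
      by (simp add: test_fun_def Int_absorb1)
  qed
  ultimately show ?thesis by (simp add: test_fun_def)
qed

lemma test_fun_iterated_deriv: "test_fun \<phi> \<Longrightarrow> test_fun ((deriv ^^ i) \<phi>)"
  by (induction i) (auto intro: test_fun_deriv)

lemma test_fun_bounded_support:
  assumes "test_fun \<phi>" shows "\<exists>K. \<forall>x. K < \<bar>x\<bar> \<longrightarrow> \<phi> x = 0"
proof -
  have "bounded (closure {x. \<phi> x \<noteq> 0})" using assms by (simp add: test_fun_def compact_imp_bounded)
  then obtain K where "\<forall>x\<in>closure {x. \<phi> x \<noteq> 0}. norm x \<le> K" by (auto simp: bounded_iff)
  then have "\<phi> x = 0" if "K < \<bar>x\<bar>" for x
    using that closure_subset[of "{x. \<phi> x \<noteq> 0}"] by fastforce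
  then show ?thesis by blast
qed

lemma test_fun_weighted_integrable:
  assumes "test_fun \<phi>" shows "integrable lborel (\<lambda>x. (\<phi> x)\<^sup>2 * cosh (2 * x))"
proof -
  obtain K where K: "\<And>x. K < \<bar>x\<bar> \<Longrightarrow> \<phi> x = 0" using test_fun_bounded_support[OF assms] by blast
  have "integrable lborel (\<lambda>x. indicator {-K..K} x *\<^sub>R ((\<phi> x)\<^sup>2 * cosh (2 * x)))"
    by (intro borel_integrable_compact compact_Icc continuous_intros
        continuous_on_subset[OF test_fun_continuous[OF assms]]) auto
  moreover have "(\<lambda>x. indicator {-K..K} x *\<^sub>R ((\<phi> x)\<^sup>2 * cosh (2 * x))) = (\<lambda>x. (\<phi> x)\<^sup>2 * cosh (2 * x))"
  proof
    fix x show "indicator {-K..K} x *\<^sub>R ((\<phi> x)\<^sup>2 * cosh (2 * x)) = (\<phi> x)\<^sup>2 * cosh (2 * x)"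
      using K[of x] by (cases "K < \<bar>x\<bar>") (auto simp: indicator_def)
  qed
  ultimately show ?thesis by simp
qed

text \<open>The fundamental theorem of calculus for \<open>cosh (2z) \<phi>(z)\<^sup>2\<close>, from the left of the support to \<open>x\<close>; the
derivative is estimated by \<open>\<bar>sinh\<bar> \<le> cosh\<close> and \<open>2\<phi>\<phi>' \<le> \<phi>\<^sup>2 + \<phi>'\<^sup>2\<close>.\<close>

lemma test_fun_pointwise_bound:
  assumes "test_fun \<phi>"
  shows "cosh (2 * x) * (\<phi> x)\<^sup>2 \<le>
    3 * (\<integral>x. (\<phi> x)\<^sup>2 * cosh (2 * x) \<partial>lborel) + (\<integral>x. (deriv \<phi> x)\<^sup>2 * cosh (2 * x) \<partial>lborel)"
proof -
  obtain K where K: "\<And>x. K < \<bar>x\<bar> \<Longrightarrow> \<phi> x = 0" using test_fun_bounded_support[OF assms] by blast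
  \<comment> \<open>A point to the left of both \<open>x\<close> and the support.\<close>
  define a where "a = - (\<bar>K\<bar> + \<bar>x\<bar> + 1)"
  have "\<phi> a = 0" by (rule K) (simp add: a_def)
  have "a \<le> x" by (simp add: a_def)
  define g where "g z = 2 * sinh (2 * z) * (\<phi> z)\<^sup>2 + cosh (2 * z) * (2 * \<phi> z * deriv \<phi> z)" for z
  define G where "G z = 3 * ((\<phi> z)\<^sup>2 * cosh (2 * z)) + (deriv \<phi> z)\<^sup>2 * cosh (2 * z)" for z
  have d: "((\<lambda>z. cosh (2 * z) * (\<phi> z)\<^sup>2) has_real_derivative g z) (at z)" for z
    unfolding g_def using test_fun_derivative[OF assms, of z]
    by (auto intro!: derivative_eq_intros simp: algebra_simps)
  have c: "isCont g z" for z
    unfolding g_def using test_fun_continuous[OF assms] test_fun_continuous[OF test_fun_deriv[OF assms]]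
    by (auto intro!: continuous_intros simp: continuous_on_eq_continuous_at)
  have iG: "integrable lborel G"
    unfolding G_def using test_fun_weighted_integrable[OF assms]
      test_fun_weighted_integrable[OF test_fun_deriv[OF assms]] by auto
  have gG: "g z \<le> G z" "0 \<le> G z" for z
  proof -
    have "2 * sinh (2 * z) * (\<phi> z)\<^sup>2 \<le> 2 * cosh (2 * z) * (\<phi> z)\<^sup>2"
      using sinh_le_cosh_real[of "2 * z"] by (intro mult_right_mono) auto
    moreover have "cosh (2 * z) * (2 * \<phi> z * deriv \<phi> z) \<le> cosh (2 * z) * ((\<phi> z)\<^sup>2 + (deriv \<phi> z)\<^sup>2)"
      using sum_squares_bound[of "\<phi> z" "deriv \<phi> z"] by (intro mult_left_mono) auto
    ultimately show "g z \<le> G z" by (simp add: g_def G_def algebra_simps)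
    show "0 \<le> G z" by (simp add: G_def)
  qed
  have ig: "integrable lborel (\<lambda>z. g z * indicator {a..x} z)"
    and FTC: "(\<integral>z. g z * indicator {a..x} z \<partial>lborel) = cosh (2 * x) * (\<phi> x)\<^sup>2 - cosh (2 * a) * (\<phi> a)\<^sup>2"
    using has_bochner_integral_FTC_Icc_real[OF \<open>a \<le> x\<close> d c]
    by (auto simp: has_bochner_integral_iff)
  have "cosh (2 * x) * (\<phi> x)\<^sup>2 = (\<integral>z. g z * indicator {a..x} z \<partial>lborel)"
    using FTC \<open>\<phi> a = 0\<close> by simp
  also have "\<dots> \<le> (\<integral>z. G z \<partial>lborel)"
    by (rule integral_mono[OF ig iG]) (use gG in \<open>auto simp: indicator_def\<close>)
  also have "\<dots> = 3 * (\<integral>x. (\<phi> x)\<^sup>2 * cosh (2 * x) \<partial>lborel) + (\<integral>x. (deriv \<phi> x)\<^sup>2 * cosh (2 * x) \<partial>lborel)"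
    unfolding G_def using test_fun_weighted_integrable[OF assms]
      test_fun_weighted_integrable[OF test_fun_deriv[OF assms]] by simp
  finally show ?thesis .
qed

text \<open>The Bochner integrals in the Sobolev norm are meaningful only if the weighted squares are integrable;
here this is inherited from the approximating test functions. The factor \<open>2\<close> in the last
estimate comes from \<open>\<phi>\<^sup>2 \<le> 2(\<phi> - g)\<^sup>2 + 2g\<^sup>2\<close>.\<close>

lemma weighted_L2_limit:
  assumes \<phi>: "\<And>n. test_fun (\<phi> n)" and g: "g \<in> borel_measurable borel"
    and lim: "(\<lambda>n. \<integral>\<^sup>+x. ennreal ((\<phi> n x - g x)\<^sup>2 * cosh (2 * x)) \<partial>lborel) \<longlonglongrightarrow> 0"
  shows "integrable lborel (\<lambda>x. (g x)\<^sup>2 * cosh (2 * x))"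
    and "integrable lborel (\<lambda>x. (\<phi> n x - g x)\<^sup>2 * cosh (2 * x))"
    and "(\<lambda>n. \<integral>x. (\<phi> n x - g x)\<^sup>2 * cosh (2 * x) \<partial>lborel) \<longlonglongrightarrow> 0"
    and "\<kappa> > 0 \<Longrightarrow> \<forall>\<^sub>F n in sequentially. (\<integral>x. (\<phi> n x)\<^sup>2 * cosh (2 * x) \<partial>lborel) \<le>
      2 * (\<integral>x. (g x)\<^sup>2 * cosh (2 * x) \<partial>lborel) + \<kappa>"
proof -
  have [measurable]: "\<phi> n \<in> borel_measurable borel" for n
    using test_fun_continuous[OF \<phi>] by (rule borel_measurable_continuous_onI)
  note [measurable] = g
  have cm [measurable]: "(\<lambda>x::real. cosh (2 * x)) \<in> borel_measurable borel"
    by (intro borel_measurable_continuous_onI continuous_intros)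
  have sq: "(y::real)\<^sup>2 * cosh (2 * x) \<le> 2 * ((z - y)\<^sup>2 * cosh (2 * x)) + 2 * (z\<^sup>2 * cosh (2 * x))" for x y z :: real
  proof -
    have "2 * (z - y)\<^sup>2 + 2 * z\<^sup>2 - y\<^sup>2 = (2 * z - y)\<^sup>2"
      by (simp add: power2_eq_square algebra_simps)
    then have "y\<^sup>2 \<le> 2 * (z - y)\<^sup>2 + 2 * z\<^sup>2" by (metis diff_ge_0_iff_ge zero_le_power2)
    then have "y\<^sup>2 * cosh (2 * x) \<le> (2 * (z - y)\<^sup>2 + 2 * z\<^sup>2) * cosh (2 * x)"
      by (intro mult_right_mono) auto
    then show ?thesis by (simp add: algebra_simps)
  qed
  have "\<forall>\<^sub>F n in sequentially. (\<integral>\<^sup>+x. ennreal ((\<phi> n x - g x)\<^sup>2 * cosh (2 * x)) \<partial>lborel) < 1"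
    using lim by (rule order_tendstoD) simp
  then obtain n0 where n0: "(\<integral>\<^sup>+x. ennreal ((\<phi> n0 x - g x)\<^sup>2 * cosh (2 * x)) \<partial>lborel) < 1"
    by (auto simp: eventually_sequentially)
  have "integrable lborel (\<lambda>x. (\<phi> n0 x - g x)\<^sup>2 * cosh (2 * x))"
    by (rule integrableI_nonneg) (use n0 in \<open>auto intro: less_trans[OF _ ennreal_one_less_top]\<close>)
  then have "integrable lborel (\<lambda>x. 2 * ((\<phi> n0 x - g x)\<^sup>2 * cosh (2 * x)) + 2 * ((\<phi> n0 x)\<^sup>2 * cosh (2 * x)))"
    using test_fun_weighted_integrable[OF \<phi>[of n0]] by auto
  then show ig: "integrable lborel (\<lambda>x. (g x)\<^sup>2 * cosh (2 * x))"
    by (rule Bochner_Integration.integrable_bound) (use sq in auto)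
  show id: "integrable lborel (\<lambda>x. (\<phi> n x - g x)\<^sup>2 * cosh (2 * x))" for n
  proof -
    have "integrable lborel (\<lambda>x. 2 * ((g x)\<^sup>2 * cosh (2 * x)) + 2 * ((\<phi> n x)\<^sup>2 * cosh (2 * x)))"
      using test_fun_weighted_integrable[OF \<phi>[of n]] ig by auto
    then show ?thesis
    proof (rule Bochner_Integration.integrable_bound)
      show "AE x in lborel. norm ((\<phi> n x - g x)\<^sup>2 * cosh (2 * x)) \<le>
         norm (2 * ((g x)\<^sup>2 * cosh (2 * x)) + 2 * ((\<phi> n x)\<^sup>2 * cosh (2 * x)))"
        using sq[of "\<phi> n x - g x" x "\<phi> n x" for x] by (auto simp: algebra_simps)
    qed auto
  qed
  have nn: "(\<integral>\<^sup>+x. ennreal ((\<phi> n x - g x)\<^sup>2 * cosh (2 * x)) \<partial>lborel) =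
      ennreal (\<integral>x. (\<phi> n x - g x)\<^sup>2 * cosh (2 * x) \<partial>lborel)" for n
    by (rule nn_integral_eq_integral[OF id]) auto
  show lim': "(\<lambda>n. \<integral>x. (\<phi> n x - g x)\<^sup>2 * cosh (2 * x) \<partial>lborel) \<longlonglongrightarrow> 0"
  proof -
    have "(\<lambda>n. ennreal (\<integral>x. (\<phi> n x - g x)\<^sup>2 * cosh (2 * x) \<partial>lborel)) \<longlonglongrightarrow> ennreal 0"
      using lim unfolding nn by simp
    then show ?thesis
      by (subst (asm) tendsto_ennreal_iff) (auto intro!: always_eventually integral_nonneg_AE)
  qed
  show "\<forall>\<^sub>F n in sequentially. (\<integral>x. (\<phi> n x)\<^sup>2 * cosh (2 * x) \<partial>lborel) \<le>
      2 * (\<integral>x. (g x)\<^sup>2 * cosh (2 * x) \<partial>lborel) + \<kappa>" if "\<kappa> > 0"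
  proof -
    have "\<forall>\<^sub>F n in sequentially. (\<integral>x. (\<phi> n x - g x)\<^sup>2 * cosh (2 * x) \<partial>lborel) < \<kappa> / 2"
      using lim' by (rule order_tendstoD) (use that in simp)
    then show ?thesis
    proof eventually_elim
      case (elim n)
      have "(\<integral>x. (\<phi> n x)\<^sup>2 * cosh (2 * x) \<partial>lborel) \<le>
          (\<integral>x. 2 * ((\<phi> n x - g x)\<^sup>2 * cosh (2 * x)) + 2 * ((g x)\<^sup>2 * cosh (2 * x)) \<partial>lborel)"
        using sq[of "\<phi> n x" x "g x" for x]
        by (intro integral_mono test_fun_weighted_integrable \<phi> Bochner_Integration.integrable_add
             integrable_mult_right id ig) (simp add: power2_commute)
      also have "\<dots> = 2 * (\<integral>x. (\<phi> n x - g x)\<^sup>2 * cosh (2 * x) \<partial>lborel) + 2 * (\<integral>x. (g x)\<^sup>2 * cosh (2 * x) \<partial>lborel)"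
        using id ig by simp
      finally show ?case using elim by simp
    qed
  qed
qed

lemma sqrt_cosh_bound:
  assumes "cosh (2 * x) * z\<^sup>2 \<le> 9 * D\<^sup>2" "D > 0"
  shows "sqrt (cosh (2 * x)) * \<bar>z :: real\<bar> \<le> 3 * D"
proof -
  have "(sqrt (cosh (2 * x)) * \<bar>z\<bar>)\<^sup>2 = cosh (2 * x) * z\<^sup>2"
    by (simp add: power_mult_distrib)
  also have "\<dots> \<le> (3 * D)\<^sup>2" using assms(1) by (simp add: power_mult_distrib)
  finally show ?thesis
    by (rule power2_le_imp_le) (use assms(2) in simp)
qed

text \<open>A subsequence of the approximating test functions converges almost everywhere. The pointwise bounds
on the test functions and their classical derivatives are uniform in the index, so they pass to \<open>f\<close> on a
dense set of points.\<close>

lemma Ht_approximation: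
  assumes "Ht_derivs k f g" and D: "sqrt (\<Sum>i\<le>k. \<integral>x. (g i x)\<^sup>2 * cosh (2 * x) \<partial>lborel) < D"
  shows "\<exists>\<psi>. (\<forall>n. test_fun (\<psi> n)) \<and> (AE x in lborel. (\<lambda>n. \<psi> n x) \<longlonglongrightarrow> f x) \<and>
    (\<forall>i<k. \<forall>n x. sqrt (cosh (2 * x)) * \<bar>(deriv ^^ i) (\<psi> n) x\<bar> \<le> 3 * D)"
proof -
  from assms(1) obtain \<phi> where \<phi>: "\<And>n. test_fun (\<phi> n)" and g0: "AE x in lborel. g 0 x = f x"
    and gm: "\<And>i. i \<le> k \<Longrightarrow> g i \<in> borel_measurable borel"
    and lim: "\<And>i. i \<le> k \<Longrightarrow>
      (\<lambda>n. \<integral>\<^sup>+x. ennreal (((deriv ^^ i) (\<phi> n) x - g i x)\<^sup>2 * cosh (2 * x)) \<partial>lborel) \<longlonglongrightarrow> 0"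
    unfolding Ht_derivs_def by blast
  define N where "N i = (\<integral>x. (g i x)\<^sup>2 * cosh (2 * x) \<partial>lborel)" for i
  have N0: "N i \<ge> 0" for i unfolding N_def by (intro integral_nonneg_AE) auto
  have "0 \<le> sqrt (\<Sum>i\<le>k. N i)" using N0 by (simp add: sum_nonneg)
  then have "D > 0" using D unfolding N_def by linarith
  have S: "(\<Sum>i\<le>k. N i) \<le> D\<^sup>2"
    using D N0 \<open>D > 0\<close> unfolding N_def[symmetric] by (metis less_imp_le real_sqrt_le_iff real_sqrt_unique)
  have ev: "\<forall>\<^sub>F n in sequentially. \<forall>i\<in>{..k}. (\<integral>x. ((deriv ^^ i) (\<phi> n) x)\<^sup>2 * cosh (2 * x) \<partial>lborel) \<le>
      2 * N i + 3 * D\<^sup>2 / 4"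
    by (rule eventually_ball_finite, simp, unfold N_def, intro ballI weighted_L2_limit(4) test_fun_iterated_deriv \<phi> gm lim)
      (use \<open>D > 0\<close> in auto)
  then obtain n0 where n0: "\<And>n i. n \<ge> n0 \<Longrightarrow> i \<le> k \<Longrightarrow>
      (\<integral>x. ((deriv ^^ i) (\<phi> n) x)\<^sup>2 * cosh (2 * x) \<partial>lborel) \<le> 2 * N i + 3 * D\<^sup>2 / 4"
    by (auto simp: eventually_sequentially)
  have bd: "sqrt (cosh (2 * x)) * \<bar>(deriv ^^ i) (\<phi> n) x\<bar> \<le> 3 * D" if "i < k" "n \<ge> n0" for i n x
  proof (rule sqrt_cosh_bound[OF _ \<open>D > 0\<close>])
    have "cosh (2 * x) * ((deriv ^^ i) (\<phi> n) x)\<^sup>2 \<le>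
      3 * (\<integral>x. ((deriv ^^ i) (\<phi> n) x)\<^sup>2 * cosh (2 * x) \<partial>lborel)
      + (\<integral>x. ((deriv ^^ Suc i) (\<phi> n) x)\<^sup>2 * cosh (2 * x) \<partial>lborel)"
      using test_fun_pointwise_bound[OF test_fun_iterated_deriv[OF \<phi>, of i n], of x] by simp
    also have "\<dots> \<le> 3 * (2 * N i + 3 * D\<^sup>2 / 4) + (2 * N (Suc i) + 3 * D\<^sup>2 / 4)"
      using n0[OF that(2), of i] n0[OF that(2), of "Suc i"] that(1) by auto
    also have "\<dots> \<le> 6 * (N i + N (Suc i)) + 3 * D\<^sup>2" using N0[of "Suc i"] by simp
    also have "N i + N (Suc i) \<le> (\<Sum>i\<le>k. N i)"
    proof -
      have "sum N {i, Suc i} \<le> sum N {..k}" by (rule sum_mono2) (use that N0 in auto)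
      then show ?thesis by simp
    qed
    finally show "cosh (2 * x) * ((deriv ^^ i) (\<phi> n) x)\<^sup>2 \<le> 9 * D\<^sup>2" using S by simp
  qed
  have i0: "integrable lborel (\<lambda>x. (\<phi> n x - g 0 x)\<^sup>2 * cosh (2 * x))" for n
    using weighted_L2_limit(2)[OF \<phi> gm[of 0]] lim[of 0] by simp
  have "\<exists>r. strict_mono r \<and> (AE x in lborel. (\<lambda>n. (\<phi> (r n) x - g 0 x)\<^sup>2 * cosh (2 * x)) \<longlonglongrightarrow> 0)"
    by (rule tendsto_L1_AE_subseq[OF i0]) (use weighted_L2_limit(3)[OF \<phi> gm[of 0]] lim[of 0] in simp)
  then obtain r :: "nat \<Rightarrow> nat" where r: "strict_mono r"
    and ae: "AE x in lborel. (\<lambda>n. (\<phi> (r n) x - g 0 x)\<^sup>2 * cosh (2 * x)) \<longlonglongrightarrow> 0" by auto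
  have "AE x in lborel. (\<lambda>n. \<phi> (r n) x) \<longlonglongrightarrow> f x"
    using ae g0
  proof eventually_elim
    case (elim x)
    have "(\<lambda>n. sqrt ((\<phi> (r n) x - g 0 x)\<^sup>2 * cosh (2 * x) / cosh (2 * x))) \<longlonglongrightarrow> sqrt (0 / cosh (2 * x))"
      using elim(1) by (intro tendsto_intros) auto
    then have "(\<lambda>n. \<bar>\<phi> (r n) x - g 0 x\<bar>) \<longlonglongrightarrow> 0" by simp
    then show ?case using elim(2) by (simp add: tendsto_rabs_zero_iff LIM_zero_iff)
  qed
  then have ae': "AE x in lborel. (\<lambda>n. \<phi> (r (n + n0)) x) \<longlonglongrightarrow> f x"
    by eventually_elim (rule LIMSEQ_ignore_initial_segment)
  have "r (n + n0) \<ge> n0" for n using seq_suble[OF r, of "n + n0"] by simp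
  then show ?thesis
    using \<phi> ae' bd by (intro exI[of _ "\<lambda>n. \<phi> (r (n + n0))"]) simp
qed

text \<open>On intervals of length one the weight is constant up to a factor, so it can be pulled out of a
Lipschitz estimate.\<close>

lemma cosh_shift_le:
  assumes "\<bar>x - z\<bar> \<le> 1/2" shows "sqrt (cosh (2 * x)) \<le> 2 * sqrt (cosh (2 * z :: real))"
proof -
  have e: "exp 1 \<le> (4::real)" using exp_le by linarith
  have "exp (2 * x) \<le> exp 1 * exp (2 * z)" "exp (- (2 * x)) \<le> exp 1 * exp (- (2 * z))"
  proof -
    have "2 * x \<le> 1 + 2 * z" "- (2 * x) \<le> 1 + - (2 * z)" using assms by linarith+
    then show "exp (2 * x) \<le> exp 1 * exp (2 * z)" "exp (- (2 * x)) \<le> exp 1 * exp (- (2 * z))"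
      by (simp_all only: exp_add[symmetric] exp_le_cancel_iff)
  qed
  moreover have "exp 1 * exp (2 * z) \<le> 4 * exp (2 * z)" "exp 1 * exp (- (2 * z)) \<le> 4 * exp (- (2 * z))"
    by (rule mult_right_mono[OF e], simp)+
  ultimately have "exp (2 * x) \<le> 4 * exp (2 * z)" "exp (- (2 * x)) \<le> 4 * exp (- (2 * z))"
    by (meson order_trans)+
  then have "exp (2 * x) + exp (- (2 * x)) \<le> 4 * (exp (2 * z) + exp (- (2 * z)))"
    by (simp add: distrib_left)
  then have "cosh (2 * x) \<le> 4 * cosh (2 * z)"
    by (simp add: cosh_def)
  then have "sqrt (cosh (2 * x)) \<le> sqrt (4 * cosh (2 * z))" by simp
  then show ?thesis by (simp add: real_sqrt_mult)
qed

text \<open>The bound holds at almost every point, hence on a dense set, hence everywhere by continuity.\<close>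

lemma Ht_pointwise_bound:
  assumes "Ht_derivs k f g" "sqrt (\<Sum>i\<le>k. \<integral>x. (g i x)\<^sup>2 * cosh (2 * x) \<partial>lborel) < D"
    and "k \<ge> 1" and f: "continuous_on UNIV f"
  shows "sqrt (cosh (2 * x)) * \<bar>f x\<bar> \<le> 3 * D"
proof -
  obtain \<psi> where \<psi>: "\<And>n. test_fun (\<psi> n)" "AE x in lborel. (\<lambda>n. \<psi> n x) \<longlonglongrightarrow> f x"
    "\<And>i n x. i < k \<Longrightarrow> sqrt (cosh (2 * x)) * \<bar>(deriv ^^ i) (\<psi> n) x\<bar> \<le> 3 * D"
    using Ht_approximation[OF assms(1,2)] by blast
  have "AE x in lborel. sqrt (cosh (2 * x)) * \<bar>f x\<bar> \<le> 3 * D"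
    using \<psi>(2)
  proof eventually_elim
    case (elim x)
    have "(\<lambda>n. sqrt (cosh (2 * x)) * \<bar>\<psi> n x\<bar>) \<longlonglongrightarrow> sqrt (cosh (2 * x)) * \<bar>f x\<bar>"
      using elim by (intro tendsto_intros)
    then show ?case
      by (rule LIMSEQ_le_const2) (use \<psi>(3)[of 0 x] assms(3) in auto)
  qed
  then have "AE x in lebesgue. x \<in> {x. sqrt (cosh (2 * x)) * \<bar>f x\<bar> \<le> 3 * D}"
    by (simp add: AE_completion)
  moreover have "closed {x. sqrt (cosh (2 * x)) * \<bar>f x\<bar> \<le> 3 * D}"
    by (intro closed_Collect_le continuous_intros f)
  ultimately show ?thesis using mem_closed_if_AE_lebesgue by blast
qed

text \<open>Near \<open>x\<close> the test functions have a common Lipschitz constant \<open>L\<close>, by the bound on their derivatives.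
It is inherited by \<open>f\<close> on a dense set of pairs, by continuity on all pairs near \<open>x\<close>, and finally it
bounds the difference quotients of \<open>f\<close>.\<close>

lemma Ht_pointwise_deriv_bound:
  assumes "Ht_derivs k f g" "sqrt (\<Sum>i\<le>k. \<integral>x. (g i x)\<^sup>2 * cosh (2 * x) \<partial>lborel) < D"
    and "k \<ge> 2" and f: "\<And>x. (f has_real_derivative f' x) (at x)"
  shows "sqrt (cosh (2 * x)) * \<bar>f' x\<bar> \<le> 6 * D"
proof -
  obtain \<psi> where \<psi>: "\<And>n. test_fun (\<psi> n)" "AE x in lborel. (\<lambda>n. \<psi> n x) \<longlonglongrightarrow> f x"
    "\<And>i n x. i < k \<Longrightarrow> sqrt (cosh (2 * x)) * \<bar>(deriv ^^ i) (\<psi> n) x\<bar> \<le> 3 * D"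
    using Ht_approximation[OF assms(1,2)] by blast
  define P where "P = {y. (\<lambda>n. \<psi> n y) \<longlonglongrightarrow> f y}"
  have aeP: "AE y in lebesgue. y \<in> P"
    using AE_completion[OF \<psi>(2)] by (simp add: P_def)
  define I where "I = {x - 1/2 <..< x + 1/2}"
  define L where "L = 6 * D / sqrt (cosh (2 * x))"
  have dpsi: "\<bar>deriv (\<psi> n) z\<bar> \<le> L" if "z \<in> I" for n z
  proof -
    have "sqrt (cosh (2 * x)) * \<bar>deriv (\<psi> n) z\<bar> \<le> (2 * sqrt (cosh (2 * z))) * \<bar>deriv (\<psi> n) z\<bar>"
    proof (intro mult_right_mono cosh_shift_le)
      have "x - 1/2 < z" "z < x + 1/2" using that by (auto simp: I_def)
      then show "\<bar>x - z\<bar> \<le> 1/2" by linarith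
    qed simp
    also have "\<dots> \<le> 6 * D" using \<psi>(3)[of 1 z n] assms(3) by (simp add: mult_ac)
    finally show ?thesis by (simp add: L_def field_simps)
  qed
  have lip: "\<bar>f y - f z\<bar> \<le> L * \<bar>y - z\<bar>" if "y \<in> P" "z \<in> P" "y \<in> I" "z \<in> I" for y z
  proof -
    have "\<bar>\<psi> n y - \<psi> n z\<bar> \<le> L * \<bar>y - z\<bar>" for n
    proof -
      have "norm (\<psi> n y - \<psi> n z) \<le> L * norm (y - z)"
      proof (rule field_differentiable_bound[of I])
        show "(\<psi> n has_real_derivative deriv (\<psi> n) w) (at w within I)" for w
          by (rule has_field_derivative_at_within[OF test_fun_derivative]) (simp add: \<psi>)
      qed (use that dpsi in \<open>auto simp: I_def\<close>)
      then show ?thesis by simp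
    qed
    moreover have "(\<lambda>n. \<bar>\<psi> n y - \<psi> n z\<bar>) \<longlonglongrightarrow> \<bar>f y - f z\<bar>"
      using that by (intro tendsto_intros) (auto simp: P_def)
    ultimately show ?thesis by (meson LIMSEQ_le_const2)
  qed
  have fc: "continuous_on UNIV f" using f by (meson DERIV_isCont continuous_at_imp_continuous_on)
  have ext: "y \<in> - I \<union> {y. \<bar>f y - f z\<bar> \<le> L * \<bar>y - z\<bar>}"
    if "\<And>y. y \<in> P \<Longrightarrow> y \<in> I \<Longrightarrow> \<bar>f y - f z\<bar> \<le> L * \<bar>y - z\<bar>" for y z
  proof (rule mem_closed_if_AE_lebesgue)
    show "closed (- I \<union> {y. \<bar>f y - f z\<bar> \<le> L * \<bar>y - z\<bar>})"
      unfolding I_def by (intro closed_Un closed_Collect_le continuous_intros fc open_greaterThanLessThan closed_Compl)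
    show "AE y in lebesgue. y \<in> - I \<union> {y. \<bar>f y - f z\<bar> \<le> L * \<bar>y - z\<bar>}"
      using aeP by eventually_elim (use that in auto)
  qed
  have lip1: "\<bar>f y - f z\<bar> \<le> L * \<bar>y - z\<bar>" if "z \<in> P" "y \<in> I" "z \<in> I" for y z
    using ext[of z y] lip that by auto
  have lip2: "\<bar>f y - f z\<bar> \<le> L * \<bar>y - z\<bar>" if "y \<in> I" "z \<in> I" for y z
    using ext[of y z] lip1 that by (metis (no_types, lifting) Compl_iff UnE abs_minus_commute mem_Collect_eq)
  have "((\<lambda>y. \<bar>(f y - f x) / (y - x)\<bar>) \<longlongrightarrow> \<bar>f' x\<bar>) (at x)"
    using f[of x] by (intro tendsto_rabs) (simp add: has_field_derivative_iff)
  moreover have "\<forall>\<^sub>F y in at x. \<bar>(f y - f x) / (y - x)\<bar> \<le> L"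
  proof -
    have "\<forall>\<^sub>F y in at x. y \<in> I" by (intro eventually_at_in_open') (auto simp: I_def)
    moreover have "\<forall>\<^sub>F y in at x. y \<noteq> x" by (simp add: eventually_at_filter)
    ultimately show ?thesis
    proof eventually_elim
      case (elim y)
      then show ?case using lip2[of y x] by (auto simp: I_def abs_divide divide_le_eq)
    qed
  qed
  ultimately have "\<bar>f' x\<bar> \<le> L"
    by (rule tendsto_upperbound) simp
  then show ?thesis by (simp add: L_def field_simps)
qed

lemma Ht_norm_less_witness:
  assumes "Ht_norm k f < ennreal D"
  obtains g where "Ht_derivs k f g" "sqrt (\<Sum>i\<le>k. \<integral>x. (g i x)\<^sup>2 * cosh (2 * x) \<partial>lborel) < D"
proof -
  from assms obtain g where "Ht_derivs k f g"
    "ennreal (sqrt (\<Sum>i\<le>k. \<integral>x. (g i x)\<^sup>2 * cosh (2 * x) \<partial>lborel)) < ennreal D"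
    unfolding Ht_norm_def by (auto simp: INF_less_iff)
  moreover have "0 \<le> sqrt (\<Sum>i\<le>k. \<integral>x. (g i x)\<^sup>2 * cosh (2 * x) \<partial>lborel)"
    by (intro real_sqrt_ge_zero sum_nonneg integral_nonneg_AE) auto
  ultimately show ?thesis by (intro that[of g]) (auto simp: ennreal_less_iff)
qed

section \<open>Decay of the perturbation\<close>

lemma exp_mult_eq: "a + b = c \<Longrightarrow> exp a * exp b = exp (c :: real)"
  by (simp add: exp_add[symmetric])

lemma Rb_partials:
  "has_partials2 (Rb R0) (\<lambda>t x. 2 * Rb R0 t x) (\<lambda>t x. 2 * tanh (2 * x) * Rb R0 t x)
    (\<lambda>t x. 4 * Rb R0 t x) (\<lambda>t x. 4 * tanh (2 * x) * Rb R0 t x) (\<lambda>t x. 4 * Rb R0 t x)"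
proof -
  define E where "E = (\<lambda>t::real. exp (2 * t))"
  have E: "(E has_real_derivative 2 * E t) (at t)" "continuous_on UNIV (\<lambda>t. 2 * E t)" for t
    unfolding E_def by (auto intro!: derivative_eq_intros continuous_intros)
  have c: "((\<lambda>x. k * cosh (2 * x)) has_real_derivative 2 * k * sinh (2 * x)) (at x)"
    "((\<lambda>x. k * sinh (2 * x)) has_real_derivative 2 * k * cosh (2 * x)) (at x)" for x k :: real
    by (auto intro!: derivative_eq_intros)
  have cc: "continuous_on UNIV (\<lambda>x. k * cosh (2 * x))" "continuous_on UNIV (\<lambda>x. k * sinh (2 * x))" for k :: real
    by (auto intro!: continuous_intros)
  have C: "has_partials (\<lambda>t x. E t * (k * cosh (2 * x))) (\<lambda>t x. 2 * E t * (k * cosh (2 * x)))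
      (\<lambda>t x. E t * (2 * k * sinh (2 * x)))" for k
    by (rule has_partials_cong[OF has_partials_mult[OF has_partials_time[OF E] has_partials_space[OF c(1) cc(2)]]]) auto
  have S: "has_partials (\<lambda>t x. E t * (k * sinh (2 * x))) (\<lambda>t x. 2 * E t * (k * sinh (2 * x)))
      (\<lambda>t x. E t * (2 * k * cosh (2 * x)))" for k
    by (rule has_partials_cong[OF has_partials_mult[OF has_partials_time[OF E] has_partials_space[OF c(2) cc(1)]]]) auto
  have th: "tanh (2 * x) * cosh (2 * x) = sinh (2 * x)" for x :: real
    by (simp add: tanh_def)
  have th': "tanh (2 * x) * Rb R0 t x = E t * (R0 * sinh (2 * x))" for t x
    using th[of x] by (simp add: Rb_def E_def mult.left_commute mult.commute)
  show ?thesis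
    unfolding has_partials2_def
  proof (intro conjI)
    show "has_partials (Rb R0) (\<lambda>t x. 2 * Rb R0 t x) (\<lambda>t x. 2 * tanh (2 * x) * Rb R0 t x)"
      by (rule has_partials_cong[OF C[of R0]]) (use th' in \<open>auto simp: Rb_def E_def mult.assoc\<close>)
    show "has_partials (\<lambda>t x. 2 * Rb R0 t x) (\<lambda>t x. 4 * Rb R0 t x) (\<lambda>t x. 4 * tanh (2 * x) * Rb R0 t x)"
      by (rule has_partials_cong[OF C[of "2 * R0"]]) (use th' in \<open>auto simp: Rb_def E_def mult.assoc\<close>)
    show "has_partials (\<lambda>t x. 2 * tanh (2 * x) * Rb R0 t x) (\<lambda>t x. 4 * tanh (2 * x) * Rb R0 t x) (\<lambda>t x. 4 * Rb R0 t x)"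
      by (rule has_partials_cong[OF S[of "2 * R0"]]) (use th' in \<open>auto simp: Rb_def E_def mult.assoc\<close>)
  qed
qed

text \<open>The difference \<open>r = R - R\<^sub>b\<close> satisfies \<open>\<bar>r\<^sub>t\<bar>, \<bar>r\<^sub>x\<bar> \<le> 2\<delta>\<close> by transport, hence \<open>\<bar>r\<bar> \<le> \<delta> (1 + 2t)\<close>. Both
deviations are quotients of such terms by \<open>R \<ge> R\<^sub>b/2\<close>, and \<open>\<delta> (1 + t) e\<^bsup>-2t\<^esup> \<le> \<delta> e\<^bsup>-t\<^esup>\<close>. The factor \<open>12\<close> in the
smallness condition makes the bounds at most \<open>1\<close> and keeps \<open>R\<close> positive.\<close>

lemma areal_perturbation:
  assumes R: "has_partials2 R Rt Rx Rtt Rtx Rxx" and wave: "\<And>t x. t \<ge> 0 \<Longrightarrow> Rxx t x - Rtt t x = 0"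
    and "R0 > 0" "\<delta> > 0" "12 * \<delta> \<le> R0"
    and data: "\<And>x. \<bar>R 0 x - Rb R0 0 x\<bar> \<le> \<delta>" "\<And>x. \<bar>Rt 0 x - 2 * Rb R0 0 x\<bar> \<le> \<delta>"
      "\<And>x. \<bar>Rx 0 x - 2 * tanh (2 * x) * Rb R0 0 x\<bar> \<le> \<delta>"
    and "t \<ge> 0"
  shows "R t x > 0" "\<bar>Rt t x / R t x - 2\<bar> \<le> 12 * \<delta> / R0 * exp (- t) * sech2 x"
    "\<bar>Rx t x / R t x - 2 * tanh (2 * x)\<bar> \<le> 12 * \<delta> / R0 * exp (- t) * sech2 x"
proof -
  define r where "r t x = R t x - Rb R0 t x" for t x
  define rt where "rt t x = Rt t x - 2 * Rb R0 t x" for t x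
  define rx where "rx t x = Rx t x - 2 * tanh (2 * x) * Rb R0 t x" for t x
  have r: "has_partials2 r rt rx (\<lambda>t x. Rtt t x - 4 * Rb R0 t x)
     (\<lambda>t x. Rtx t x - 4 * tanh (2 * x) * Rb R0 t x) (\<lambda>t x. Rxx t x - 4 * Rb R0 t x)"
    unfolding r_def[abs_def] rt_def[abs_def] rx_def[abs_def] by (rule has_partials2_diff[OF R Rb_partials])
  have tr: "\<bar>rt s y + c * rx s y\<bar> \<le> 2 * \<delta>" if "s \<ge> 0" "c = 1 \<or> c = -1" for s y c
  proof -
    have "\<bar>rt s y + c * rx s y\<bar> \<le> \<bar>rt 0 (y + c * s)\<bar> + \<bar>rx 0 (y + c * s)\<bar> + (0 - 0)"
    proof (rule transport_bound[OF r that])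
      show "((\<lambda>_. 0) has_real_derivative 0) (at \<sigma> within {0..s})" for \<sigma> by simp
    qed (use wave in auto)
    with data(2,3)[of "y + c * s"] show ?thesis by (simp add: rt_def rx_def)
  qed
  have b: "\<bar>rt s y\<bar> \<le> 2 * \<delta>" "\<bar>rx s y\<bar> \<le> 2 * \<delta>" if "s \<ge> 0" for s y
    using tr[OF that, of 1 y] tr[OF that, of "-1" y] by auto
  have dr: "((\<lambda>s. r s x) has_real_derivative rt s x) (at s within {0..t})" if "s \<in> {0..t}" for s
    by (rule DERIV_subset[of _ _ _ "{0..}"]) (use r that in \<open>auto simp: has_partials2_def has_partials_def\<close>)
  have dl: "((\<lambda>s. 2 * \<delta> * s) has_real_derivative 2 * \<delta>) (at s within {0..t})" for s
    by (auto intro!: derivative_eq_intros)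
  have "r t x - r 0 x \<le> 2 * \<delta> * t - 2 * \<delta> * 0"
    by (rule increment_le_of_derivative_le[OF \<open>t \<ge> 0\<close> dr dl]) (use b in \<open>auto simp: abs_le_iff\<close>)
  moreover have "- r t x - - r 0 x \<le> 2 * \<delta> * t - 2 * \<delta> * 0"
    by (rule increment_le_of_derivative_le[OF \<open>t \<ge> 0\<close> DERIV_minus[OF dr] dl])
      (use b(1)[of _ x] in \<open>force simp: abs_le_iff\<close>)+
  moreover have "\<bar>r 0 x\<bar> \<le> \<delta>" using data(1) by (simp add: r_def)
  ultimately have r1: "\<bar>r t x\<bar> \<le> \<delta> * (1 + 2 * t)" by (simp add: algebra_simps)
  define B where "B = Rb R0 t x"
  have B: "B = R0 * (exp t * exp t) * cosh (2 * x)"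
    by (simp add: B_def Rb_def mult_exp_exp[symmetric] exp_add[symmetric])
  have et: "1 + t \<le> exp t" "1 \<le> exp t" using \<open>t \<ge> 0\<close> by auto
  have "\<delta> * (1 + 2 * t) \<le> \<delta> * (2 * exp t)"
    using et \<open>\<delta> > 0\<close> by (intro mult_left_mono) linarith+
  also have "\<dots> \<le> \<delta> * (2 * (exp t * exp t))"
    using et \<open>\<delta> > 0\<close> by (intro mult_left_mono) auto
  also have "\<dots> \<le> (R0 / 12) * (2 * (exp t * exp t))"
    using assms(5) by (intro mult_right_mono) auto
  also have "\<dots> \<le> (R0 / 12) * (2 * (exp t * exp t)) * cosh (2 * x)"
    using cosh_2x_ge_1[of x] \<open>R0 > 0\<close> mult_left_mono[of 1 "cosh (2 * x)" "(R0 / 12) * (2 * (exp t * exp t))"] by simp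
  finally have "\<delta> * (1 + 2 * t) \<le> B / 6" by (simp add: B)
  moreover have "B > 0" using \<open>R0 > 0\<close> by (simp add: B)
  ultimately have RB: "R t x \<ge> B / 2" using r1 by (simp add: r_def B_def)
  with \<open>B > 0\<close> show Rpos: "R t x > 0" by linarith
  have num: "2 * \<delta> + 2 * \<bar>r t x\<bar> \<le> 6 * \<delta> * exp t"
  proof -
    have "2 * \<delta> + 2 * \<bar>r t x\<bar> \<le> \<delta> * (4 + 4 * t)" using r1 by (simp add: algebra_simps)
    also have "\<dots> \<le> \<delta> * (6 * exp t)" using et \<open>\<delta> > 0\<close> by (intro mult_left_mono) linarith+
    finally show ?thesis by simp
  qed
  have key: "\<bar>z / R t x\<bar> \<le> 12 * \<delta> / R0 * exp (- t) * sech2 x" if "\<bar>z\<bar> \<le> 2 * \<delta> + 2 * \<bar>r t x\<bar>" for z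
  proof -
    have "\<bar>z / R t x\<bar> = \<bar>z\<bar> / R t x" using Rpos by (simp add: abs_divide)
    also have "\<dots> \<le> (6 * \<delta> * exp t) / (B / 2)"
      using that num RB \<open>B > 0\<close> by (intro frac_le) auto
    also have "\<dots> = 12 * \<delta> / R0 * exp (- t) * sech2 x"
      using \<open>R0 > 0\<close> by (simp add: B exp_minus field_simps)
    finally show ?thesis .
  qed
  have "Rt t x / R t x - 2 = (rt t x - 2 * r t x) / R t x"
    using Rpos by (simp add: rt_def r_def field_simps)
  moreover have "\<bar>rt t x - 2 * r t x\<bar> \<le> 2 * \<delta> + 2 * \<bar>r t x\<bar>" using b(1)[OF \<open>t \<ge> 0\<close>, of x] by linarith
  ultimately show "\<bar>Rt t x / R t x - 2\<bar> \<le> 12 * \<delta> / R0 * exp (- t) * sech2 x" using key by metis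
  have "Rx t x / R t x - 2 * tanh (2 * x) = (rx t x - 2 * tanh (2 * x) * r t x) / R t x"
    using Rpos by (simp add: rx_def r_def field_simps)
  moreover have "\<bar>rx t x - 2 * tanh (2 * x) * r t x\<bar> \<le> 2 * \<delta> + 2 * \<bar>r t x\<bar>"
  proof -
    have "\<bar>2 * tanh (2 * x) * r t x\<bar> \<le> 2 * \<bar>r t x\<bar>"
      using mult_right_mono[OF abs_tanh_le_1[of x], of "\<bar>r t x\<bar>"] by (simp add: abs_mult)
    then show ?thesis using b(2)[OF \<open>t \<ge> 0\<close>, of x] by linarith
  qed
  ultimately show "\<bar>Rx t x / R t x - 2 * tanh (2 * x)\<bar> \<le> 12 * \<delta> / R0 * exp (- t) * sech2 x" using key by metis
qed

text \<open>A continuity argument in time would need the supremum over all \<open>x\<close> to be continuous in \<open>t\<close>. On the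
compact triangle below \<open>(T, X)\<close> there is an earliest point at which the bound fails, and the triangle
below that point contains no failure before its apex.\<close>

lemma first_exit_in_triangles:
  assumes G: "cont_hp G"
    and step: "\<And>T X. T \<ge> 0 \<Longrightarrow> (\<And>s y. 0 \<le> s \<Longrightarrow> s < T \<Longrightarrow> \<bar>y - X\<bar> \<le> T - s \<Longrightarrow> G s y < \<mu>) \<Longrightarrow> G T X < \<mu>"
    and "T \<ge> 0"
  shows "G T X < (\<mu>::real)"
proof (rule ccontr)
  assume bad: "\<not> G T X < \<mu>"
  define S where "S = {p \<in> {0..T} \<times> {X - T..X + T}. \<mu> \<le> G (fst p) (snd p)} \<inter> {p. \<bar>snd p - X\<bar> \<le> T - fst p}"
  have "closed {p \<in> {0..T} \<times> {X - T..X + T}. \<mu> \<le> G (fst p) (snd p)}"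
    by (intro continuous_on_closed_Collect_le closed_Times continuous_intros
        cont_hp_compose[OF G]) auto
  then have "closed S" unfolding S_def by (intro closed_Int closed_Collect_le continuous_intros) auto
  moreover have "compact ({0..T} \<times> {X - T..X + T})" by (intro compact_Times compact_Icc)
  moreover have "S \<subseteq> {0..T} \<times> {X - T..X + T}" by (auto simp: S_def)
  ultimately have "compact S" by (metis compact_Int_closed inf.absorb_iff2)
  moreover have "(T, X) \<in> S" using bad \<open>T \<ge> 0\<close> by (auto simp: S_def)
  moreover have "continuous_on S fst" by (intro continuous_intros)
  ultimately obtain p where p: "p \<in> S" "\<And>p'. p' \<in> S \<Longrightarrow> fst p \<le> fst p'"
    using continuous_attains_inf[of S fst] by blast
  obtain s y where sy: "p = (s, y)" by fastforce
  have "G s y < \<mu>"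
  proof (rule step)
    show "s \<ge> 0" using p sy by (auto simp: S_def)
    fix s' y' assume *: "0 \<le> s'" "s' < s" "\<bar>y' - y\<bar> \<le> s - s'"
    show "G s' y' < \<mu>"
    proof (rule ccontr)
      assume "\<not> G s' y' < \<mu>"
      moreover have "\<bar>y - X\<bar> \<le> T - s" using p(1) sy by (auto simp: S_def)
      ultimately have "(s', y') \<in> S" using * by (auto simp: S_def)
      from p(2)[OF this] sy * show False by simp
    qed
  qed
  moreover have "\<mu> \<le> G s y" using p(1) sy by (auto simp: S_def)
  ultimately show False by simp
qed

text \<open>The factor \<open>e\<^bsup>-t/4\<^esup>\<close> compensates the growth permitted by \<open>weighted_wave_bound\<close>.\<close>

definition weighted_size where
  "weighted_size u ut ux q qt qx t x = weight t x *
     (\<bar>u t x\<bar> + \<bar>ut t x\<bar> + \<bar>ux t x\<bar> + \<bar>q t x\<bar> + \<bar>qt t x\<bar> + \<bar>qx t x\<bar>) * exp (- t / 4)"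

lemma weighted_size_bounds:
  assumes "weighted_size u ut ux q qt qx t x < \<mu>"
  shows "weight t x * \<bar>u t x\<bar> \<le> \<mu> * exp (t / 4)" "weight t x * \<bar>ut t x\<bar> \<le> \<mu> * exp (t / 4)"
    "weight t x * \<bar>ux t x\<bar> \<le> \<mu> * exp (t / 4)" "weight t x * \<bar>q t x\<bar> \<le> \<mu> * exp (t / 4)"
    "weight t x * \<bar>qt t x\<bar> \<le> \<mu> * exp (t / 4)" "weight t x * \<bar>qx t x\<bar> \<le> \<mu> * exp (t / 4)"
proof -
  define \<Sigma> where "\<Sigma> = \<bar>u t x\<bar> + \<bar>ut t x\<bar> + \<bar>ux t x\<bar> + \<bar>q t x\<bar> + \<bar>qt t x\<bar> + \<bar>qx t x\<bar>"
  have "weight t x * \<Sigma> = weighted_size u ut ux q qt qx t x * exp (t / 4)"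
    by (simp add: weighted_size_def \<Sigma>_def exp_minus)
  also have "\<dots> \<le> \<mu> * exp (t / 4)" using assms by (intro mult_right_mono) auto
  finally have *: "weight t x * \<Sigma> \<le> \<mu> * exp (t / 4)" .
  have "weight t x * \<bar>z\<bar> \<le> \<mu> * exp (t / 4)" if "\<bar>z\<bar> \<le> \<Sigma>" for z
    by (rule order_trans[OF mult_left_mono[OF that] *]) (simp add: less_imp_le)
  then show "weight t x * \<bar>u t x\<bar> \<le> \<mu> * exp (t / 4)" "weight t x * \<bar>ut t x\<bar> \<le> \<mu> * exp (t / 4)"
    "weight t x * \<bar>ux t x\<bar> \<le> \<mu> * exp (t / 4)" "weight t x * \<bar>q t x\<bar> \<le> \<mu> * exp (t / 4)"
    "weight t x * \<bar>qt t x\<bar> \<le> \<mu> * exp (t / 4)" "weight t x * \<bar>qx t x\<bar> \<le> \<mu> * exp (t / 4)"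
    by (auto simp: \<Sigma>_def)
qed

lemma weighted_decay:
  assumes "weight t x * \<bar>z\<bar> \<le> \<mu> * exp (t / 4)"
  shows "\<bar>z\<bar> \<le> \<mu> * exp (- (3 / 4) * t)"
proof -
  have "exp t * \<bar>z\<bar> \<le> weight t x * \<bar>z\<bar>" by (intro mult_right_mono weight_ge) auto
  then have "exp t * \<bar>z\<bar> \<le> \<mu> * exp (t / 4)" using assms by linarith
  then have "exp (- t) * (exp t * \<bar>z\<bar>) \<le> exp (- t) * (\<mu> * exp (t / 4))" by (intro mult_left_mono) auto
  moreover have "exp (- t) * (exp t * \<bar>z\<bar>) = \<bar>z\<bar>" by (simp add: exp_minus)
  moreover have "exp (- t) * exp (t / 4) = exp (- (3 / 4) * t)" by (rule exp_mult_eq) simp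
  ultimately show ?thesis by (metis mult.left_commute)
qed

text \<open>One of the two weights pays for the growth factors \<open>e\<^bsup>t/4\<^esup>\<close>: this is why quadratic terms are harmless
in the weighted equation. With both weights spent, a product even decays integrably in time and space.\<close>

lemma weighted_product:
  assumes "weight t x * \<bar>z\<bar> \<le> \<mu> * exp (t / 4)" "weight t x * \<bar>z'\<bar> \<le> \<mu> * exp (t / 4)" "t \<ge> 0" "\<mu> \<ge> 0"
  shows "weight t x * \<bar>z * z'\<bar> \<le> \<mu>\<^sup>2" "\<bar>z * z'\<bar> \<le> \<mu>\<^sup>2 * exp (- t / 2) * sech2 x"
proof -
  have P: "(weight t x * \<bar>z\<bar>) * (weight t x * \<bar>z'\<bar>) \<le> (\<mu> * exp (t / 4)) * (\<mu> * exp (t / 4))"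
    by (rule mult_mono[OF assms(1,2)])
      (use assms(4) in \<open>auto intro!: mult_nonneg_nonneg less_imp_le[OF weight_pos]\<close>)
  have ee: "exp (t / 4) * exp (t / 4) = exp (t / 2)" by (rule exp_mult_eq) simp
  have "weight t x * weight t x * \<bar>z * z'\<bar> = (weight t x * \<bar>z\<bar>) * (weight t x * \<bar>z'\<bar>)"
    by (simp add: abs_mult)
  also note P
  also have "(\<mu> * exp (t / 4)) * (\<mu> * exp (t / 4)) = \<mu>\<^sup>2 * exp (t / 2)"
    unfolding ee[symmetric] by (simp add: power2_eq_square)
  finally have P': "weight t x * weight t x * \<bar>z * z'\<bar> \<le> \<mu>\<^sup>2 * exp (t / 2)" .
  have "exp (t / 2) \<le> exp t" using assms(3) by simp
  also have "\<dots> \<le> weight t x" by (rule weight_ge)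
  finally have "\<mu>\<^sup>2 * exp (t / 2) \<le> \<mu>\<^sup>2 * weight t x" by (intro mult_left_mono) auto
  with P' have "weight t x * weight t x * \<bar>z * z'\<bar> \<le> \<mu>\<^sup>2 * weight t x" by linarith
  then have "weight t x * (weight t x * \<bar>z * z'\<bar>) \<le> weight t x * \<mu>\<^sup>2"
    by (simp only: mult.assoc mult.commute[of "\<mu>\<^sup>2"])
  then show "weight t x * \<bar>z * z'\<bar> \<le> \<mu>\<^sup>2" using weight_pos[of t x] by simp
  have "\<bar>z * z'\<bar> \<le> \<mu>\<^sup>2 * exp (t / 2) / (exp (2 * t) * cosh (2 * x))"
    using P' unfolding weight_square by (simp add: field_simps)
  also have "\<dots> = \<mu>\<^sup>2 * exp (- (3/2) * t) * sech2 x"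
  proof -
    have "exp (- (3/2) * t) * exp (2 * t) = exp (t / 2)" by (rule exp_mult_eq) simp
    then show ?thesis by (simp add: field_simps)
  qed
  also have "\<dots> \<le> \<mu>\<^sup>2 * exp (- t / 2) * sech2 x"
    using assms(3) by (intro mult_right_mono mult_left_mono) auto
  finally show "\<bar>z * z'\<bar> \<le> \<mu>\<^sup>2 * exp (- t / 2) * sech2 x" .
qed

text \<open>An upper bound for \<open>e\<^bsup>-4W\<^esup>\<close> while \<open>\<bar>W - W\<^sub>b\<bar> \<le> 1\<close>, from \<open>0 < arctan < 2\<close> on the positive axis.\<close>

definition exp_const :: "real \<Rightarrow> real \<Rightarrow> real" where
  "exp_const W0 W1 = exp (4 * (\<bar>W1\<bar> + 2 * \<bar>W0\<bar> + 1))"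

lemma exp_W_bound:
  assumes "\<bar>u\<bar> \<le> 1"
  shows "exp (- 4 * (u + Wb W0 W1 t x)) \<le> exp_const W0 W1"
proof -
  have "0 < arctan (exp (2 * x))" "arctan (exp (2 * x)) < 2"
    using arctan_ubound[of "exp (2 * x)"] pi_half_less_two by auto
  then have "\<bar>W0 * arctan (exp (2 * x))\<bar> \<le> \<bar>W0\<bar> * 2"
    unfolding abs_mult by (intro mult_left_mono) auto
  moreover define w where "w = W0 * arctan (exp (2 * x))"
  ultimately have "\<bar>w\<bar> \<le> 2 * \<bar>W0\<bar>" by simp
  then have "- w \<le> 2 * \<bar>W0\<bar>" by (simp add: abs_le_iff)
  moreover have "- u \<le> 1" "- W1 \<le> \<bar>W1\<bar>" using assms by (simp_all add: abs_le_iff)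
  ultimately have "(- u) + ((- W1) + (- w)) \<le> 1 + (\<bar>W1\<bar> + 2 * \<bar>W0\<bar>)" by (intro add_mono)
  then have "- 4 * (u + (W1 + w)) \<le> 4 * (\<bar>W1\<bar> + 2 * \<bar>W0\<bar> + 1)"
    by (simp add: algebra_simps)
  then have "- 4 * (u + Wb W0 W1 t x) \<le> 4 * (\<bar>W1\<bar> + 2 * \<bar>W0\<bar> + 1)"
    by (simp add: Wb_def w_def)
  then show ?thesis by (simp add: exp_const_def)
qed

definition source_const :: "real \<Rightarrow> real \<Rightarrow> real" where
  "source_const W0 W1 = 8 + \<bar>W0\<bar> + exp_const W0 W1"

text \<open>Here \<open>al\<close> and \<open>be\<close> stand for \<open>R\<^sub>t/R - 2\<close> and \<open>R\<^sub>x/R - 2 tanh (2x)\<close>. The one term that is linear in them and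
does not contain the unknowns, \<open>be * W\<^sub>0 / cosh (2x)\<close>, stems from the background \<open>W\<^sub>b\<close>: its weighted size
is bounded since \<open>be\<close> decays like \<open>e\<^bsup>-t\<^esup>\<close>, and the two factors \<open>1 / cosh (2x)\<close> beat the spatial weight.\<close>

lemma nonlinear_source_bounds:
  fixes u ut ux q qt qx al be d \<mu> :: real
  assumes z: "weight t x * \<bar>u\<bar> \<le> \<mu> * exp (t / 4)" "weight t x * \<bar>ut\<bar> \<le> \<mu> * exp (t / 4)"
    "weight t x * \<bar>ux\<bar> \<le> \<mu> * exp (t / 4)" "weight t x * \<bar>q\<bar> \<le> \<mu> * exp (t / 4)"
    "weight t x * \<bar>qt\<bar> \<le> \<mu> * exp (t / 4)" "weight t x * \<bar>qx\<bar> \<le> \<mu> * exp (t / 4)"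
    and \<mu>: "0 \<le> \<mu>" "\<mu> \<le> 1" and t: "t \<ge> 0" and d: "d \<ge> 0"
    and ab: "\<bar>al\<bar> \<le> d * exp (- t) * sech2 x" "\<bar>be\<bar> \<le> d * exp (- t) * sech2 x"
  shows "weight t x * \<bar>- al * ut + be * (ux + W0 * sech2 x)
       - (qt\<^sup>2 - qx\<^sup>2) / 2 * exp (- 4 * (u + Wb W0 W1 t x))\<bar> \<le> source_const W0 W1 * (d + \<mu>\<^sup>2)"
    "weight t x * \<bar>- al * qt + be * qx + 4 * qt * ut - 4 * qx * ux\<bar> \<le> source_const W0 W1 * (d + \<mu>\<^sup>2)"
proof -
  note weight = weight_pos[of t x]
  define E where "E = exp_const W0 W1"
  have E0: "E \<ge> 0" by (simp add: E_def exp_const_def)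
  have lin: "weight t x * \<bar>c * z\<bar> \<le> d" if "\<bar>c\<bar> \<le> d * exp (- t) * sech2 x" "weight t x * \<bar>z\<bar> \<le> \<mu> * exp (t / 4)" for c z
  proof -
    have "weight t x * \<bar>c * z\<bar> = \<bar>c\<bar> * (weight t x * \<bar>z\<bar>)" by (simp add: abs_mult)
    also have "\<dots> \<le> (d * exp (- t) * sech2 x) * (\<mu> * exp (t / 4))"
      by (rule mult_mono[OF that]) (use weight d in \<open>auto intro!: mult_nonneg_nonneg less_imp_le[OF weight]\<close>)
    also have "\<dots> \<le> (d * exp (- t) * 1) * (1 * exp t)"
      using sech2_bounds[of x] \<mu> d t by (intro mult_mono) (auto intro!: mult_nonneg_nonneg)
    also have "\<dots> = d" by (simp add: exp_minus)
    finally show ?thesis .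
  qed
  have lin2: "weight t x * \<bar>be * (W0 * sech2 x)\<bar> \<le> d * \<bar>W0\<bar>"
  proof -
    have "sqrt (cosh (2 * x)) \<le> cosh (2 * x) * cosh (2 * x)"
    proof -
      have "sqrt (cosh (2 * x)) \<le> cosh (2 * x)"
        using cosh_2x_ge_1[of x] by (intro real_le_lsqrt) (auto simp: power2_eq_square)
      also have "\<dots> \<le> cosh (2 * x) * cosh (2 * x)"
        using cosh_2x_ge_1[of x] mult_left_mono[of 1 "cosh (2 * x)" "cosh (2 * x)"] by simp
      finally show ?thesis .
    qed
    then have c: "sqrt (cosh (2 * x)) * (sech2 x * sech2 x) \<le> 1" by (simp add: divide_le_eq)
    have "weight t x * \<bar>be * (W0 * sech2 x)\<bar> = \<bar>be\<bar> * (weight t x * (\<bar>W0\<bar> * sech2 x))" by (simp add: abs_mult)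
    also have "\<dots> \<le> (d * exp (- t) * sech2 x) * (weight t x * (\<bar>W0\<bar> * sech2 x))"
      using ab(2) less_imp_le[OF weight] sech2_bounds(1)[of x]
      by (intro mult_right_mono mult_nonneg_nonneg) auto
    also have "\<dots> = d * \<bar>W0\<bar> * (exp (- t) * exp t) * (sqrt (cosh (2 * x)) * (sech2 x * sech2 x))"
      by (simp add: weight_def mult_ac)
    also have "\<dots> \<le> d * \<bar>W0\<bar> * (exp (- t) * exp t) * 1"
      using c d by (intro mult_left_mono) auto
    also have "\<dots> = d * \<bar>W0\<bar>" by (simp add: exp_minus)
    finally show ?thesis .
  qed
  have "\<bar>u\<bar> \<le> \<mu> * exp (- (3 / 4) * t)" by (rule weighted_decay[OF z(1)])
  also have "\<dots> \<le> 1 * 1" using \<mu> t by (intro mult_mono) auto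
  finally have eW: "exp (- 4 * (u + Wb W0 W1 t x)) \<le> E"
    unfolding E_def by (intro exp_W_bound) simp
  note pr = weighted_product(1)[OF _ _ t \<mu>(1)]
  have quad: "weight t x * \<bar>(qt\<^sup>2 - qx\<^sup>2) / 2 * exp (- 4 * (u + Wb W0 W1 t x))\<bar> \<le> \<mu>\<^sup>2 * E"
  proof -
    have "weight t x * \<bar>qt\<^sup>2 - qx\<^sup>2\<bar> \<le> weight t x * (\<bar>qt * qt\<bar> + \<bar>qx * qx\<bar>)"
      unfolding power2_eq_square by (intro mult_left_mono abs_triangle_ineq4 less_imp_le[OF weight])
    also have "\<dots> \<le> 2 * \<mu>\<^sup>2" using pr[OF z(5) z(5)] pr[OF z(6) z(6)] by (simp add: distrib_left)
    finally have *: "weight t x * \<bar>(qt\<^sup>2 - qx\<^sup>2) / 2\<bar> \<le> \<mu>\<^sup>2" by simp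
    have "weight t x * \<bar>(qt\<^sup>2 - qx\<^sup>2) / 2 * exp (- 4 * (u + Wb W0 W1 t x))\<bar>
      = (weight t x * \<bar>(qt\<^sup>2 - qx\<^sup>2) / 2\<bar>) * exp (- 4 * (u + Wb W0 W1 t x))"
      by (simp only: abs_mult abs_exp_cancel mult.assoc)
    also have "\<dots> \<le> \<mu>\<^sup>2 * E" using * eW by (intro mult_mono) auto
    finally show ?thesis .
  qed
  have tri: "weight t x * \<bar>a + b\<bar> \<le> weight t x * \<bar>a\<bar> + weight t x * \<bar>b\<bar>" for a b
    using weight by (simp add: distrib_left[symmetric])
  define Q where "Q = (qt\<^sup>2 - qx\<^sup>2) / 2 * exp (- 4 * (u + Wb W0 W1 t x))"
  have "weight t x * \<bar>- al * ut + be * (ux + W0 * sech2 x) - Q\<bar>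
      \<le> weight t x * \<bar>al * ut\<bar> + (weight t x * \<bar>be * ux\<bar> + weight t x * \<bar>be * (W0 * sech2 x)\<bar>) + weight t x * \<bar>Q\<bar>"
    using tri[of "- al * ut + be * (ux + W0 * sech2 x)" "- Q"] tri[of "- al * ut" "be * (ux + W0 * sech2 x)"]
      tri[of "be * ux" "be * (W0 * sech2 x)"] by (simp add: distrib_left)
  also have "\<dots> \<le> d + (d + d * \<bar>W0\<bar>) + \<mu>\<^sup>2 * E"
    using lin[OF ab(1) z(2)] lin[OF ab(2) z(3)] lin2 quad unfolding Q_def by linarith
  also have "\<dots> \<le> source_const W0 W1 * (d + \<mu>\<^sup>2)"
  proof -
    have "source_const W0 W1 * (d + \<mu>\<^sup>2) = d + (d + d * \<bar>W0\<bar>) + \<mu>\<^sup>2 * E + (6 * d + 8 * \<mu>\<^sup>2 + \<bar>W0\<bar> * \<mu>\<^sup>2 + E * d)"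
      by (simp add: source_const_def E_def[symmetric] algebra_simps)
    moreover have "6 * d + 8 * \<mu>\<^sup>2 + \<bar>W0\<bar> * \<mu>\<^sup>2 + E * d \<ge> 0" using d E0 by simp
    ultimately show ?thesis by linarith
  qed
  finally show "weight t x * \<bar>- al * ut + be * (ux + W0 * sech2 x)
       - (qt\<^sup>2 - qx\<^sup>2) / 2 * exp (- 4 * (u + Wb W0 W1 t x))\<bar> \<le> source_const W0 W1 * (d + \<mu>\<^sup>2)"
    unfolding Q_def .
  have "weight t x * \<bar>- al * qt + be * qx + 4 * qt * ut - 4 * qx * ux\<bar>
    \<le> weight t x * \<bar>al * qt\<bar> + weight t x * \<bar>be * qx\<bar> + 4 * (weight t x * \<bar>qt * ut\<bar>) + 4 * (weight t x * \<bar>qx * ux\<bar>)"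
    using tri[of "- al * qt + be * qx + 4 * (qt * ut)" "- 4 * (qx * ux)"]
      tri[of "- al * qt + be * qx" "4 * (qt * ut)"] tri[of "- al * qt" "be * qx"]
    by (simp add: abs_mult mult_ac)
  also have "\<dots> \<le> 2 * d + 8 * \<mu>\<^sup>2"
    using lin[OF ab(1) z(5)] lin[OF ab(2) z(6)] pr[OF z(5) z(2)] pr[OF z(6) z(3)] by linarith
  also have "\<dots> \<le> source_const W0 W1 * (d + \<mu>\<^sup>2)"
  proof -
    have "source_const W0 W1 * (d + \<mu>\<^sup>2) = 2 * d + 8 * \<mu>\<^sup>2 + (6 * d + \<bar>W0\<bar> * d + E * d + \<bar>W0\<bar> * \<mu>\<^sup>2 + E * \<mu>\<^sup>2)"
      by (simp add: source_const_def E_def[symmetric] algebra_simps)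
    moreover have "6 * d + \<bar>W0\<bar> * d + E * d + \<bar>W0\<bar> * \<mu>\<^sup>2 + E * \<mu>\<^sup>2 \<ge> 0" using d E0 by simp
    ultimately show ?thesis by linarith
  qed
  finally show "weight t x * \<bar>- al * qt + be * qx + 4 * qt * ut - 4 * qx * ux\<bar> \<le> source_const W0 W1 * (d + \<mu>\<^sup>2)" .
qed

text \<open>As long as the weighted size stays below \<open>\<mu>\<close>, the sources are at most
\<open>source_const * (d + \<mu>\<^sup>2)\<close>, and the linear estimate returns a size proportional to \<open>A + source_const * (d + \<mu>\<^sup>2)\<close>. This
is smaller than \<open>\<mu>\<close> by the smallness hypothesis, whose factor \<open>6\<close> counts the summands of the weighted size.\<close>

lemma perturbation_decay:
  assumes u: "has_partials2 u ut ux utt utx uxx" and q: "has_partials2 q qt qx qtt qtx qxx"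
    and equ: "\<And>t x. t \<ge> 0 \<Longrightarrow> utt t x - uxx t x + 2 * ut t x - 2 * slope 0 x * ux t x =
      - al t x * ut t x + be t x * (ux t x + W0 * sech2 x)
       - ((qt t x)\<^sup>2 - (qx t x)\<^sup>2) / 2 * exp (- 4 * (u t x + Wb W0 W1 t x))"
    and eqq: "\<And>t x. t \<ge> 0 \<Longrightarrow> qtt t x - qxx t x + 2 * qt t x - 2 * slope (2 * W0) x * qx t x =
      - al t x * qt t x + be t x * qx t x + 4 * qt t x * ut t x - 4 * qx t x * ux t x"
    and ab: "\<And>t x. t \<ge> 0 \<Longrightarrow> \<bar>al t x\<bar> \<le> d * exp (- t) * sech2 x"
      "\<And>t x. t \<ge> 0 \<Longrightarrow> \<bar>be t x\<bar> \<le> d * exp (- t) * sech2 x"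
    and data: "\<And>x. weight 0 x * \<bar>u 0 x\<bar> \<le> A" "\<And>x. weight 0 x * \<bar>ut 0 x\<bar> \<le> A" "\<And>x. weight 0 x * \<bar>ux 0 x\<bar> \<le> A"
      "\<And>x. weight 0 x * \<bar>q 0 x\<bar> \<le> A" "\<And>x. weight 0 x * \<bar>qt 0 x\<bar> \<le> A" "\<And>x. weight 0 x * \<bar>qx 0 x\<bar> \<le> A"
    and "A > 0" "d \<ge> 0" "0 < \<mu>" "\<mu> \<le> 1"
    and small: "6 * (weighted_const 0 + weighted_const (2 * W0)) * (A + source_const W0 W1 * (d + \<mu>\<^sup>2)) < \<mu>"
    and "t \<ge> 0"
  shows "weighted_size u ut ux q qt qx t x < \<mu>"
proof (rule first_exit_in_triangles[where G = "weighted_size u ut ux q qt qx", OF _ _ \<open>t \<ge> 0\<close>])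
  have c: "cont_hp u" "cont_hp ut" "cont_hp ux" "cont_hp q" "cont_hp qt" "cont_hp qx"
    using u q by (auto simp: has_partials2_def intro: has_partials_cont)
  have "cont_hp weight"
    unfolding weight_def by (intro cont_hp_intros(4,6,7) continuous_intros)
  then show "cont_hp (weighted_size u ut ux q qt qx)"
    unfolding weighted_size_def[abs_def]
    by (intro cont_hp_intros(2,4,5,7) c continuous_intros) simp_all
  fix T X :: real
  assume "T \<ge> 0" and small_before: "\<And>s y. 0 \<le> s \<Longrightarrow> s < T \<Longrightarrow> \<bar>y - X\<bar> \<le> T - s \<Longrightarrow> weighted_size u ut ux q qt qx s y < \<mu>"
  define \<eta> where "\<eta> = source_const W0 W1 * (d + \<mu>\<^sup>2)"
  have "\<eta> \<ge> 0" using assms by (auto simp: \<eta>_def source_const_def exp_const_def intro!: mult_nonneg_nonneg)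
  define M where "M = (weighted_const 0 + weighted_const (2 * W0)) * (A + \<eta>) * exp (T / 4)"
  have srcs: "weight s y * \<bar>utt s y - uxx s y + 2 * ut s y - 2 * slope 0 y * ux s y\<bar> \<le> \<eta>"
    "weight s y * \<bar>qtt s y - qxx s y + 2 * qt s y - 2 * slope (2 * W0) y * qx s y\<bar> \<le> \<eta>"
    if "0 \<le> s" "s < T" "\<bar>y - X\<bar> \<le> T - s" for s y
    unfolding equ[OF that(1)] eqq[OF that(1)] \<eta>_def
    using nonlinear_source_bounds[OF weighted_size_bounds[OF small_before[OF that]] less_imp_le[OF \<open>0 < \<mu>\<close>]
        \<open>\<mu> \<le> 1\<close> that(1) \<open>d \<ge> 0\<close> ab[OF that(1), of y]]
    by blast+
  have ub: "weight T X * \<bar>u T X\<bar> \<le> weighted_const 0 * (A + \<eta>) * exp (T / 4)"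
    "weight T X * \<bar>ut T X\<bar> \<le> weighted_const 0 * (A + \<eta>) * exp (T / 4)"
    "weight T X * \<bar>ux T X\<bar> \<le> weighted_const 0 * (A + \<eta>) * exp (T / 4)"
    by (rule weighted_wave_bound[OF u \<open>T \<ge> 0\<close> \<open>A > 0\<close> \<open>\<eta> \<ge> 0\<close>]; use data srcs(1) in simp)+
  have qb: "weight T X * \<bar>q T X\<bar> \<le> weighted_const (2 * W0) * (A + \<eta>) * exp (T / 4)"
    "weight T X * \<bar>qt T X\<bar> \<le> weighted_const (2 * W0) * (A + \<eta>) * exp (T / 4)"
    "weight T X * \<bar>qx T X\<bar> \<le> weighted_const (2 * W0) * (A + \<eta>) * exp (T / 4)"
    by (rule weighted_wave_bound[OF q \<open>T \<ge> 0\<close> \<open>A > 0\<close> \<open>\<eta> \<ge> 0\<close>]; use data srcs(2) in simp)+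
  have M0: "weighted_const k * (A + \<eta>) * exp (T / 4) \<ge> 0" for k
    using weighted_const_pos[of k] \<open>A > 0\<close> \<open>\<eta> \<ge> 0\<close> by (intro mult_nonneg_nonneg) auto
  have M: "M = weighted_const 0 * (A + \<eta>) * exp (T / 4) + weighted_const (2 * W0) * (A + \<eta>) * exp (T / 4)"
    by (simp add: M_def distrib_right)
  have "weighted_size u ut ux q qt qx T X = (weight T X * \<bar>u T X\<bar> + weight T X * \<bar>ut T X\<bar> + weight T X * \<bar>ux T X\<bar> +
      weight T X * \<bar>q T X\<bar> + weight T X * \<bar>qt T X\<bar> + weight T X * \<bar>qx T X\<bar>) * exp (- T / 4)"
    by (simp only: weighted_size_def distrib_left)
  also have "\<dots> \<le> (6 * M) * exp (- T / 4)"
    using ub qb M M0[of 0] M0[of "2 * W0"] by (intro mult_right_mono) (linarith, simp)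
  also have "\<dots> = 6 * (weighted_const 0 + weighted_const (2 * W0)) * (A + \<eta>)"
    by (simp add: M_def mult_exp_exp exp_minus)
  also have "\<dots> < \<mu>" using small by (simp add: \<eta>_def)
  finally show "weighted_size u ut ux q qt qx T X < \<mu>" .
qed

section \<open>Stability of the metric function\<close>

lemma slice_antiderivative:
  assumes F: "\<And>x. (F has_real_derivative f x) (at x)"
  shows "slice (\<lambda>s y. f y) T X s = F (X + (T - s)) - F (X - (T - s))"
proof -
  have "((\<lambda>z. (T - s) * f (X + (T - s) * z)) has_integral
      F (X + (T - s) * 1) - F (X + (T - s) * (-1))) {-1..1}"
  proof (rule fundamental_theorem_of_calculus)
    fix z :: real
    have g: "((\<lambda>z. X + (T - s) * z) has_real_derivative T - s) (at z)"
      by (auto intro!: derivative_eq_intros)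
    have "((\<lambda>z. F (X + (T - s) * z)) has_real_derivative f (X + (T - s) * z) * (T - s)) (at z)"
      by (rule DERIV_chain2[OF F g])
    then show "((\<lambda>z. F (X + (T - s) * z)) has_vector_derivative (T - s) * f (X + (T - s) * z)) (at z within {-1..1})"
      by (simp add: has_field_derivative_at_within mult.commute flip: has_real_derivative_iff_has_vector_derivative)
  qed simp
  then have "integral {-1..1} (\<lambda>z. (T - s) * f (X + (T - s) * z)) = F (X + (T - s) * 1) - F (X + (T - s) * (-1))"
    by (rule integral_unique)
  moreover have "X + (T - s) * (-1) = X - (T - s)" by simp
  ultimately show ?thesis by (simp only: slice_def integral_mult_right mult_1_right)
qed

lemma slice_abs_le:
  assumes "cont_hp e" "cont_hp f" "0 \<le> s" "s \<le> T"
    and le: "\<And>y. \<bar>y - X\<bar> \<le> T - s \<Longrightarrow> \<bar>e s y\<bar> \<le> f s y"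
  shows "\<bar>slice e T X s\<bar> \<le> slice f T X s"
proof -
  have "slice e T X s \<le> slice f T X s"
    by (rule slice_mono[OF assms(1-4)]) (use le in \<open>force simp: abs_le_iff\<close>)
  moreover have "slice (\<lambda>s y. (-1) * e s y) T X s \<le> slice f T X s"
    by (rule slice_mono[OF cont_hp_intros(4)[OF cont_hp_intros(1) assms(1)] assms(2-4)])
      (use le in \<open>force simp: abs_le_iff\<close>)
  ultimately show ?thesis unfolding slice_cmult by linarith
qed

text \<open>The quantity \<open>slice b\<^sub>t + b(right end) + b(left end)\<close> has derivative \<open>slice (b\<^sub>t\<^sub>t - b\<^sub>x\<^sub>x)\<close> in \<open>s\<close>: the flux of
\<open>(b\<^sub>t, b\<^sub>x)\<close> through the sides cancels the derivatives of the end values. At \<open>s = T\<close> it is \<open>2 b(T, X)\<close>.\<close>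

lemma wave_duhamel_bound:
  assumes b: "has_partials2 b bt bx btt btx bxx" and "T \<ge> 0"
    and G: "\<And>s. s \<in> {0..T} \<Longrightarrow> (G has_real_derivative G' s) (at s within {0..T})"
    and le: "\<And>s. 0 < s \<Longrightarrow> s < T \<Longrightarrow> \<bar>slice (\<lambda>s y. btt s y - bxx s y) T X s\<bar> \<le> G' s"
  shows "2 * \<bar>b T X\<bar> \<le> \<bar>slice bt T X 0\<bar> + \<bar>b 0 (X + T)\<bar> + \<bar>b 0 (X - T)\<bar> + (G T - G 0)"
proof -
  have p: "has_partials b bt bx" "has_partials bt btt btx" "has_partials bx btx bxx"
    using b by (auto simp: has_partials2_def)
  define J where "J s = slice bt T X s + b s (X + (T - s)) + b s (X - (T - s))" for s
  define J' where "J' s = slice (\<lambda>s y. btt s y - bxx s y) T X s" for s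
  have J: "(J has_real_derivative J' s) (at s within {0..T})" if s: "s \<in> {0..T}" for s
  proof -
    have s0: "s \<ge> 0" using s by simp
    have d: "((\<lambda>s. X + (T - s)) has_real_derivative -1) (at s within {0..})"
      "((\<lambda>s. X - (T - s)) has_real_derivative 1) (at s within {0..})"
      by (auto intro!: derivative_eq_intros)
    have "(J has_real_derivative J' s) (at s within {0..})"
      using DERIV_add[OF DERIV_add[OF slice_has_derivative[OF p(2,3) s0, of T X] has_partials_along[OF p(1) s0 d(1)]]
          has_partials_along[OF p(1) s0 d(2)]]
      by (simp add: J_def[abs_def] J'_def)
    then show ?thesis by (rule DERIV_subset) auto
  qed
  have "J T - J 0 \<le> G T - G 0"
    by (rule increment_le_of_derivative_le[OF \<open>T \<ge> 0\<close> J G]) (use le in \<open>auto simp: J'_def abs_le_iff\<close>)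
  moreover have "- J T - - J 0 \<le> G T - G 0"
    by (rule increment_le_of_derivative_le[OF \<open>T \<ge> 0\<close> DERIV_minus[OF J] G])
      (use le in \<open>auto simp: J'_def abs_le_iff\<close>)
  moreover have "J T = 2 * b T X" by (simp add: J_def slice_def)
  moreover have "J 0 = slice bt T X 0 + b 0 (X + T) + b 0 (X - T)" by (simp add: J_def)
  ultimately show ?thesis by linarith
qed

lemma slice_le_L1_norm:
  assumes f: "continuous_on UNIV f" and "L1_norm f \<le> ennreal c" "c \<ge> 0" "T \<ge> 0"
  shows "slice (\<lambda>s y. \<bar>f y\<bar>) T X 0 \<le> c"
proof -
  define l where "l = X - T - 1"
  define F where "F x = integral {l..x} (\<lambda>y. \<bar>f y\<bar>)" for x
  have cf: "continuous_on S (\<lambda>y. \<bar>f y\<bar>)" for S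
    using f by (intro continuous_intros) (auto intro: continuous_on_subset)
  have F: "(F has_real_derivative \<bar>f x\<bar>) (at x)" if "l < x" for x
  proof -
    have "(F has_real_derivative \<bar>f x\<bar>) (at x within {l..x + 1})"
      unfolding F_def by (rule integral_has_real_derivative[OF cf]) (use that in auto)
    then show ?thesis using that by (simp add: at_within_Icc_at)
  qed
  have "slice (\<lambda>s y. \<bar>f y\<bar>) T X 0 = F (X + T) - F (X - T)"
  proof -
    have "((\<lambda>z. T * \<bar>f (X + T * z)\<bar>) has_integral F (X + T * 1) - F (X + T * (-1))) {-1..1}"
    proof (rule fundamental_theorem_of_calculus)
      fix z :: real assume z: "z \<in> {-1..1}"
      have g: "((\<lambda>z. X + T * z) has_real_derivative T) (at z)"
        by (auto intro!: derivative_eq_intros)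
      have "T * (-1) \<le> T * z" using z \<open>T \<ge> 0\<close> by (intro mult_left_mono) auto
      then have "l < X + T * z" by (simp add: l_def)
      from DERIV_chain2[OF F[OF this] g]
      show "((\<lambda>z. F (X + T * z)) has_vector_derivative T * \<bar>f (X + T * z)\<bar>) (at z within {-1..1})"
        by (simp add: has_field_derivative_at_within mult.commute flip: has_real_derivative_iff_has_vector_derivative)
    qed simp
    then have "integral {-1..1} (\<lambda>z. T * \<bar>f (X + T * z)\<bar>) = F (X + T * 1) - F (X + T * (-1))"
      by (rule integral_unique)
    moreover have "X + T * (-1) = X - T" by simp
    ultimately show ?thesis by (simp only: slice_def integral_mult_right mult_1_right diff_zero)
  qed
  moreover have "ennreal (F (X + T) - F (X - T)) \<le> ennreal c"
  proof -
    have "(\<integral>\<^sup>+x. ennreal \<bar>f x\<bar> * indicator {X - T..X + T} x \<partial>lborel) = ennreal (F (X + T) - F (X - T))"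
    proof (rule nn_integral_FTC_Icc)
      show "(\<lambda>y. \<bar>f y\<bar>) \<in> borel_measurable borel" by (rule borel_measurable_continuous_onI[OF cf])
      show "(F has_real_derivative \<bar>f x\<bar>) (at x)" if "x \<in> {X - T..X + T}" for x
        by (rule F) (use that in \<open>simp add: l_def\<close>)
    qed (use \<open>T \<ge> 0\<close> in auto)
    then have "ennreal (F (X + T) - F (X - T)) = (\<integral>\<^sup>+x. ennreal \<bar>f x\<bar> * indicator {X - T..X + T} x \<partial>lborel)" by simp
    also have "\<dots> \<le> (\<integral>\<^sup>+x. ennreal \<bar>f x\<bar> \<partial>lborel)"
      by (intro nn_integral_mono) (auto simp: indicator_def)
    also have "\<dots> \<le> ennreal c" using assms(2) by (simp add: L1_norm_def)
    finally show ?thesis .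
  qed
  ultimately show ?thesis using \<open>c \<ge> 0\<close> by simp
qed

lemma C0_norm_le_imp:
  assumes "C0_norm f \<le> ennreal c" "c \<ge> 0" shows "\<bar>f x\<bar> \<le> c"
proof -
  have "ennreal \<bar>f x\<bar> \<le> C0_norm f" unfolding C0_norm_def by (rule SUP_upper) simp
  with assms(1) have "ennreal \<bar>f x\<bar> \<le> ennreal c" by (rule order_trans[rotated])
  then show ?thesis using assms(2) by simp
qed

lemma C0_norm_leI:
  assumes "\<And>x. \<bar>f x\<bar> \<le> c" shows "C0_norm f \<le> ennreal c"
  unfolding C0_norm_def using assms by (intro SUP_least ennreal_leI)

lemma C0_norm_le_Ck_norm:
  assumes "i \<le> k" shows "C0_norm ((deriv ^^ i) f) \<le> Ck_norm k f"
  unfolding Ck_norm_def using assms by (intro member_le_sum) auto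

lemma ennreal_add_leD:
  assumes "(a :: ennreal) + b \<le> c" shows "a \<le> c" "b \<le> c"
  using order_trans[OF add_increasing2[OF zero_le order_refl] assms]
    order_trans[OF add_increasing[OF zero_le order_refl] assms] by auto

lemma Wb_partials:
  "has_partials2 (Wb W0 W1) (\<lambda>t x. 0) (\<lambda>t x. W0 * sech2 x) (\<lambda>t x. 0) (\<lambda>t x. 0)
     (\<lambda>t x. - 2 * W0 * sech2 x * tanh (2 * x))"
proof -
  have c: "continuous_on UNIV (\<lambda>x. W0 * sech2 x)" "continuous_on UNIV (\<lambda>x. - 2 * W0 * sech2 x * tanh (2 * x))"
    by (intro continuous_intros continuous_on_tanh_2x; simp)+
  have "((\<lambda>x. W1 + W0 * arctan (exp (2 * x))) has_real_derivative W0 * sech2 x) (at x)" for x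
    using DERIV_add[OF DERIV_const DERIV_cmult[OF arctan_exp_has_derivative[of x], of W0], of W1] by simp
  from has_partials_space[OF this c(1)] have 1: "has_partials (Wb W0 W1) (\<lambda>t x. 0) (\<lambda>t x. W0 * sech2 x)"
    by (simp add: Wb_def[abs_def])
  have "((\<lambda>x. W0 * sech2 x) has_real_derivative - 2 * W0 * sech2 x * tanh (2 * x)) (at x)" for x
    using DERIV_cmult[OF sech2_has_derivative[of x], of W0] by (simp add: mult_ac)
  from has_partials_space[OF this c(2)] 1 show ?thesis
    by (simp add: has_partials2_def has_partials_space)
qed

lemma ab_partials:
  "has_partials2 (ab a0 W0) (\<lambda>t x. 3/2 + W0\<^sup>2 / 2) (\<lambda>t x. - (1/2 + W0\<^sup>2 / 2) * tanh (2 * x))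
     (\<lambda>t x. 0) (\<lambda>t x. 0) (\<lambda>t x. - (1 + W0\<^sup>2) * (sech2 x)\<^sup>2)"
proof -
  define k where "k = 1/2 + W0\<^sup>2 / 2"
  have c: "continuous_on UNIV (\<lambda>x. - k * tanh (2 * x))" "continuous_on UNIV (\<lambda>x. - (1 + W0\<^sup>2) * (sech2 x)\<^sup>2)"
    by (intro continuous_intros continuous_on_tanh_2x; simp)+
  have "((\<lambda>x. ln (cosh (2 * x))) has_real_derivative 2 * tanh (2 * x)) (at x)" for x :: real
    by (auto intro!: derivative_eq_intros simp: tanh_def field_simps)
  then have "((\<lambda>x. a0 - k * (1/2) * ln (cosh (2 * x))) has_real_derivative - k * tanh (2 * x)) (at x)" for x
    using DERIV_diff[OF DERIV_const DERIV_cmult[of "\<lambda>x. ln (cosh (2 * x))" "2 * tanh (2 * x)" x UNIV "k * (1/2)"], of a0]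
    by simp
  from has_partials_space[OF this c(1)]
  have sp: "has_partials (\<lambda>t x. a0 - k * (1/2) * ln (cosh (2 * x))) (\<lambda>t x. 0) (\<lambda>t x. - k * tanh (2 * x))" .
  have ti: "has_partials (\<lambda>t x. (3/2 + W0\<^sup>2 / 2) * t) (\<lambda>t x. 3/2 + W0\<^sup>2 / 2) (\<lambda>t x. 0)"
    by (rule has_partials_time) (auto intro!: derivative_eq_intros)
  have 1: "has_partials (ab a0 W0) (\<lambda>t x. 3/2 + W0\<^sup>2 / 2) (\<lambda>t x. - k * tanh (2 * x))"
    by (rule has_partials_cong[OF has_partials_add[OF sp ti]]) (auto simp: ab_def k_def)
  have "((\<lambda>x. - k * tanh (2 * x)) has_real_derivative - (1 + W0\<^sup>2) * (sech2 x)\<^sup>2) (at x)" for x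
  proof -
    have "- k * (2 * (sech2 x)\<^sup>2) = - (1 + W0\<^sup>2) * (sech2 x)\<^sup>2"
      by (simp add: k_def algebra_simps del: power_divide power_one_over divide_const_simps)
    with DERIV_cmult[OF tanh_2x_has_derivative[of x], of "- k"] show ?thesis by (simp only:)
  qed
  from has_partials_space[OF this c(2)] 1 has_partials_space[of "\<lambda>x. 3/2 + W0\<^sup>2 / 2" "\<lambda>x. 0"] show ?thesis
    by (simp add: has_partials2_def k_def)
qed

text \<open>The background contributions \<open>((2 tanh (2x))\<^sup>2 - 2\<^sup>2)/4 - W\<^sub>0\<^sup>2 / cosh(2x)\<^sup>2\<close> cancel against
\<open>(1 + W\<^sub>0\<^sup>2) / cosh(2x)\<^sup>2\<close>. What remains is linear in \<open>al\<close> and \<open>be\<close>, quadratic in the unknowns, or the linear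
term \<open>2 W\<^sub>0 u\<^sub>x / cosh (2x)\<close>, which decays because \<open>u\<^sub>x\<close> does and which the factor \<open>1 / cosh (2x)\<close> makes
integrable in space.\<close>

lemma metric_source_bound:
  fixes u ut ux q qt qx al be d \<mu> :: real
  assumes z: "weight t x * \<bar>u\<bar> \<le> \<mu> * exp (t / 4)" "weight t x * \<bar>ut\<bar> \<le> \<mu> * exp (t / 4)"
    "weight t x * \<bar>ux\<bar> \<le> \<mu> * exp (t / 4)" "weight t x * \<bar>q\<bar> \<le> \<mu> * exp (t / 4)"
    "weight t x * \<bar>qt\<bar> \<le> \<mu> * exp (t / 4)" "weight t x * \<bar>qx\<bar> \<le> \<mu> * exp (t / 4)"
    and \<mu>: "0 \<le> \<mu>" "\<mu> \<le> 1" and t: "t \<ge> 0" and d: "0 \<le> d" "d \<le> 1"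
    and ab: "\<bar>al\<bar> \<le> d * exp (- t) * sech2 x" "\<bar>be\<bar> \<le> d * exp (- t) * sech2 x"
  shows "\<bar>((2 * tanh (2 * x) + be)\<^sup>2 - (2 + al)\<^sup>2) / 4 + (1 + W0\<^sup>2) * (sech2 x)\<^sup>2
      + ut\<^sup>2 - (ux + W0 * sech2 x)\<^sup>2 + 1/4 * (qt\<^sup>2 - qx\<^sup>2) * exp (- 4 * (u + Wb W0 W1 t x))\<bar>
    \<le> (3 * d + (2 + 2 * \<bar>W0\<bar> + exp_const W0 W1) * \<mu>) * (exp (- t / 2) * sech2 x)"
proof -
  define \<rho> where "\<rho> = exp (- t / 2) * sech2 x"
  note S = sech2_bounds[of x]
  have \<rho>0: "0 \<le> \<rho>" unfolding \<rho>_def using S by (intro mult_nonneg_nonneg) auto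
  have D: "d * exp (- t) * sech2 x \<le> d * \<rho>"
    unfolding \<rho>_def mult.assoc using S d t by (intro mult_left_mono mult_right_mono) auto
  have D1: "d * exp (- t) * sech2 x \<le> 1"
  proof -
    have "d * exp (- t) * sech2 x \<le> 1 * 1 * 1"
      using S d t by (intro mult_mono mult_nonneg_nonneg) auto
    then show ?thesis by simp
  qed
  have a1: "\<bar>al\<bar> \<le> d * \<rho>" "\<bar>be\<bar> \<le> d * \<rho>" "\<bar>al\<bar> \<le> 1" "\<bar>be\<bar> \<le> 1" using ab D D1 by linarith+
  have sq: "\<bar>z\<^sup>2\<bar> \<le> d * \<rho>" if "\<bar>z\<bar> \<le> d * \<rho>" "\<bar>z\<bar> \<le> 1" for z :: real
  proof -
    have "\<bar>z\<^sup>2\<bar> = \<bar>z\<bar> * \<bar>z\<bar>" by (simp add: power2_eq_square)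
    also have "\<dots> \<le> d * \<rho> * 1" using that by (intro mult_mono) auto
    finally show ?thesis by simp
  qed
  have tb: "\<bar>tanh (2 * x) * be\<bar> \<le> d * \<rho>"
    using mult_mono[OF abs_tanh_le_1[of x] a1(2)] by (simp add: abs_mult)
  have e1: "((2 * tanh (2 * x) + be)\<^sup>2 - (2 + al)\<^sup>2) / 4 + (sech2 x)\<^sup>2 = tanh (2 * x) * be + be\<^sup>2 / 4 - al - al\<^sup>2 / 4"
  proof -
    have "((2 * tanh (2 * x) + be)\<^sup>2 - (2 + al)\<^sup>2) / 4 =
      (tanh (2 * x))\<^sup>2 + tanh (2 * x) * be + be\<^sup>2 / 4 - 1 - al - al\<^sup>2 / 4"
      by (simp add: power2_eq_square field_simps)
    then show ?thesis using tanh_sech[of x] by linarith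
  qed
  have t1: "\<bar>((2 * tanh (2 * x) + be)\<^sup>2 - (2 + al)\<^sup>2) / 4 + (sech2 x)\<^sup>2\<bar> \<le> 3 * (d * \<rho>)"
    unfolding e1 using tb sq[OF a1(1,3)] sq[OF a1(2,4)] a1(1) by linarith
  have \<mu>2: "\<mu>\<^sup>2 \<le> \<mu>" using \<mu> mult_left_mono[of \<mu> 1 \<mu>] by (simp add: power2_eq_square)
  have pr: "\<bar>z\<^sup>2\<bar> \<le> \<mu> * \<rho>" if "weight t x * \<bar>z\<bar> \<le> \<mu> * exp (t / 4)" for z
  proof -
    have "\<bar>z\<^sup>2\<bar> \<le> \<mu>\<^sup>2 * exp (- t / 2) * sech2 x"
      using weighted_product(2)[OF that that t \<mu>(1)] by (simp add: power2_eq_square)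
    also have "\<dots> = \<mu>\<^sup>2 * \<rho>" by (simp add: \<rho>_def)
    also have "\<dots> \<le> \<mu> * \<rho>" using \<mu>2 \<rho>0 by (rule mult_right_mono)
    finally show ?thesis .
  qed
  have t2: "\<bar>W0 * sech2 x * ux\<bar> \<le> \<bar>W0\<bar> * (\<mu> * \<rho>)"
  proof -
    have "\<bar>ux\<bar> \<le> \<mu> * exp (- (3/4) * t)" by (rule weighted_decay[OF z(3)])
    also have "\<dots> \<le> \<mu> * exp (- t / 2)" using \<mu> t by (intro mult_left_mono) auto
    finally have "sech2 x * \<bar>ux\<bar> \<le> sech2 x * (\<mu> * exp (- t / 2))" using S by (intro mult_left_mono) auto
    then have "\<bar>W0\<bar> * (sech2 x * \<bar>ux\<bar>) \<le> \<bar>W0\<bar> * (\<mu> * \<rho>)"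
      by (intro mult_left_mono) (auto simp: \<rho>_def mult_ac)
    then show ?thesis by (simp add: abs_mult)
  qed
  have "\<bar>u\<bar> \<le> \<mu> * exp (- (3 / 4) * t)" by (rule weighted_decay[OF z(1)])
  also have "\<dots> \<le> 1 * 1" using \<mu> t by (intro mult_mono) auto
  finally have eW: "exp (- 4 * (u + Wb W0 W1 t x)) \<le> exp_const W0 W1" by (intro exp_W_bound) simp
  have t3: "\<bar>1/4 * (qt\<^sup>2 - qx\<^sup>2) * exp (- 4 * (u + Wb W0 W1 t x))\<bar> \<le> \<mu> * \<rho> * exp_const W0 W1"
  proof -
    have "\<bar>qt\<^sup>2 - qx\<^sup>2\<bar> \<le> \<bar>qt\<^sup>2\<bar> + \<bar>qx\<^sup>2\<bar>" by (rule abs_triangle_ineq4)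
    then have "\<bar>qt\<^sup>2 - qx\<^sup>2\<bar> \<le> 4 * (\<mu> * \<rho>)"
      using pr[OF z(5)] pr[OF z(6)] \<rho>0 \<mu> mult_nonneg_nonneg[of \<mu> \<rho>] by linarith
    then have "\<bar>1/4 * (qt\<^sup>2 - qx\<^sup>2)\<bar> \<le> \<mu> * \<rho>" by (simp add: abs_mult)
    then have "\<bar>1/4 * (qt\<^sup>2 - qx\<^sup>2)\<bar> * exp (- 4 * (u + Wb W0 W1 t x)) \<le> \<mu> * \<rho> * exp_const W0 W1"
      using eW by (intro mult_mono) auto
    then show ?thesis by (simp only: abs_mult abs_exp_cancel)
  qed
  have split: "((2 * tanh (2 * x) + be)\<^sup>2 - (2 + al)\<^sup>2) / 4 + (1 + W0\<^sup>2) * (sech2 x)\<^sup>2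
      + ut\<^sup>2 - (ux + W0 * sech2 x)\<^sup>2 + 1/4 * (qt\<^sup>2 - qx\<^sup>2) * exp (- 4 * (u + Wb W0 W1 t x))
    = (((2 * tanh (2 * x) + be)\<^sup>2 - (2 + al)\<^sup>2) / 4 + (sech2 x)\<^sup>2) + ut\<^sup>2 - ux\<^sup>2 - 2 * (W0 * sech2 x * ux)
      + 1/4 * (qt\<^sup>2 - qx\<^sup>2) * exp (- 4 * (u + Wb W0 W1 t x))"
  proof -
    have "(ux + W0 * sech2 x)\<^sup>2 = ux\<^sup>2 + 2 * (W0 * sech2 x * ux) + W0\<^sup>2 * (sech2 x)\<^sup>2"
      unfolding power2_sum power_mult_distrib by (simp only: mult_ac)
    moreover have "(1 + W0\<^sup>2) * (sech2 x)\<^sup>2 = (sech2 x)\<^sup>2 + W0\<^sup>2 * (sech2 x)\<^sup>2"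
      by (simp only: distrib_right mult_1_left)
    ultimately show ?thesis by linarith
  qed
  have "(3 * d + (2 + 2 * \<bar>W0\<bar> + exp_const W0 W1) * \<mu>) * \<rho> =
      3 * (d * \<rho>) + (\<mu> * \<rho> + \<mu> * \<rho>) + 2 * (\<bar>W0\<bar> * (\<mu> * \<rho>)) + \<mu> * \<rho> * exp_const W0 W1"
    by (simp add: algebra_simps)
  then show ?thesis
    unfolding split \<rho>_def[symmetric] using t1 pr[OF z(2)] pr[OF z(3)] t2 t3 by linarith
qed

lemma Ht_norm_pointwise:
  assumes "Ht_norm k f \<le> ennreal \<delta>" "\<delta> > 0" "k \<ge> 1" "continuous_on UNIV f"
  shows "weight 0 x * \<bar>f x\<bar> \<le> 12 * \<delta>"
proof -
  have "Ht_norm k f < ennreal (2 * \<delta>)" using assms(1,2) by (simp add: le_less_trans ennreal_lessI)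
  then obtain g where "Ht_derivs k f g" "sqrt (\<Sum>i\<le>k. \<integral>x. (g i x)\<^sup>2 * cosh (2 * x) \<partial>lborel) < 2 * \<delta>"
    by (rule Ht_norm_less_witness)
  from Ht_pointwise_bound[OF this assms(3,4), of x] assms(2) show ?thesis by (simp add: weight_def)
qed

lemma Ht_norm_pointwise_deriv:
  assumes "Ht_norm k f \<le> ennreal \<delta>" "\<delta> > 0" "k \<ge> 2" "\<And>x. (f has_real_derivative f' x) (at x)"
  shows "weight 0 x * \<bar>f' x\<bar> \<le> 12 * \<delta>"
proof -
  have "Ht_norm k f < ennreal (2 * \<delta>)" using assms(1,2) by (simp add: le_less_trans ennreal_lessI)
  then obtain g where "Ht_derivs k f g" "sqrt (\<Sum>i\<le>k. \<integral>x. (g i x)\<^sup>2 * cosh (2 * x) \<partial>lborel) < 2 * \<delta>"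
    by (rule Ht_norm_less_witness)
  from Ht_pointwise_deriv_bound[OF this assms(3,4), of x] show ?thesis by (simp add: weight_def)
qed

text \<open>The number \<open>\<mu>\<close> is the size to which the perturbation is kept by the first-exit argument; it is chosen
before \<open>\<delta>\<close>, since the bound on the source contains it.\<close>

lemma metric_perturbation_source:
  assumes sol: "is_solution R W q a" and "R0 > 0" "\<delta> > 0" "12 * \<delta> \<le> R0" "0 < \<mu>" "\<mu> \<le> 1"
    and norms: "M_norm 3 W0 W1 W q 0 + m_norm 3 R0 R 0 \<le> ennreal \<delta>"
    and small: "6 * (weighted_const 0 + weighted_const (2 * W0)) *
       (12 * \<delta> + source_const W0 W1 * (12 * \<delta> / R0 + \<mu>\<^sup>2)) < \<mu>"
    and t: "t \<ge> 0"
  shows "\<bar>pd_t (pd_t a) t x - (pd_x (pd_x a) t x + (1 + W0\<^sup>2) * (sech2 x)\<^sup>2)\<bar>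
    \<le> (36 * \<delta> / R0 + (2 + 2 * \<bar>W0\<bar> + exp_const W0 W1) * \<mu>) * (exp (- t / 2) * sech2 x)"
proof -
  have C2: "has_partials2 R (pd_t R) (pd_x R) (pd_t (pd_t R)) (pd_x (pd_t R)) (pd_x (pd_x R))"
    "has_partials2 W (pd_t W) (pd_x W) (pd_t (pd_t W)) (pd_x (pd_t W)) (pd_x (pd_x W))"
    "has_partials2 q (pd_t q) (pd_x q) (pd_t (pd_t q)) (pd_x (pd_t q)) (pd_x (pd_x q))"
    using sol by (auto simp: is_solution_def intro!: C2_tx_has_partials2)
  note eqs = sol[unfolded is_solution_def, THEN conjunct2, THEN conjunct2, THEN conjunct2, THEN conjunct2,
      rule_format]
  define u where "u = (\<lambda>t x. W t x - Wb W0 W1 t x)"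
  define ut where "ut = (\<lambda>t x. pd_t W t x - 0)"
  define ux where "ux = (\<lambda>t x. pd_x W t x - W0 * sech2 x)"
  have u: "has_partials2 u ut ux (\<lambda>t x. pd_t (pd_t W) t x - 0) (\<lambda>t x. pd_x (pd_t W) t x - 0)
     (\<lambda>t x. pd_x (pd_x W) t x - (- 2 * W0 * sech2 x * tanh (2 * x)))"
    unfolding u_def ut_def ux_def by (rule has_partials2_diff[OF C2(2) Wb_partials])
  define r where "r = (\<lambda>t x. R t x - Rb R0 t x)"
  have r: "has_partials2 r (\<lambda>t x. pd_t R t x - 2 * Rb R0 t x)
     (\<lambda>t x. pd_x R t x - 2 * tanh (2 * x) * Rb R0 t x)
     (\<lambda>t x. pd_t (pd_t R) t x - 4 * Rb R0 t x)
     (\<lambda>t x. pd_x (pd_t R) t x - 4 * tanh (2 * x) * Rb R0 t x) (\<lambda>t x. pd_x (pd_x R) t x - 4 * Rb R0 t x)"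
    unfolding r_def by (rule has_partials2_diff[OF C2(1) Rb_partials])
  note n1 = ennreal_add_leD[OF norms]
  note nM = n1(1)[unfolded M_norm_def] and nm = ennreal_add_leD[OF n1(2)[unfolded m_norm_def]]
  note nq' = ennreal_add_leD[OF nM] 
  note nq = ennreal_add_leD[OF nq'(1)]
  note nu = ennreal_add_leD[OF nq(1)]
  have fu0: "(u 0 has_real_derivative ux 0 x) (at x)" "(q 0 has_real_derivative pd_x q 0 x) (at x)" for x
    using u C2(3) by (auto simp: has_partials2_def has_partials_def)
  have cu: "continuous_on UNIV (u 0)" "continuous_on UNIV (ut 0)" "continuous_on UNIV (q 0)" "continuous_on UNIV (pd_t q 0)"
  proof -
    have *: "cont_hp u" "cont_hp ut" "cont_hp q" "cont_hp (pd_t q)"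
      using u C2(3) by (auto simp: has_partials2_def intro: has_partials_cont)
    have "continuous_on UNIV (f 0)" if "cont_hp f" for f
      by (rule cont_hp_compose[OF that]) (auto intro!: continuous_intros)
    with * show "continuous_on UNIV (u 0)" "continuous_on UNIV (ut 0)" "continuous_on UNIV (q 0)" "continuous_on UNIV (pd_t q 0)"
      by auto
  qed
  have ut0: "pd_t u 0 = ut 0"
    using has_partials_pd(1)[of u ut ux 0] u by (auto simp: has_partials2_def)
  have data: "weight 0 x * \<bar>u 0 x\<bar> \<le> 12 * \<delta>" "weight 0 x * \<bar>ut 0 x\<bar> \<le> 12 * \<delta>" "weight 0 x * \<bar>ux 0 x\<bar> \<le> 12 * \<delta>"
      "weight 0 x * \<bar>q 0 x\<bar> \<le> 12 * \<delta>" "weight 0 x * \<bar>pd_t q 0 x\<bar> \<le> 12 * \<delta>" "weight 0 x * \<bar>pd_x q 0 x\<bar> \<le> 12 * \<delta>" for x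
  proof -
    have h: "Ht_norm 3 (u 0) \<le> ennreal \<delta>" "Ht_norm 2 (ut 0) \<le> ennreal \<delta>"
      "Ht_norm 3 (q 0) \<le> ennreal \<delta>" "Ht_norm 2 (pd_t q 0) \<le> ennreal \<delta>"
      using nu nq(2) nq'(2) ut0 by (simp_all add: u_def)
    show "weight 0 x * \<bar>u 0 x\<bar> \<le> 12 * \<delta>" "weight 0 x * \<bar>ut 0 x\<bar> \<le> 12 * \<delta>"
      "weight 0 x * \<bar>q 0 x\<bar> \<le> 12 * \<delta>" "weight 0 x * \<bar>pd_t q 0 x\<bar> \<le> 12 * \<delta>"
      using h Ht_norm_pointwise \<open>\<delta> > 0\<close> cu by auto
    show "weight 0 x * \<bar>ux 0 x\<bar> \<le> 12 * \<delta>" "weight 0 x * \<bar>pd_x q 0 x\<bar> \<le> 12 * \<delta>"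
      using Ht_norm_pointwise_deriv[OF h(1) \<open>\<delta> > 0\<close> _ fu0(1)] Ht_norm_pointwise_deriv[OF h(3) \<open>\<delta> > 0\<close> _ fu0(2)]
      by auto
  qed
  have R_data: "\<bar>R 0 x - Rb R0 0 x\<bar> \<le> \<delta>" "\<bar>pd_t R 0 x - 2 * Rb R0 0 x\<bar> \<le> \<delta>"
    "\<bar>pd_x R 0 x - 2 * tanh (2 * x) * Rb R0 0 x\<bar> \<le> \<delta>" for x
  proof -
    have c: "C0_norm (r 0) \<le> ennreal \<delta>" "C0_norm (deriv (r 0)) \<le> ennreal \<delta>"
      "C0_norm (\<lambda>x. pd_t R 0 x - pd_t (Rb R0) 0 x) \<le> ennreal \<delta>"
      using order_trans[OF C0_norm_le_Ck_norm[of 0 3] nm(1)] order_trans[OF C0_norm_le_Ck_norm[of 1 3] nm(1)]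
        order_trans[OF C0_norm_le_Ck_norm[of 0 "3 - 1"] nm(2)] by (auto simp: r_def)
    have "pd_t (Rb R0) 0 x = 2 * Rb R0 0 x" for x
      using has_partials_pd(1)[of "Rb R0" _ _ 0 x] Rb_partials[of R0] by (auto simp: has_partials2_def)
    then show "\<bar>R 0 x - Rb R0 0 x\<bar> \<le> \<delta>" "\<bar>pd_t R 0 x - 2 * Rb R0 0 x\<bar> \<le> \<delta>"
      using C0_norm_le_imp[OF c(1), of x] C0_norm_le_imp[OF c(3), of x] \<open>\<delta> > 0\<close> by (simp_all add: r_def)
    have "(r 0 has_real_derivative (pd_x R 0 x - 2 * tanh (2 * x) * Rb R0 0 x)) (at x)"
      using r by (auto simp: has_partials2_def has_partials_def)
    then have "deriv (r 0) x = pd_x R 0 x - 2 * tanh (2 * x) * Rb R0 0 x" by (rule DERIV_imp_deriv)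
    then show "\<bar>pd_x R 0 x - 2 * tanh (2 * x) * Rb R0 0 x\<bar> \<le> \<delta>"
      using C0_norm_le_imp[OF c(2), of x] \<open>\<delta> > 0\<close> by simp
  qed
  define d where "d = 12 * \<delta> / R0"
  have d: "0 \<le> d" "d \<le> 1" using assms(2-4) by (auto simp: d_def divide_le_eq)
  define al where "al t x = pd_t R t x / R t x - 2" for t x
  define be where "be t x = pd_x R t x / R t x - 2 * tanh (2 * x)" for t x
  note areal = areal_perturbation[OF C2(1) _ assms(2-4) R_data]
  have abb: "\<bar>al t x\<bar> \<le> d * exp (- t) * sech2 x" "\<bar>be t x\<bar> \<le> d * exp (- t) * sech2 x"
    and Rpos: "R t x > 0" if "t \<ge> 0" for t x
    using areal(1)[OF _ that, of x] areal(2)[OF _ that, of x] areal(3)[OF _ that, of x] eqs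
    by (auto simp: al_def be_def d_def)
  have Rq: "pd_t R t x / R t x = 2 + al t x" "pd_x R t x / R t x = 2 * tanh (2 * x) + be t x" for t x
    by (simp_all add: al_def be_def)
  have size: "weighted_size u ut ux q (pd_t q) (pd_x q) t x < \<mu>"
  proof (rule perturbation_decay[OF u C2(3) _ _ abb data _ d(1) \<open>0 < \<mu>\<close> \<open>\<mu> \<le> 1\<close> _ t])
    fix t x :: real assume t: "t \<ge> 0"
    have Wu: "u t x + Wb W0 W1 t x = W t x" by (simp add: u_def)
    have "pd_t (pd_t W) t x - pd_x (pd_x W) t x
          + (2 + al t x) * pd_t W t x - (2 * tanh (2 * x) + be t x) * pd_x W t x
          + ((pd_t q t x)\<^sup>2 - (pd_x q t x)\<^sup>2) / 2 * exp (- 4 * W t x) = 0"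
      using eqs[OF t, of x] unfolding Rq by blast
    then show "pd_t (pd_t W) t x - 0 - (pd_x (pd_x W) t x - - 2 * W0 * sech2 x * tanh (2 * x)) +
        2 * ut t x - 2 * slope 0 x * ux t x =
        - al t x * ut t x + be t x * (ux t x + W0 * sech2 x) -
        ((pd_t q t x)\<^sup>2 - (pd_x q t x)\<^sup>2) / 2 * exp (- 4 * (u t x + Wb W0 W1 t x))"
      unfolding Wu ut_def ux_def slope_def by (simp add: algebra_simps)
    have "pd_t (pd_t q) t x - pd_x (pd_x q) t x
          + (2 + al t x) * pd_t q t x - (2 * tanh (2 * x) + be t x) * pd_x q t x
          - 4 * pd_t q t x * pd_t W t x + 4 * pd_x q t x * pd_x W t x = 0"
      using eqs[OF t, of x] unfolding Rq by blast
    then show "pd_t (pd_t q) t x - pd_x (pd_x q) t x + 2 * pd_t q t x - 2 * slope (2 * W0) x * pd_x q t x =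
        - al t x * pd_t q t x + be t x * pd_x q t x + 4 * pd_t q t x * ut t x - 4 * pd_x q t x * ux t x"
      unfolding ut_def ux_def slope_def by (simp add: algebra_simps)
  qed (use \<open>\<delta> > 0\<close> small in \<open>auto simp: d_def\<close>)
  define src where "src = ((2 * tanh (2 * x) + be t x)\<^sup>2 - (2 + al t x)\<^sup>2) / 4 + (1 + W0\<^sup>2) * (sech2 x)\<^sup>2
      + (ut t x)\<^sup>2 - (ux t x + W0 * sech2 x)\<^sup>2
      + 1/4 * ((pd_t q t x)\<^sup>2 - (pd_x q t x)\<^sup>2) * exp (- 4 * (u t x + Wb W0 W1 t x))"
  have "\<bar>src\<bar> \<le> (3 * d + (2 + 2 * \<bar>W0\<bar> + exp_const W0 W1) * \<mu>) * (exp (- t / 2) * sech2 x)"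
    unfolding src_def
    by (rule metric_source_bound[OF weighted_size_bounds[OF size] less_imp_le[OF \<open>0 < \<mu>\<close>] \<open>\<mu> \<le> 1\<close> t d abb[OF t]])
  moreover have "pd_t (pd_t a) t x - (pd_x (pd_x a) t x + (1 + W0\<^sup>2) * (sech2 x)\<^sup>2) = - src"
  proof -
    have "((pd_x R t x)\<^sup>2 - (pd_t R t x)\<^sup>2) / (4 * (R t x)\<^sup>2) = ((2 * tanh (2 * x) + be t x)\<^sup>2 - (2 + al t x)\<^sup>2) / 4"
      unfolding Rq[symmetric] power_divide diff_divide_distrib[symmetric] by simp
    moreover have "u t x + Wb W0 W1 t x = W t x" "ut t x = pd_t W t x" "ux t x + W0 * sech2 x = pd_x W t x"
      by (simp_all add: u_def ut_def ux_def)
    ultimately have "src = ((pd_x R t x)\<^sup>2 - (pd_t R t x)\<^sup>2) / (4 * (R t x)\<^sup>2) + (1 + W0\<^sup>2) * (sech2 x)\<^sup>2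
        + (pd_t W t x)\<^sup>2 - (pd_x W t x)\<^sup>2 + 1/4 * ((pd_t q t x)\<^sup>2 - (pd_x q t x)\<^sup>2) * exp (- 4 * W t x)"
      unfolding src_def by (simp only:)
    moreover have "pd_t (pd_t a) t x - pd_x (pd_x a) t x
          + ((pd_x R t x)\<^sup>2 - (pd_t R t x)\<^sup>2) / (4 * (R t x)\<^sup>2)
          + (pd_t W t x)\<^sup>2 - (pd_x W t x)\<^sup>2
          + 1 / 4 * ((pd_t q t x)\<^sup>2 - (pd_x q t x)\<^sup>2) * exp (- 4 * W t x) = 0"
      using eqs[OF t, of x] by blast
    ultimately show ?thesis by linarith
  qed
  ultimately show ?thesis by (simp add: d_def)
qed

lemma exp_half_antiderivative:
  "((\<lambda>s. - 2 * \<kappa> * exp (- s / 2)) has_real_derivative \<kappa> * exp (- s / 2)) (at s within S)"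
  by (auto intro!: derivative_eq_intros)

theorem theorem3p6:
  fixes R0 W0 W1 a0 \<epsilon> :: real
  assumes "R0 > 0" and "W0 \<noteq> 0" and "\<epsilon> > 0"
  shows "\<exists>\<delta>>0. \<forall>R W q a.
    is_solution R W q a \<longrightarrow> admissible_data R0 W0 W1 R W q a \<longrightarrow>
      ((M_norm 3 W0 W1 W q 0 + m_norm 3 R0 R 0 \<le> ennreal \<delta> \<and>
        C0_norm (\<lambda>x. a 0 x - ab a0 W0 0 x)
          + L1_norm (\<lambda>x. pd_t a 0 x - pd_t (ab a0 W0) 0 x) \<le> ennreal \<delta> \<longrightarrow>
        (\<forall>t\<ge>0. C0_norm (\<lambda>x. a t x - ab a0 W0 t x) \<le> ennreal \<epsilon>)) \<and>
       (M_norm 3 W0 W1 W q 0 + m_norm 3 R0 R 0 \<le> ennreal \<delta> \<and>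
        C0_norm (\<lambda>x. pd_x a 0 x - pd_x (ab a0 W0) 0 x)
          + C0_norm (\<lambda>x. pd_t a 0 x - pd_t (ab a0 W0) 0 x) \<le> ennreal \<delta> \<longrightarrow>
        (\<forall>t\<ge>0. C0_norm (\<lambda>x. pd_x a t x - pd_x (ab a0 W0) t x)
          + C0_norm (\<lambda>x. pd_t a t x - pd_t (ab a0 W0) t x) \<le> ennreal \<epsilon>)))"
proof -
  define C where "C = 6 * (weighted_const 0 + weighted_const (2 * W0))"
  define K where "K = source_const W0 W1"
  define K2 where "K2 = 2 + 2 * \<bar>W0\<bar> + exp_const W0 W1"
  have C: "C > 0" using weighted_const_pos[of 0] weighted_const_pos[of "2 * W0"] by (simp add: C_def)
  have E: "exp_const W0 W1 > 0" by (simp add: exp_const_def)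
  then have K: "K > 0" "K2 > 0" by (auto simp: K_def source_const_def K2_def)
  \<comment> \<open>First \<open>\<mu>\<close>, so small that the quadratic terms return at most \<open>\<mu>/4\<close> and that \<open>\<mu>\<close> contributes little to the
source of the metric function; then \<open>\<delta>\<close>, so small that the data and the area function return at most
another \<open>\<mu>/4\<close>.\<close>
  define \<mu> where "\<mu> = min 1 (min (1 / (4 * C * K)) (\<epsilon> / (16 * K2)))"
  have \<mu>: "0 < \<mu>" "\<mu> \<le> 1" "C * K * \<mu> \<le> 1 / 4" "K2 * \<mu> \<le> \<epsilon> / 16"
  proof -
    show "0 < \<mu>" "\<mu> \<le> 1" using C K \<open>\<epsilon> > 0\<close> by (auto simp: \<mu>_def)
    have "\<mu> \<le> 1 / (4 * C * K)" "\<mu> \<le> \<epsilon> / (16 * K2)" by (auto simp: \<mu>_def)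
    then show "C * K * \<mu> \<le> 1 / 4" "K2 * \<mu> \<le> \<epsilon> / 16" using C K by (auto simp: field_simps)
  qed
  define Z where "Z = C * (12 + K * 12 / R0)"
  have Z: "Z > 0" using C K \<open>R0 > 0\<close> by (auto simp: Z_def intro!: mult_pos_pos add_pos_pos)
  define \<delta> where "\<delta> = min (R0 / 12) (min (\<mu> / (4 * Z)) (min (\<epsilon> / 16) (\<epsilon> * R0 / 576)))"
  have \<delta>: "\<delta> > 0" "12 * \<delta> \<le> R0" "Z * \<delta> \<le> \<mu> / 4" "\<delta> \<le> \<epsilon> / 16" "36 * \<delta> / R0 \<le> \<epsilon> / 16"
  proof -
    show "\<delta> > 0" using \<open>R0 > 0\<close> \<open>\<epsilon> > 0\<close> \<mu> Z by (auto simp: \<delta>_def)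
    have "\<delta> \<le> R0 / 12" "\<delta> \<le> \<mu> / (4 * Z)" "\<delta> \<le> \<epsilon> * R0 / 576" by (auto simp: \<delta>_def)
    then show "12 * \<delta> \<le> R0" "Z * \<delta> \<le> \<mu> / 4" "36 * \<delta> / R0 \<le> \<epsilon> / 16"
      using Z \<open>R0 > 0\<close> by (auto simp: field_simps)
    show "\<delta> \<le> \<epsilon> / 16" by (auto simp: \<delta>_def)
  qed
  have small: "6 * (weighted_const 0 + weighted_const (2 * W0)) *
       (12 * \<delta> + source_const W0 W1 * (12 * \<delta> / R0 + \<mu>\<^sup>2)) < \<mu>"
  proof -
    have "C * (12 * \<delta> + K * (12 * \<delta> / R0 + \<mu>\<^sup>2)) = Z * \<delta> + (C * K * \<mu>) * \<mu>"
      by (simp add: Z_def power2_eq_square algebra_simps)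
    also have "\<dots> \<le> \<mu> / 4 + (1 / 4) * \<mu>" using \<delta>(3) \<mu> by (intro add_mono mult_right_mono) auto
    also have "\<dots> < \<mu>" using \<mu>(1) by simp
    finally show ?thesis by (simp add: C_def K_def)
  qed
  define \<kappa> where "\<kappa> = 36 * \<delta> / R0 + K2 * \<mu>"
  have \<kappa>: "0 \<le> \<kappa>" "\<kappa> \<le> \<epsilon> / 8"
    using \<delta> \<mu> K \<open>R0 > 0\<close> by (auto simp: \<kappa>_def)
  define b where "b a = (\<lambda>t x. a t x - ab a0 W0 t x)" for a
  define bt where "bt a = (\<lambda>t x. pd_t a t x - (3/2 + W0\<^sup>2 / 2))" for a
  define bx where "bx a = (\<lambda>t x. pd_x a t x - (- (1/2 + W0\<^sup>2 / 2) * tanh (2 * x)))" for a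
  define btt where "btt a = (\<lambda>t x. pd_t (pd_t a) t x - 0)" for a
  define btx where "btx a = (\<lambda>t x. pd_x (pd_t a) t x - 0)" for a
  define bxx where "bxx a = (\<lambda>t x. pd_x (pd_x a) t x - (- (1 + W0\<^sup>2) * (sech2 x)\<^sup>2))" for a
  have b_partials: "has_partials2 (b a) (bt a) (bx a) (btt a) (btx a) (bxx a)"
    if "is_solution R W q a" for R W q a
    unfolding b_def bt_def bx_def btt_def btx_def bxx_def
    by (rule has_partials2_diff[OF C2_tx_has_partials2 ab_partials]) (use that in \<open>simp add: is_solution_def\<close>)
  have pd_ab: "pd_t (ab a0 W0) t x = 3/2 + W0\<^sup>2 / 2" "pd_x (ab a0 W0) t x = - (1/2 + W0\<^sup>2 / 2) * tanh (2 * x)"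
    if "t \<ge> 0" for t x
    using has_partials_pd[of "ab a0 W0" _ _ t x] ab_partials[of a0 W0] that by (auto simp: has_partials2_def)
  have source: "\<bar>btt a t x - bxx a t x\<bar> \<le> \<kappa> * exp (- t / 2) * sech2 x"
    if "is_solution R W q a" "M_norm 3 W0 W1 W q 0 + m_norm 3 R0 R 0 \<le> ennreal \<delta>" "t \<ge> 0" for R W q a t x
  proof -
    have "bxx a t x = pd_x (pd_x a) t x + (1 + W0\<^sup>2) * (sech2 x)\<^sup>2" "btt a t x = pd_t (pd_t a) t x"
      by (simp_all only: bxx_def btt_def mult_minus_left diff_minus_eq_add diff_zero)
    then show ?thesis
      using metric_perturbation_source[OF that(1) \<open>R0 > 0\<close> \<delta>(1,2) \<mu>(1,2) that(2) small that(3), of x]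
      by (simp only: \<kappa>_def K2_def mult.assoc)
  qed
  have C0_stable: "C0_norm (\<lambda>x. a t x - ab a0 W0 t x) \<le> ennreal \<epsilon>"
    if sol: "is_solution R W q a" and norms: "M_norm 3 W0 W1 W q 0 + m_norm 3 R0 R 0 \<le> ennreal \<delta>"
      and data: "C0_norm (\<lambda>x. a 0 x - ab a0 W0 0 x)
          + L1_norm (\<lambda>x. pd_t a 0 x - pd_t (ab a0 W0) 0 x) \<le> ennreal \<delta>" and t: "t \<ge> 0" for R W q a t
  proof (rule C0_norm_leI)
    fix x
    note bp = b_partials[OF sol]
    have c: "cont_hp (btt a)" "cont_hp (bxx a)" "cont_hp (bt a)"
      using bp by (auto simp: has_partials2_def has_partials_def)
    define F where "F s = - 4 * \<kappa> * exp (- s / 2)" for s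
    have "2 * \<bar>b a t x\<bar> \<le> \<bar>slice (bt a) t x 0\<bar> + \<bar>b a 0 (x + t)\<bar> + \<bar>b a 0 (x - t)\<bar> + (F t - F 0)"
    proof (rule wave_duhamel_bound[OF bp t])
      show "(F has_real_derivative 2 * \<kappa> * exp (- s / 2)) (at s within {0..t})" for s
        using exp_half_antiderivative[of "2 * \<kappa>" s] by (simp add: F_def[abs_def])
      fix s assume s: "0 < s" "s < t"
      have cS: "cont_hp (\<lambda>s y. \<kappa> * exp (- s / 2) * sech2 y)"
        by (intro cont_hp_intros(1,4,6,7) continuous_intros) simp_all
      have "\<bar>slice (\<lambda>s y. btt a s y - bxx a s y) t x s\<bar> \<le> slice (\<lambda>s y. \<kappa> * exp (- s / 2) * sech2 y) t x s"
        by (rule slice_abs_le[OF cont_hp_intros(3)[OF c(1,2)] cS]) (use s source[OF sol norms] in auto)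
      also have "\<dots> = \<kappa> * exp (- s / 2) * slice (\<lambda>s y. sech2 y) t x s"
        by (simp only: slice_def integral_mult_right mult.left_commute[of "t - s"])
      also have "\<dots> \<le> \<kappa> * exp (- s / 2) * 2"
      proof (rule mult_left_mono)
        have "arctan (exp (2 * (x + (t - s)))) < pi / 2" "0 < arctan (exp (2 * (x - (t - s))))"
          by (rule arctan_ubound) simp
        then show "slice (\<lambda>s y. sech2 y) t x s \<le> 2"
          unfolding slice_antiderivative[OF arctan_exp_has_derivative] using pi_half_less_two by linarith
      qed (use \<kappa>(1) in simp)
      finally show "\<bar>slice (\<lambda>s y. btt a s y - bxx a s y) t x s\<bar> \<le> 2 * \<kappa> * exp (- s / 2)"
        by (simp only: mult_ac)
    qed
    moreover have "F t - F 0 \<le> 4 * \<kappa>" using \<kappa>(1) by (simp add: F_def)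
    moreover have "\<bar>b a 0 y\<bar> \<le> \<delta>" for y
      using C0_norm_le_imp[OF ennreal_add_leD(1)[OF data], of y] \<delta>(1) by (simp add: b_def)
    moreover have "\<bar>slice (bt a) t x 0\<bar> \<le> \<delta>"
    proof -
      have cb: "continuous_on UNIV (bt a 0)"
        by (rule cont_hp_compose[OF c(3)]) (auto intro!: continuous_intros)
      have "\<bar>slice (bt a) t x 0\<bar> \<le> slice (\<lambda>s y. \<bar>bt a 0 y\<bar>) t x 0"
        by (rule slice_abs_le[OF c(3) cont_hp_intros(6)]) (use t cb in \<open>auto intro!: continuous_intros\<close>)
      also have "\<dots> \<le> \<delta>"
        by (rule slice_le_L1_norm[OF cb]) (use ennreal_add_leD(2)[OF data] \<delta>(1) t pd_ab(1) in \<open>simp_all add: bt_def\<close>)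
      finally show ?thesis .
    qed
    ultimately have "2 * \<bar>b a t x\<bar> \<le> \<delta> + \<delta> + \<delta> + 4 * \<kappa>" by (smt (verit))
    then show "\<bar>a t x - ab a0 W0 t x\<bar> \<le> \<epsilon>"
      using \<delta>(1,4) \<kappa> \<open>\<epsilon> > 0\<close> unfolding b_def by simp
  qed
  have C1_stable: "C0_norm (\<lambda>x. pd_x a t x - pd_x (ab a0 W0) t x)
          + C0_norm (\<lambda>x. pd_t a t x - pd_t (ab a0 W0) t x) \<le> ennreal \<epsilon>"
    if sol: "is_solution R W q a" and norms: "M_norm 3 W0 W1 W q 0 + m_norm 3 R0 R 0 \<le> ennreal \<delta>"
      and data: "C0_norm (\<lambda>x. pd_x a 0 x - pd_x (ab a0 W0) 0 x)
          + C0_norm (\<lambda>x. pd_t a 0 x - pd_t (ab a0 W0) 0 x) \<le> ennreal \<delta>" and t: "t \<ge> 0" for R W q a t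
  proof -
    note bp = b_partials[OF sol]
    define F where "F s = - 2 * \<kappa> * exp (- s / 2)" for s
    have d0: "\<bar>bx a 0 y\<bar> \<le> \<delta>" "\<bar>bt a 0 y\<bar> \<le> \<delta>" for y
      using C0_norm_le_imp[OF ennreal_add_leD(1)[OF data], of y] C0_norm_le_imp[OF ennreal_add_leD(2)[OF data], of y]
        \<delta>(1) by (simp_all add: bx_def bt_def pd_ab)
    have tr: "\<bar>bt a t x + c * bx a t x\<bar> \<le> 2 * \<delta> + 2 * \<kappa>" if c: "c = 1 \<or> c = -1" for c x
    proof -
      have "\<bar>bt a t x + c * bx a t x\<bar> \<le> \<bar>bt a 0 (x + c * t)\<bar> + \<bar>bx a 0 (x + c * t)\<bar> + (F t - F 0)"
      proof (rule transport_bound[OF bp t c])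
        show "(F has_real_derivative \<kappa> * exp (- s / 2)) (at s within {0..t})" for s
          unfolding F_def[abs_def] by (rule exp_half_antiderivative)
        fix s assume s: "0 < s" "s < t"
        let ?y = "x + c * (t - s)"
        have "\<bar>btt a s ?y - bxx a s ?y\<bar> \<le> \<kappa> * exp (- s / 2) * sech2 ?y"
          by (rule source[OF sol norms]) (use s in simp)
        also have "\<dots> \<le> \<kappa> * exp (- s / 2) * 1"
          using \<kappa>(1) sech2_bounds[of ?y] by (intro mult_left_mono) auto
        finally show "\<bar>btt a s ?y - bxx a s ?y\<bar> \<le> \<kappa> * exp (- s / 2)" by simp
      qed
      moreover have "F t - F 0 \<le> 2 * \<kappa>" using \<kappa>(1) by (simp add: F_def)
      ultimately show ?thesis using d0[of "x + c * t"] by linarith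
    qed
    have bound: "2 * \<delta> + 2 * \<kappa> \<le> \<epsilon> / 2" using \<delta>(4) \<kappa> \<open>\<epsilon> > 0\<close> by simp
    have "\<bar>bt a t x\<bar> \<le> \<epsilon> / 2" "\<bar>bx a t x\<bar> \<le> \<epsilon> / 2" for x
    proof -
      have "\<bar>bt a t x + bx a t x\<bar> \<le> \<epsilon> / 2" "\<bar>bt a t x - bx a t x\<bar> \<le> \<epsilon> / 2"
        using order_trans[OF tr[of 1 x] bound] order_trans[OF tr[of "-1" x] bound] by simp_all
      then show "\<bar>bt a t x\<bar> \<le> \<epsilon> / 2" "\<bar>bx a t x\<bar> \<le> \<epsilon> / 2"
        unfolding abs_le_iff by linarith+
    qed
    then have "C0_norm (bx a t) \<le> ennreal (\<epsilon> / 2)" "C0_norm (bt a t) \<le> ennreal (\<epsilon> / 2)"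
      by (auto intro: C0_norm_leI)
    then have "C0_norm (bx a t) + C0_norm (bt a t) \<le> ennreal (\<epsilon> / 2) + ennreal (\<epsilon> / 2)"
      by (rule add_mono)
    also have "\<dots> = ennreal \<epsilon>" using \<open>\<epsilon> > 0\<close> by (simp flip: ennreal_plus)
    finally show ?thesis using t by (simp add: bx_def bt_def pd_ab)
  qed
  show ?thesis
    by (intro exI[of _ \<delta>] conjI \<delta>(1) allI impI) (use C0_stable C1_stable in blast)+
qed

end
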